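(* Let $n\in\mathbb{N}$, $0<\alpha<n$, and let $f$ be a non-negative measurable function on $\mathbb{R}^n$. Then the following statements are equivalent. (i) $I_\alpha f\in BMO(\mathbb{R}^n)$; (ii) $I_\alpha f\in BMO^\beta(\mathbb{R}^n)$ for every $\beta\in(n-\alpha,n]$; (iii) for every $\beta\in(n-\alpha,n]$, $\|I_\alpha f\|_{BMO^\beta(\mathbb{R}^n)}<\infty$ and there exist constants $c_1,c_2>0$ depending only on $\beta$ (and the fixed dimension $n$) such that for every cube $Q\subseteq\mathbb{R}^n$ there is $c_Q\in\mathbb{R}$ with $$\mathcal{H}^\beta_\infty(\{x\in Q:|I_\alpha f(x)-c_Q|>\lambda\})\le c_1\,\ell(Q)^\beta\exp\left(-c_2\lambda/\|I_\alpha f\|_{BMO^\beta(\mathbb{R}^n)}\right)\quad\text{for all }\lambda>0$$ (the right-hand side being read as $0$ if $\|I_\alpha f\|_{BMO^\beta(\mathbb{R}^n)}=0$); (iv) for every $\beta\in(n-\alpha,n]$, there exist constants $\gamma,C'>0$ independent of $Q$ such that for every cube $Q\subseteq\mathbb{R}^n$ there is $c_Q\in\mathbb{R}$ with $$\int_Q\exp\left(\gamma|I_\alpha f-c_Q|\right)d\mathcal{H}^\beta_\infty\le C'\ell(Q)^\beta;$$ (v) for every $\beta\in(n-\alpha,n]$ and every $p\in[1,\infty)$, $$\|I_\alpha f\|_{BMO^{\beta,p}(\mathbb{R}^n)}:=\sup_{Q\subset\mathbb{R}^n}\inf_{c\in\mathbb{R}}\left(\frac{1}{\ell(Q)^\beta}\int_Q|I_\alpha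 f-c|^p\,d\mathcal{H}^\beta_\infty\right)^{1/p}<\infty;$$ (vi) $f\in\mathcal{M}^\alpha_1(\mathbb{R}^n)$ and $I_\alpha f\in L^1_{loc}(\mathbb{R}^n)$.
   Context: Riesz potential: $I_\alpha f(x)=\frac{1}{\gamma(\alpha)}\int_{\mathbb{R}^n}\frac{f(y)}{|x-y|^{n-\alpha}}\,dy\in[0,\infty]$, with $\gamma(\alpha)>0$ the usual normalization constant. Morrey space: $\mathcal{M}^\alpha_1(\mathbb{R}^n)$ is the set of measurable $f$ with $\sup_Q\ell(Q)^{\alpha-n}\int_Q|f|\,dy<\infty$, the supremum over all cubes $Q\subseteq\mathbb{R}^n$ with side length $\ell(Q)$. For $0<\beta\le n$, the Hausdorff content of $E\subseteq\mathbb{R}^n$ is $\mathcal{H}^\beta_\infty(E)=\inf\{\sum_{i}\omega_\beta r_i^\beta: E\subset\bigcup_{i=1}^\infty B(x_i,r_i)\}$, $\omega_\beta=\pi^{\beta/2}/\Gamma(\beta/2+1)$. For non-negative $g$, the Choquet integral is $\int_\Omega g\,d\mathcal{H}^\beta_\infty=\int_0^\infty\mathcal{H}^\beta_\infty(\{x\in\Omega:g(x)>t\})\,dt$. Here $\Omega$ is $\mathbb{R}^n$ or an open cube. A function $g$ on $\Omega$ is $\mathcal{H}^\beta_\infty$-quasicontinuous if for every $\epsilon>0$ there is an open set $O\subseteq\Omega$ with $\mathcal{H}^\beta_\infty(O)<\epsilon$ such that $g$ restricted to $\Omega\setminus O$ is continuous; functions need only be defined and finite outside a set of zero $\mathcal{H}^\beta_\infty$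 content. $L^1(\Omega;\mathcal{H}^\beta_\infty)$ is the set of $\mathcal{H}^\beta_\infty$-quasicontinuous $g$ with $\int_\Omega|g|\,d\mathcal{H}^\beta_\infty<\infty$, and $g\in L^1_{loc}(\mathbb{R}^n;\mathcal{H}^\beta_\infty)$ means $g|_Q\in L^1(Q;\mathcal{H}^\beta_\infty)$ for every (finite, open) cube $Q$. $BMO^\beta(\mathbb{R}^n)$ is the set of $u\in L^1_{loc}(\mathbb{R}^n;\mathcal{H}^\beta_\infty)$ with $$\|u\|_{BMO^\beta(\mathbb{R}^n)}:=\sup_{Q\subseteq\mathbb{R}^n}\inf_{c\in\mathbb{R}}\frac{1}{\ell(Q)^\beta}\int_Q|u-c|\,d\mathcal{H}^\beta_\infty<\infty,$$ the supremum being over all finite cubes $Q$. $BMO(\mathbb{R}^n)$ is the usual space of $u\in L^1_{loc}(\mathbb{R}^n)$ (Lebesgue measure) with $\|u\|_{BMO(\mathbb{R}^n)}=\sup_Q\inf_{c}\frac{1}{\ell(Q)^n}\int_Q|u-c|\,dx<\infty$ (up to equivalent norm). *)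

theory Defs
  imports "HOL-Analysis.Analysis"
begin

definition TFAE :: "bool list \<Rightarrow> bool" where
  "TFAE Ps \<longleftrightarrow> (\<forall>P\<in>set Ps. \<forall>Q\<in>set Ps. P \<longleftrightarrow> Q)"

text \<open>Cubes are open, with sides parallel to the coordinate axes; \<open>a\<close> is the lower corner and \<open>l\<close>
  the side length. Users of \<open>cube\<close> must require \<open>l > 0\<close>.\<close>

definition cube :: "'a::euclidean_space \<Rightarrow> real \<Rightarrow> 'a set" where
  "cube a l = box a (a + l *\<^sub>R One)"


subsection \<open>Riesz potentials and Morrey spaces\<close>

definition riesz_const :: "nat \<Rightarrow> real \<Rightarrow> real" where
  "riesz_const n \<alpha> =
     pi powr (real n / 2) * 2 powr \<alpha> * Gamma (\<alpha> / 2) / Gamma ((real n - \<alpha>) / 2)"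

text \<open>For \<open>f \<ge> 0\<close> the potential has values in \<open>[0,\<infinity>]\<close>; it is typed as a function into \<open>ereal\<close>
  because the oscillation spaces below consist of signed functions. At the single point \<open>y = x\<close> the
  integrand is \<open>0\<close>, since \<open>z / 0 = 0\<close>; this does not affect the integral.\<close>

definition riesz_potential :: "real \<Rightarrow> ('a::euclidean_space \<Rightarrow> real) \<Rightarrow> 'a \<Rightarrow> ereal" where
  "riesz_potential \<alpha> f x = enn2ereal
     (ennreal (1 / riesz_const DIM('a) \<alpha>) *
      (\<integral>\<^sup>+ y. ennreal (f y / norm (x - y) powr (real DIM('a) - \<alpha>)) \<partial>lebesgue))"

definition morrey :: "real \<Rightarrow> ('a::euclidean_space \<Rightarrow> real) set" where
  "morrey \<alpha> = {f. f \<in> borel_measurable lebesgue \<and>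
     (SUP a. SUP l\<in>{0<..}. ennreal (l powr (\<alpha> - real DIM('a))) *
        (\<integral>\<^sup>+ y\<in>cube a l. ennreal \<bar>f y\<bar> \<partial>lebesgue)) < \<infinity>}"


subsection \<open>Functions on \<open>[0,\<infinity>]\<close>\<close>

definition powr_ennreal :: "ennreal \<Rightarrow> real \<Rightarrow> ennreal" where
  "powr_ennreal x p = (if x = \<infinity> then \<infinity> else ennreal (enn2real x powr p))"

definition exp_ennreal :: "ennreal \<Rightarrow> ennreal" where
  "exp_ennreal x = (if x = \<infinity> then \<infinity> else ennreal (exp (enn2real x)))"

text \<open>The pointwise deviation \<open>|u(x) - c|\<close>, which is \<open>\<infinity>\<close> where \<open>u\<close> is infinite.\<close>

definition dev :: "('a \<Rightarrow> ereal) \<Rightarrow> real \<Rightarrow> 'a \<Rightarrow> ennreal" where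
  "dev u c x = e2ennreal \<bar>u x - ereal c\<bar>"


subsection \<open>Hausdorff content and the Choquet integral\<close>

text \<open>Radius \<open>0\<close> gives the empty ball, so finite covers are included.
  \<open>unit_ball_vol \<beta>\<close> is \<open>\<pi>\<^bsup>\<beta>/2\<^esup> / \<Gamma>(\<beta>/2 + 1)\<close> for every real \<open>\<beta>\<close>.\<close>

definition hausdorff_content :: "real \<Rightarrow> 'a::euclidean_space set \<Rightarrow> ennreal" where
  "hausdorff_content \<beta> E =
     Inf {(\<Sum>i. ennreal (unit_ball_vol \<beta> * r i powr \<beta>)) | (x :: nat \<Rightarrow> 'a) r.
            (\<forall>i. 0 \<le> r i) \<and> E \<subseteq> (\<Union>i. ball (x i) (r i))}"

definition choquet :: "real \<Rightarrow> 'a::euclidean_space set \<Rightarrow> ('a \<Rightarrow> ennreal) \<Rightarrow> ennreal" where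
  "choquet \<beta> \<Omega> g = (\<integral>\<^sup>+ t\<in>{0<..}. hausdorff_content \<beta> {x \<in> \<Omega>. g x > ennreal t} \<partial>lborel)"

text \<open>A function that is defined and finite only outside a set of zero content is represented by an
  \<open>ereal\<close>-valued function. Its restriction to \<open>\<Omega> - U\<close> is required to be finite as well as
  continuous. Letting \<open>\<epsilon> \<rightarrow> 0\<close> this makes the exceptional set have zero content; conversely, an
  exceptional set of zero content can be absorbed into \<open>U\<close>, having open neighbourhoods of
  arbitrarily small content.\<close>

definition quasicontinuous_on :: "real \<Rightarrow> 'a::euclidean_space set \<Rightarrow> ('a \<Rightarrow> ereal) \<Rightarrow> bool" where
  "quasicontinuous_on \<beta> \<Omega> g \<longleftrightarrow>
     (\<forall>\<epsilon>>0. \<exists>U. open U \<and> U \<subseteq> \<Omega> \<and> hausdorff_content \<beta> U < ennreal \<epsilon> \<and>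
        (\<forall>x\<in>\<Omega> - U. \<bar>g x\<bar> \<noteq> \<infinity>) \<and> continuous_on (\<Omega> - U) g)"

definition L1_content :: "real \<Rightarrow> 'a::euclidean_space set \<Rightarrow> ('a \<Rightarrow> ereal) set" where
  "L1_content \<beta> \<Omega> =
     {g. quasicontinuous_on \<beta> \<Omega> g \<and> choquet \<beta> \<Omega> (\<lambda>x. e2ennreal \<bar>g x\<bar>) < \<infinity>}"

definition L1loc_content :: "real \<Rightarrow> ('a::euclidean_space \<Rightarrow> ereal) set" where
  "L1loc_content \<beta> = {g. \<forall>a. \<forall>l>0. g \<in> L1_content \<beta> (cube a l)}"


subsection \<open>Bounded mean oscillation\<close>

definition bmo_content_norm :: "real \<Rightarrow> ('a::euclidean_space \<Rightarrow> ereal) \<Rightarrow> ennreal" where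
  "bmo_content_norm \<beta> u =
     (SUP a. SUP l\<in>{0<..}. INF c. choquet \<beta> (cube a l) (dev u c) / ennreal (l powr \<beta>))"

definition BMO_content :: "real \<Rightarrow> ('a::euclidean_space \<Rightarrow> ereal) set" where
  "BMO_content \<beta> = {u \<in> L1loc_content \<beta>. bmo_content_norm \<beta> u < \<infinity>}"

definition bmo_content_p_norm ::
    "real \<Rightarrow> real \<Rightarrow> ('a::euclidean_space \<Rightarrow> ereal) \<Rightarrow> ennreal" where
  "bmo_content_p_norm \<beta> p u =
     (SUP a. SUP l\<in>{0<..}. INF c. powr_ennreal
        (choquet \<beta> (cube a l) (\<lambda>x. powr_ennreal (dev u c x) p) / ennreal (l powr \<beta>)) (1 / p))"

definition L1loc_lebesgue :: "('a::euclidean_space \<Rightarrow> ereal) set" where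
  "L1loc_lebesgue = {u. u \<in> borel_measurable lebesgue \<and>
     (\<forall>K. compact K \<longrightarrow> (\<integral>\<^sup>+ x\<in>K. e2ennreal \<bar>u x\<bar> \<partial>lebesgue) < \<infinity>)}"

definition bmo_norm :: "('a::euclidean_space \<Rightarrow> ereal) \<Rightarrow> ennreal" where
  "bmo_norm u =
     (SUP a. SUP l\<in>{0<..}. INF c.
        (\<integral>\<^sup>+ x\<in>cube a l. dev u c x \<partial>lebesgue) / ennreal (l ^ DIM('a)))"

definition BMO :: "('a::euclidean_space \<Rightarrow> ereal) set" where
  "BMO = {u \<in> L1loc_lebesgue. bmo_norm u < \<infinity>}"

end

theory Submission
  imports Defs "HOL-Real_Asymp.Real_Asymp"
begin

text \<open>
  Up to a constant, \<open>I\<^sub>\<alpha> f\<close> is the potential of a measure \<open>\<mu>\<close> with kernel \<open>|x|\<^bsup>-s\<^esup>\<close>, \<open>s = n - \<alpha>\<close>, and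
  \<open>f\<close> is a Morrey function iff \<open>\<mu> (B(x, r)) \<le> M r\<^sup>s\<close> for all balls.

  The John-Nirenberg inequality holds for arbitrary functions under a mere weak-type bound on the
  oscillation: a cover of the bad set by balls is replaced by a sparser cover by balls at which the
  mass of the original cover just becomes critical, and a Vitali selection keeps the sum of the
  \<open>r\<^sup>\<beta>\<close> under control. No density theorem and no quasicontinuity is involved.

  Under the Morrey condition the weak-type bound follows by truncating the kernel at the scale of the cube:
  the truncated potential oscillates by at most \<open>O(M)\<close>, and the remainder is controlled by a fractional
  maximal function of order \<open>\<beta> > s\<close>. Conversely, a BMO potential has almost the same average over
  concentric cubes, up to a logarithm of the ratio of the sides; testing this with geometric weights
  which decay slowly enough yields a nonnegative kernel, bounded below near its centre, and thus
  the Morrey condition.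
\<close>

subsection \<open>Hausdorff content and a Vitali covering estimate\<close>

text \<open>Hausdorff content is only subadditive, so oscillations cannot be compared through
  averages. The substitute is a common good point: if two exceptional sets together have less
  content than a ball, some point of the ball avoids both, and there the two constants are compared
  pointwise. The lower bound for the content of balls makes this quantitative.

  The constants in (iii) may depend on \<beta> and n only, so they cannot come from the Morrey
  bound: the John-Nirenberg estimate is applied again to the BMO seminorm itself, with a rate
  inversely proportional to it. A vanishing seminorm needs its own argument, because an infimum over
  c need not be attained.

  In the return from BMO no limit of the averages over growing cubes is known. This is why a whole
  mixture of averages is subtracted from a single one: its weights have total mass 1, they sum the
  logarithmic drift, and the mixture is finite, so that it can be cancelled.\<close>

lemma hausdorff_content_mono: "A \<subseteq> B \<Longrightarrow> hausdorff_content \<beta> A \<le> hausdorff_content \<beta> B"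
  unfolding hausdorff_content_def by (rule Inf_superset_mono) (blast intro: order_trans)

lemma hausdorff_content_cover:
  assumes "\<And>i. 0 \<le> r i" "E \<subseteq> (\<Union>i::nat. ball (x i) (r i))"
  shows "hausdorff_content \<beta> E \<le> (\<Sum>i. ennreal (unit_ball_vol \<beta> * r i powr \<beta>))"
  unfolding hausdorff_content_def using assms by (intro Inf_lower) blast

lemma hausdorff_content_lessE:
  fixes E :: "'a::euclidean_space set"
  assumes "hausdorff_content \<beta> E < t"
  obtains x :: "nat \<Rightarrow> 'a" and r where "\<And>i. 0 \<le> r i" "E \<subseteq> (\<Union>i. ball (x i) (r i))"
    "(\<Sum>i. ennreal (unit_ball_vol \<beta> * r i powr \<beta>)) < t"
  using assms unfolding hausdorff_content_def Inf_less_iff by blast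

lemma hausdorff_content_empty [simp]: "hausdorff_content \<beta> {} = 0"
  using hausdorff_content_cover[of "\<lambda>_. 0" "{}" "\<lambda>_. 0" \<beta>] by simp

lemma hausdorff_content_countable_subadditive:
  fixes E :: "nat \<Rightarrow> 'a::euclidean_space set"
  shows "hausdorff_content \<beta> (\<Union>i. E i) \<le> (\<Sum>i. hausdorff_content \<beta> (E i))"
proof (cases "(\<Sum>i. hausdorff_content \<beta> (E i)) = \<infinity>")
  case False
  have fin: "hausdorff_content \<beta> (E i) < \<infinity>" for i
  proof -
    have "(\<Sum>j\<in>{i}. hausdorff_content \<beta> (E j)) \<le> (\<Sum>i. hausdorff_content \<beta> (E i))"
      by (rule sum_le_suminf) auto
    then show ?thesis using False by (auto simp: top.not_eq_extremum order_le_less_trans)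
  qed
  show ?thesis
  proof (rule ennreal_le_epsilon)
    fix e :: real assume e: "0 < e"
    have "\<exists>x r. (\<forall>j. 0 \<le> r j) \<and> E i \<subseteq> (\<Union>j. ball (x j) (r j)) \<and>
        (\<Sum>j. ennreal (unit_ball_vol \<beta> * r j powr \<beta>)) \<le> hausdorff_content \<beta> (E i) + ennreal (e * (1/2) ^ Suc i)"
      for i
    proof -
      have "hausdorff_content \<beta> (E i) + 0 < hausdorff_content \<beta> (E i) + ennreal (e * (1/2) ^ Suc i)"
        using fin[of i] e by (subst ennreal_add_left_cancel_less) auto
      then have "hausdorff_content \<beta> (E i) < hausdorff_content \<beta> (E i) + ennreal (e * (1/2) ^ Suc i)"
        by simp
      then show ?thesis
        by (elim hausdorff_content_lessE) (blast intro: less_imp_le)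
    qed
    then have "\<forall>i. \<exists>x r. (\<forall>j. 0 \<le> r j) \<and> E i \<subseteq> (\<Union>j. ball (x j) (r j)) \<and>
        (\<Sum>j. ennreal (unit_ball_vol \<beta> * r j powr \<beta>)) \<le> hausdorff_content \<beta> (E i) + ennreal (e * (1/2) ^ Suc i)"
      by blast
    from this[THEN choice] obtain x where "\<forall>i. \<exists>r. (\<forall>j. 0 \<le> r j) \<and> E i \<subseteq> (\<Union>j. ball (x i j) (r j)) \<and>
        (\<Sum>j. ennreal (unit_ball_vol \<beta> * r j powr \<beta>)) \<le> hausdorff_content \<beta> (E i) + ennreal (e * (1/2) ^ Suc i)"
      by blast
    from this[THEN choice] obtain r where xr: "\<And>i j. 0 \<le> r i j" "\<And>i. E i \<subseteq> (\<Union>j::nat. ball (x i j) (r i j))"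
        "\<And>i. (\<Sum>j. ennreal (unit_ball_vol \<beta> * r i j powr \<beta>)) \<le> hausdorff_content \<beta> (E i) + ennreal (e * (1/2) ^ Suc i)"
      by blast
    define p where "p = (\<lambda>k. prod_decode k)"
    have cov: "(\<Union>i. E i) \<subseteq> (\<Union>k. ball (x (fst (p k)) (snd (p k))) (r (fst (p k)) (snd (p k))))"
    proof
      fix y assume "y \<in> (\<Union>i. E i)"
      then obtain i j where "y \<in> ball (x i j) (r i j)" using xr(2) by blast
      then show "y \<in> (\<Union>k. ball (x (fst (p k)) (snd (p k))) (r (fst (p k)) (snd (p k))))"
        by (intro UN_I[of "prod_encode (i, j)"]) (auto simp: p_def)
    qed
    have "hausdorff_content \<beta> (\<Union>i. E i) \<le> (\<Sum>k. ennreal (unit_ball_vol \<beta> * r (fst (p k)) (snd (p k)) powr \<beta>))"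
      by (rule hausdorff_content_cover[OF _ cov]) (use xr in auto)
    also have "\<dots> = (\<Sum>i. \<Sum>j. ennreal (unit_ball_vol \<beta> * r i j powr \<beta>))"
      using suminf_ennreal_2dimen[of "\<lambda>i. (\<Sum>j. ennreal (unit_ball_vol \<beta> * r i j powr \<beta>))"
          "\<lambda>z. ennreal (unit_ball_vol \<beta> * r (fst z) (snd z) powr \<beta>)"] by (simp add: p_def)
    also have "\<dots> \<le> (\<Sum>i. hausdorff_content \<beta> (E i) + ennreal (e * (1/2) ^ Suc i))"
      by (intro suminf_le xr) auto
    also have "\<dots> = (\<Sum>i. hausdorff_content \<beta> (E i)) + (\<Sum>i. ennreal (e * (1/2) ^ Suc i))"
      by (rule suminf_add[symmetric]) auto
    also have "(\<Sum>i. ennreal (e * (1/2) ^ Suc i)) = ennreal e"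
      using e sums_mult[OF power_half_series, of e] by (intro suminf_ennreal_eq) auto
    finally show "hausdorff_content \<beta> (\<Union>i. E i) \<le> (\<Sum>i. hausdorff_content \<beta> (E i)) + ennreal e" .
  qed
qed auto

lemma hausdorff_content_subadditive:
  "hausdorff_content \<beta> (A \<union> B) \<le> hausdorff_content \<beta> A + hausdorff_content \<beta> B"
proof -
  define E where "E = (\<lambda>i::nat. if i = 0 then A else if i = 1 then B else {})"
  have "A \<union> B = (\<Union>i. E i)"
    by (auto simp: E_def split: if_splits)
  then have "hausdorff_content \<beta> (A \<union> B) \<le> (\<Sum>i. hausdorff_content \<beta> (E i))"
    using hausdorff_content_countable_subadditive[of \<beta> E] by simp
  also have "\<dots> = (\<Sum>i\<in>{0,1}. hausdorff_content \<beta> (E i))"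
    by (rule suminf_finite) (auto simp: E_def)
  also have "\<dots> = hausdorff_content \<beta> A + hausdorff_content \<beta> B"
    by (simp add: E_def)
  finally show ?thesis .
qed

lemma hausdorff_content_ball_le:
  assumes "0 \<le> R"
  shows "hausdorff_content \<beta> (ball x R) \<le> ennreal (unit_ball_vol \<beta> * R powr \<beta>)"
proof -
  have "hausdorff_content \<beta> (ball x R) \<le>
      (\<Sum>i. ennreal (unit_ball_vol \<beta> * (if i = 0 then R else 0) powr \<beta>))"
    by (rule hausdorff_content_cover[where x="\<lambda>_. x"]) (use assms in \<open>auto split: if_splits\<close>)
  also have "\<dots> = (\<Sum>i\<in>{0::nat}. ennreal (unit_ball_vol \<beta> * (if i = 0 then R else 0) powr \<beta>))"
    by (rule suminf_finite) auto
  finally show ?thesis by simp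
qed

text \<open>If every radius of a cover is below \<open>R\<close>, then \<open>r\<^sup>n \<le> R\<^bsup>n-\<beta>\<^esup> r\<^sup>\<beta>\<close> and the claim follows by
  comparing volumes.\<close>

lemma hausdorff_content_ball_ge:
  fixes x :: "'a::euclidean_space" and \<beta> :: real
  assumes "0 < \<beta>" "\<beta> \<le> DIM('a)" "0 < R"
  shows "ennreal (unit_ball_vol \<beta> * R powr \<beta>) \<le> hausdorff_content \<beta> (ball x R)"
  unfolding hausdorff_content_def
proof (rule Inf_greatest, safe)
  fix y :: "nat \<Rightarrow> 'a" and r assume r: "\<forall>i. 0 \<le> r i" and cov: "ball x R \<subseteq> (\<Union>i. ball (y i) (r i))"
  define n where "n = real DIM('a)"
  show "ennreal (unit_ball_vol \<beta> * R powr \<beta>) \<le> (\<Sum>i. ennreal (unit_ball_vol \<beta> * r i powr \<beta>))"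
  proof (cases "\<exists>i. R \<le> r i")
    case True
    then obtain i where i: "R \<le> r i" by auto
    have "ennreal (unit_ball_vol \<beta> * R powr \<beta>) \<le> (\<Sum>j\<in>{i}. ennreal (unit_ball_vol \<beta> * r j powr \<beta>))"
      using i assms by (auto intro!: ennreal_leI mult_left_mono powr_mono2)
    also have "\<dots> \<le> (\<Sum>i. ennreal (unit_ball_vol \<beta> * r i powr \<beta>))"
      by (rule sum_le_suminf) auto
    finally show ?thesis .
  next
    case False
    have pw: "t ^ DIM('a) = t powr (n - \<beta>) * t powr \<beta>" if "t > 0" for t
      using that by (simp add: n_def flip: powr_add powr_realpow)
    have le: "r i ^ DIM('a) \<le> R powr (n - \<beta>) * r i powr \<beta>" for i
    proof (cases "r i = 0")
      case False
      then have "0 < r i" using r by (simp add: less_le)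
      then show ?thesis
        using assms \<open>\<not> (\<exists>i. R \<le> r i)\<close> pw[of "r i"]
        by (auto intro!: mult_right_mono powr_mono2 simp: n_def not_le less_imp_le)
    qed (simp add: power_0_left)
    have v: "0 < unit_ball_vol n" "0 < unit_ball_vol \<beta>" using assms by (auto simp: n_def)
    have "ennreal (unit_ball_vol n * R ^ DIM('a)) = emeasure lborel (ball x R)"
      using assms by (simp add: emeasure_ball n_def)
    also have "\<dots> \<le> emeasure lborel (\<Union>i. ball (y i) (r i))"
      by (rule emeasure_mono[OF cov]) auto
    also have "\<dots> \<le> (\<Sum>i. emeasure lborel (ball (y i) (r i)))"
      by (rule emeasure_subadditive_countably) auto
    also have "\<dots> = (\<Sum>i. ennreal (unit_ball_vol n * r i ^ DIM('a)))"
      using r by (simp add: emeasure_ball n_def)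
    also have "\<dots> \<le> (\<Sum>i. ennreal (unit_ball_vol n * R powr (n - \<beta>) / unit_ball_vol \<beta>) *
        ennreal (unit_ball_vol \<beta> * r i powr \<beta>))"
      using v le by (intro suminf_le) (auto simp flip: ennreal_mult' intro!: ennreal_leI)
    also have "\<dots> = ennreal (unit_ball_vol n * R powr (n - \<beta>) / unit_ball_vol \<beta>) *
       (\<Sum>i. ennreal (unit_ball_vol \<beta> * r i powr \<beta>))" by simp
    finally have *: "ennreal (unit_ball_vol n * R ^ DIM('a)) \<le> \<dots>" .
    define c where "c = unit_ball_vol n * R powr (n - \<beta>) / unit_ball_vol \<beta>"
    have c: "0 < c" using v assms by (simp add: c_def)
    have "unit_ball_vol \<beta> * R powr \<beta> = inverse c * (unit_ball_vol n * R ^ DIM('a))"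
      using v assms by (simp add: pw c_def field_simps)
    then have "ennreal (unit_ball_vol \<beta> * R powr \<beta>) = ennreal (inverse c) * ennreal (unit_ball_vol n * R ^ DIM('a))"
      using c by (simp add: ennreal_mult')
    also have "\<dots> \<le> ennreal (inverse c) * (ennreal c * (\<Sum>i. ennreal (unit_ball_vol \<beta> * r i powr \<beta>)))"
      using * unfolding c_def by (rule mult_left_mono) auto
    also have "\<dots> = ennreal (inverse c * c) * (\<Sum>i. ennreal (unit_ball_vol \<beta> * r i powr \<beta>))"
      using c by (simp only: ennreal_mult mult.assoc less_imp_le inverse_nonnegative_iff_nonnegative)
    also have "inverse c * c = 1" using c by simp
    also have "ennreal 1 * (\<Sum>i. ennreal (unit_ball_vol \<beta> * r i powr \<beta>)) = (\<Sum>i. ennreal (unit_ball_vol \<beta> * r i powr \<beta>))"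
      by simp
    finally show ?thesis .
  qed
qed

text \<open>With the normalisation \<open>unit_ball_vol\<close> the terms of a cover are, at \<beta>
  = n, exactly the volumes of its balls, so countable subadditivity of Lebesgue measure gives the
  constant 1.\<close>

lemma emeasure_lborel_le_hausdorff_content:
  fixes S :: "'a::euclidean_space set"
  assumes "S \<in> sets borel"
  shows "emeasure lborel S \<le> hausdorff_content (real DIM('a)) S"
  unfolding hausdorff_content_def
proof (rule Inf_greatest, safe)
  fix y :: "nat \<Rightarrow> 'a" and r assume r: "\<forall>i. 0 \<le> r i" and cov: "S \<subseteq> (\<Union>i. ball (y i) (r i))"
  have "emeasure lborel S \<le> emeasure lborel (\<Union>i. ball (y i) (r i))"
    by (rule emeasure_mono[OF cov]) auto
  also have "\<dots> \<le> (\<Sum>i. emeasure lborel (ball (y i) (r i)))"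
    by (rule emeasure_subadditive_countably) auto
  also have "\<dots> = (\<Sum>i. ennreal (unit_ball_vol (real DIM('a)) * r i powr real DIM('a)))"
    using r by (simp add: emeasure_ball powr_realpow')
  finally show "emeasure lborel S \<le> \<dots>" .
qed

lemma vitali_disjoint_sum:
  fixes a :: "'i \<Rightarrow> 'a::euclidean_space"
  assumes "sets m = sets borel" "0 < \<eta>"
    and R: "\<And>i. i \<in> K \<Longrightarrow> 0 < R i \<and> R i \<le> B"
    and mass: "\<And>i. i \<in> K \<Longrightarrow> ennreal (\<eta> * R i powr \<beta>) \<le> emeasure m (ball (a i) (R i))"
  obtains x :: "nat \<Rightarrow> 'a" and r where
    "\<And>j. r j = 0 \<or> (\<exists>i\<in>K. x j = a i \<and> r j = R i)"
    "(\<Union>i\<in>K. ball (a i) (R i)) \<subseteq> (\<Union>j. ball (x j) (5 * r j))"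
    "(\<Sum>j. ennreal (\<eta> * r j powr \<beta>)) \<le> emeasure m (\<Union>i\<in>K. ball (a i) (R i))"
proof -
  obtain C where C: "countable C" "C \<subseteq> K"
     "pairwise (\<lambda>i j. disjnt (ball (a i) (R i)) (ball (a j) (R j))) C"
     "(\<Union>i\<in>K. ball (a i) (R i)) \<subseteq> (\<Union>i\<in>C. ball (a i) (5 * R i))"
    by (rule Vitali_covering_lemma_balls[OF order_refl R])
  define D where "D = to_nat_on C ` C"
  define g where "g = from_nat_into C"
  have g: "g (to_nat_on C i) = i" if "i \<in> C" for i
    using that C(1) by (simp add: g_def)
  have gC: "g j \<in> C" if "j \<in> D" for j using that g by (auto simp: D_def)
  have inj: "g i \<noteq> g j" if "i \<in> D" "j \<in> D" "i \<noteq> j" for i j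
    using that g by (auto simp: D_def)
  define x where "x j = a (g j)" for j
  define r where "r j = (if j \<in> D then R (g j) else 0)" for j
  define F where "F j = (if j \<in> D then ball (a (g j)) (R (g j)) else {})" for j
  have "disjoint_family F"
    using C(3) gC inj unfolding disjoint_family_on_def F_def pairwise_def disjnt_def by auto
  show thesis
  proof
    show "r j = 0 \<or> (\<exists>i\<in>K. x j = a i \<and> r j = R i)" for j
      using gC C(2) by (auto simp: r_def x_def)
    show "(\<Union>i\<in>K. ball (a i) (R i)) \<subseteq> (\<Union>j. ball (x j) (5 * r j))"
    proof
      fix y assume "y \<in> (\<Union>i\<in>K. ball (a i) (R i))"
      then obtain i where i: "i \<in> C" "y \<in> ball (a i) (5 * R i)" using C(4) by blast
      then show "y \<in> (\<Union>j. ball (x j) (5 * r j))"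
        by (intro UN_I[of "to_nat_on C i"]) (auto simp: x_def r_def g D_def)
    qed
    have "(\<Sum>j. ennreal (\<eta> * r j powr \<beta>)) \<le> (\<Sum>j. emeasure m (F j))"
      using mass gC C(2) by (intro suminf_le) (auto simp: r_def F_def)
    also have "\<dots> = emeasure m (\<Union>j. F j)"
      by (rule suminf_emeasure[OF _ \<open>disjoint_family F\<close>]) (auto simp: F_def assms(1))
    also have "\<dots> \<le> emeasure m (\<Union>i\<in>K. ball (a i) (R i))"
      using C(2) gC by (intro emeasure_mono) (auto simp: F_def assms(1) split: if_splits intro!: borel_open)
    finally show "(\<Sum>j. ennreal (\<eta> * r j powr \<beta>)) \<le> emeasure m (\<Union>i\<in>K. ball (a i) (R i))" .
  qed
qed

subsection \<open>The John-Nirenberg inequality for Hausdorff content\<close>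

abbreviation osc_content ::
    "real \<Rightarrow> ('a::euclidean_space \<Rightarrow> ereal) \<Rightarrow> real \<Rightarrow> 'a set \<Rightarrow> real \<Rightarrow> ennreal" where
  "osc_content \<beta> u c A t \<equiv> hausdorff_content \<beta> {x \<in> A. dev u c x > ennreal t}"

lemma dev_le_triangle: "dev u d y \<le> dev u c y + ennreal \<bar>c - d\<bar>"
proof (cases "u y")
  case (real r)
  then show ?thesis
    by (auto simp: dev_def simp flip: ennreal_plus intro!: ennreal_leI)
qed (auto simp: dev_def)

lemma dist_le_of_dev_le:
  assumes "dev u c y \<le> ennreal A" "dev u d y \<le> ennreal A" "0 \<le> A"
  shows "\<bar>d - c\<bar> \<le> 2 * A"
  using assms by (cases "u y") (auto simp: dev_def top_unique)

text \<open>Replaces averaging in the comparison of two constants: outside both exceptional sets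
  both deviations are small at the same point, and \<open>dist_le_of_dev_le\<close> then bounds the
  difference of the constants.\<close>

lemma exists_point_outside:
  assumes "hausdorff_content \<beta> S + hausdorff_content \<beta> T < hausdorff_content \<beta> P"
  obtains z where "z \<in> P" "z \<notin> S" "z \<notin> T"
proof -
  have "\<not> P \<subseteq> S \<union> T"
    using assms hausdorff_content_mono[of P "S \<union> T" \<beta>] hausdorff_content_subadditive[of \<beta> S T]
    by (meson leD order_trans)
  then show thesis using that by blast
qed

text \<open>The deviation is controlled on the doubled ball because the balls of the next generation
  stick out of \<open>ball x R\<close>. The factor \<open>1 / (8 * 30 powr \<beta>)\<close> is tuned
  for \<open>john_nirenberg_step\<close>: it keeps critical radii below R / 10 and at least halves
  the sum of r^\<beta> even after the fivefold enlargement.\<close>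

definition weak_osc :: "real \<Rightarrow> ('a::euclidean_space \<Rightarrow> ereal) \<Rightarrow> real \<Rightarrow> 'a \<Rightarrow> real \<Rightarrow> real \<Rightarrow> bool" where
  "weak_osc \<beta> u A x R c \<longleftrightarrow> osc_content \<beta> u c (ball x (2 * R)) A
     \<le> ennreal (1 / (8 * 30 powr \<beta>) * (unit_ball_vol \<beta> * R powr \<beta>))"

text \<open>One stopping-time step. A near-optimal cover of the bad set is turned into point masses
  \<open>r k powr \<beta>\<close> at its centres. Around a centre one takes almost the largest
  radius \<rho> at which the mass is still at least \<open>\<eta> * \<rho> powr \<beta>\<close>.
  From twice this radius on the mass is subcritical, so the bad set takes at most half of the
  content of the fivefold ball. This leaves a point where the deviations from the old and from the
  new constant are both at most A, whence the jump 2A.\<close>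

lemma john_nirenberg_step:
  fixes u :: "'a::euclidean_space \<Rightarrow> ereal" and \<beta> :: real
  assumes \<beta>: "0 < \<beta>" "\<beta> \<le> DIM('a)" and A: "0 \<le> A" and R: "0 < R"
    and osc: "\<And>x R. 0 < R \<Longrightarrow> \<exists>c. weak_osc \<beta> u A x R c"
    and c: "weak_osc \<beta> u A x R c"
  obtains y :: "nat \<Rightarrow> 'a" and q d where
    "\<And>j. 0 \<le> q j" "\<And>j. 0 < q j \<Longrightarrow> weak_osc \<beta> u A (y j) (q j) (d j) \<and> \<bar>d j - c\<bar> \<le> 2 * A"
    "{z \<in> ball x R. dev u c z > ennreal A} \<subseteq> (\<Union>j. ball (y j) (q j))"
    "(\<Sum>j. ennreal (q j powr \<beta>)) \<le> ennreal (R powr \<beta> / 2)"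
proof -
  define \<omega> where "\<omega> = unit_ball_vol \<beta>"
  define \<epsilon> where "\<epsilon> = 1 / (8 * 30 powr \<beta>)"
  \<comment> \<open>A cover ball of radius r > 5\<rho> that met a fivefold ball would put its mass
    r^\<beta> into the ball of radius 3r about the centre of the latter. The factor
    \<open>3 powr \<beta>\<close> makes the critical mass there r^\<beta> / 2, a
    contradiction.\<close>
  define \<eta> where "\<eta> = 1 / (2 * 3 powr \<beta>)"
  have \<omega>: "0 < \<omega>" using \<beta> by (simp add: \<omega>_def)
  have \<epsilon>: "0 < \<epsilon>" by (simp add: \<epsilon>_def)
  have \<epsilon>1: "\<epsilon> \<le> 1 / 8" using \<beta> ge_one_powr_ge_zero[of 30 \<beta>] by (simp add: \<epsilon>_def field_simps)
  have \<eta>: "0 < \<eta>" by (simp add: \<eta>_def)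
  have \<eta>1: "\<eta> \<le> 1" using \<beta> ge_one_powr_ge_zero[of 3 \<beta>] by (simp add: \<eta>_def field_simps)
  define E where "E = {y \<in> ball x (2 * R). dev u c y > ennreal A}"
  have "hausdorff_content \<beta> E \<le> ennreal (\<epsilon> * (\<omega> * R powr \<beta>))"
    using c by (simp add: weak_osc_def E_def \<epsilon>_def \<omega>_def)
  also have "\<dots> < ennreal (2 * \<epsilon> * (\<omega> * R powr \<beta>))"
    using \<epsilon> \<omega> R by (intro ennreal_lessI) (auto simp: field_simps)
  finally obtain p :: "nat \<Rightarrow> 'a" and r where pr: "\<And>i. 0 \<le> r i" "E \<subseteq> (\<Union>i. ball (p i) (r i))"
    "(\<Sum>i. ennreal (\<omega> * r i powr \<beta>)) < ennreal (2 * \<epsilon> * (\<omega> * R powr \<beta>))"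
    unfolding \<omega>_def by (elim hausdorff_content_lessE) blast
  define m where "m = distr (density (count_space UNIV) (\<lambda>k. ennreal (r k powr \<beta>))) borel p"
  have sets_m: "sets m = sets borel" by (simp add: m_def)
  have m_eq: "emeasure m S = (\<Sum>k. ennreal (r k powr \<beta>) * indicator S (p k))" if "S \<in> sets borel" for S
  proof -
    have "emeasure m S = emeasure (density (count_space UNIV) (\<lambda>k. ennreal (r k powr \<beta>))) (p -` S)"
      using that by (simp add: m_def emeasure_distr)
    also have "\<dots> = (\<integral>\<^sup>+ k. ennreal (r k powr \<beta>) * indicator S (p k) \<partial>count_space UNIV)"
      by (auto simp: emeasure_density intro!: nn_integral_cong split: split_indicator)
    finally show ?thesis by (simp add: nn_integral_count_space_nat)
  qed
  have m_ge: "ennreal (r k powr \<beta>) \<le> emeasure m (ball z t)" if "p k \<in> ball z t" for k z t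
  proof -
    have "(\<Sum>j\<in>{k}. ennreal (r j powr \<beta>) * indicator (ball z t) (p j)) \<le> emeasure m (ball z t)"
      unfolding m_eq[OF borel_open[OF open_ball]] by (rule sum_le_suminf) auto
    then show ?thesis using that by (simp add: indicator_def)
  qed
  have m_le: "emeasure m S \<le> ennreal (2 * \<epsilon> * R powr \<beta>)" if "S \<in> sets borel" for S
  proof -
    have "ennreal \<omega> * emeasure m S = (\<Sum>k. ennreal \<omega> * (ennreal (r k powr \<beta>) * indicator S (p k)))"
      by (simp add: m_eq that)
    also have "\<dots> \<le> (\<Sum>i. ennreal (\<omega> * r i powr \<beta>))"
      using \<omega> by (intro suminf_le) (auto simp: ennreal_mult' split: split_indicator)
    also have "\<dots> \<le> ennreal \<omega> * ennreal (2 * \<epsilon> * R powr \<beta>)"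
      using pr(3) \<omega> by (subst ennreal_mult'[symmetric]) (auto simp: mult_ac)
    finally show ?thesis
      using \<omega> by (subst (asm) ennreal_mult_le_mult_iff) auto
  qed
  have content_le: "hausdorff_content \<beta> E' \<le> ennreal \<omega> * emeasure m (ball z t)"
    if "E' \<subseteq> (\<Union>k\<in>{k. p k \<in> ball z t}. ball (p k) (r k))" for E' z t
  proof -
    have "hausdorff_content \<beta> E' \<le> (\<Sum>k. ennreal (\<omega> * (if p k \<in> ball z t then r k else 0) powr \<beta>))"
      unfolding \<omega>_def by (rule hausdorff_content_cover[where x=p]) (use that pr(1) in \<open>fastforce split: if_splits\<close>)+
    also have "\<dots> = (\<Sum>k. ennreal \<omega> * (ennreal (r k powr \<beta>) * indicator (ball z t) (p k)))"
      using \<omega> by (intro suminf_cong) (auto simp: ennreal_mult')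
    finally show ?thesis by (simp add: m_eq)
  qed
  have "2 * \<epsilon> / \<eta> = 1 / (2 * 10 powr \<beta>)"
  proof -
    have "30 powr \<beta> = 3 powr \<beta> * 10 powr \<beta>" by (simp flip: powr_mult)
    then show ?thesis by (simp add: \<epsilon>_def \<eta>_def field_simps)
  qed
  then have ratio: "2 * \<epsilon> / \<eta> * R powr \<beta> = (R / 10) powr \<beta> / 2" using R by (simp add: powr_divide)
  \<comment> \<open>Admissible radii are also required to be at least \<open>r k\<close>, so that
    the new balls contain the original ones and still cover the bad set.\<close>
  define T where "T k = {\<rho>. r k \<le> \<rho> \<and> ennreal (\<eta> * \<rho> powr \<beta>) \<le> emeasure m (ball (p k) \<rho>)}" for k
  have T_le: "\<rho> \<le> R / 10" if "\<rho> \<in> T k" for \<rho> k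
  proof -
    have "ennreal (\<eta> * \<rho> powr \<beta>) \<le> ennreal (2 * \<epsilon> * R powr \<beta>)"
      using that m_le[of "ball (p k) \<rho>"] by (auto simp: T_def)
    then have "\<rho> powr \<beta> \<le> 2 * \<epsilon> / \<eta> * R powr \<beta>"
      using \<epsilon> \<eta> by (simp add: field_simps)
    then have "\<rho> powr \<beta> \<le> (R / 10) powr \<beta>"
      unfolding ratio using R powr_ge_zero[of "R / 10" \<beta>] by linarith
    then show ?thesis
      using R \<beta> powr_less_mono2[of \<beta> "R / 10" \<rho>] by (metis divide_nonneg_pos less_imp_le not_le zero_less_numeral)
  qed
  \<comment> \<open>The supremum of \<open>T k\<close> need not be attained; a member above half of
    it is taken instead, at the price of subcriticality only from \<open>2 * \<rho>\<close> on. The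
    set contains \<open>r k\<close> since \<eta> \<le> 1, and it is bounded by R / 10.\<close>
  have "\<exists>\<rho>. \<rho> \<in> T k \<and> (\<forall>t\<ge>2 * \<rho>. t \<notin> T k)" if "0 < r k" for k
  proof -
    have "ennreal (\<eta> * r k powr \<beta>) \<le> ennreal (r k powr \<beta>)"
      using \<eta>1 by (intro ennreal_leI) (simp add: mult_left_le_one_le \<eta> less_imp_le)
    also have "\<dots> \<le> emeasure m (ball (p k) (r k))" using that by (intro m_ge) simp
    finally have rT: "r k \<in> T k" by (simp add: T_def)
    have bdd: "bdd_above (T k)" using T_le by (intro bdd_aboveI)
    have "r k \<le> Sup (T k)" by (rule cSup_upper[OF rT bdd])
    then have "Sup (T k) / 2 < Sup (T k)" using that by simp
    then obtain \<rho> where "\<rho> \<in> T k" "Sup (T k) / 2 < \<rho>" using less_cSupD[of "T k"] rT by blast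
    moreover have "t \<notin> T k" if "2 * \<rho> \<le> t" for t
      using that calculation cSup_upper[OF _ bdd, of t] by force
    ultimately show ?thesis by blast
  qed
  then obtain \<rho> where \<rho>: "\<And>k. 0 < r k \<Longrightarrow> \<rho> k \<in> T k" "\<And>k t. 0 < r k \<Longrightarrow> 2 * \<rho> k \<le> t \<Longrightarrow> t \<notin> T k"
    by metis
  \<comment> \<open>Only balls meeting \<open>ball x R\<close> are kept. Their centres lie within
    11R / 10 of x, so the fivefold balls, of radius at most R / 2, stay inside
    \<open>ball x (2 * R)\<close>, where E records the bad points.\<close>
  define K where "K = {k. 0 < r k \<and> ball (p k) (r k) \<inter> ball x R \<noteq> {}}"
  have \<rho>K: "0 < \<rho> k \<and> \<rho> k \<le> R / 10" if "k \<in> K" for k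
    using \<rho>(1)[of k] T_le[of "\<rho> k" k] that by (auto simp: K_def T_def)
  have mass: "ennreal (\<eta> * \<rho> k powr \<beta>) \<le> emeasure m (ball (p k) (\<rho> k))" if "k \<in> K" for k
    using \<rho>(1)[of k] that by (auto simp: K_def T_def)
  obtain y :: "nat \<Rightarrow> 'a" and q where yq: "\<And>j. q j = 0 \<or> (\<exists>i\<in>K. y j = p i \<and> q j = \<rho> i)"
    "(\<Union>i\<in>K. ball (p i) (\<rho> i)) \<subseteq> (\<Union>j. ball (y j) (5 * q j))"
    "(\<Sum>j. ennreal (\<eta> * q j powr \<beta>)) \<le> emeasure m (\<Union>i\<in>K. ball (p i) (\<rho> i))"
    by (rule vitali_disjoint_sum[OF sets_m \<eta> \<rho>K mass]) (assumption | rule that)+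
  have q0: "0 \<le> q j" for j using yq(1)[of j] \<rho>K by (force simp: less_imp_le)
  have "\<exists>d. weak_osc \<beta> u A (y j) (5 * q j) d" if "0 < q j" for j using osc that by simp
  then obtain d where d: "\<And>j. 0 < q j \<Longrightarrow> weak_osc \<beta> u A (y j) (5 * q j) (d j)" by metis
  have dist: "\<bar>d j - c\<bar> \<le> 2 * A" if j: "0 < q j" for j
  proof -
    obtain i where i: "i \<in> K" "y j = p i" "q j = \<rho> i" using yq(1)[of j] j by auto
    define P where "P = ball (p i) (5 * \<rho> i)"
    have ri: "0 < r i" using i by (simp add: K_def)
    have small: "emeasure m (ball (p i) t) < ennreal (\<eta> * t powr \<beta>)" if "2 * \<rho> i \<le> t" for t
      using \<rho>(2)[OF ri that] \<rho>(1)[OF ri] that \<rho>K[OF i(1)] by (auto simp: T_def not_le)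
    have r\<rho>: "r i \<le> \<rho> i" using \<rho>(1)[OF ri] by (simp add: T_def)
    obtain w where "w \<in> ball (p i) (r i)" "w \<in> ball x R" using i(1) by (auto simp: K_def)
    then have "dist x (p i) < R + R / 10"
      using dist_triangle2[of x "p i" w] r\<rho> \<rho>K[OF i(1)] by (auto simp: dist_commute)
    then have P_sub: "P \<subseteq> ball x (2 * R)"
      unfolding P_def using \<rho>K[OF i(1)] R by (intro ball_subset_ball_iff[THEN iffD2]) (auto simp: dist_commute)
    \<comment> \<open>Cover balls that meet P have radius at most \<open>5 * \<rho> i\<close>, hence
      centres within \<open>10 * \<rho> i\<close>. The content of the bad part of P is then bounded
      by the mass of that ball, which is subcritical.\<close>
    have "E \<inter> P \<subseteq> (\<Union>k\<in>{k. p k \<in> ball (p i) (10 * \<rho> i)}. ball (p k) (r k))"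
    proof
      fix z assume z: "z \<in> E \<inter> P"
      then obtain k where k: "z \<in> ball (p k) (r k)" using pr(2) by blast
      have d1: "dist (p i) (p k) < 5 * \<rho> i + r k"
        using z k dist_triangle2[of "p i" "p k" z] by (auto simp: P_def)
      have "r k \<le> 5 * \<rho> i"
      proof (rule ccontr)
        assume *: "\<not> r k \<le> 5 * \<rho> i"
        have "ennreal (r k powr \<beta>) \<le> emeasure m (ball (p i) (3 * r k))"
          using d1 * pr(1)[of k] by (intro m_ge) auto
        also have "\<dots> < ennreal (\<eta> * (3 * r k) powr \<beta>)"
          using * \<rho>K[OF i(1)] by (intro small) auto
        also have "\<dots> = ennreal (r k powr \<beta> / 2)"
          using * \<rho>K[OF i(1)] by (simp add: \<eta>_def powr_mult)
        finally show False by (simp add: ennreal_less_iff)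
      qed
      then show "z \<in> (\<Union>k\<in>{k. p k \<in> ball (p i) (10 * \<rho> i)}. ball (p k) (r k))"
        using k d1 by (intro UN_I[of k]) auto
    qed
    then have "hausdorff_content \<beta> (E \<inter> P) \<le> ennreal \<omega> * emeasure m (ball (p i) (10 * \<rho> i))"
      by (rule content_le)
    also have "\<dots> \<le> ennreal \<omega> * ennreal (\<eta> * (10 * \<rho> i) powr \<beta>)"
      using \<rho>K[OF i(1)] by (intro mult_left_mono less_imp_le[OF small]) auto
    also have "\<dots> \<le> ennreal (\<omega> * (5 * \<rho> i) powr \<beta> / 2)"
    proof -
      have "\<eta> * (10 * \<rho> i) powr \<beta> = (10 / 3 * \<rho> i) powr \<beta> / 2"
        using \<rho>K[OF i(1)] by (simp add: \<eta>_def powr_mult powr_divide)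
      also have "\<dots> \<le> (5 * \<rho> i) powr \<beta> / 2"
        using \<rho>K[OF i(1)] \<beta> by (auto intro!: powr_mono2)
      finally show ?thesis using \<omega> by (simp flip: ennreal_mult' add: mult_left_mono)
    qed
    finally have H1: "hausdorff_content \<beta> (E \<inter> P) \<le> ennreal (\<omega> * (5 * \<rho> i) powr \<beta> / 2)" .
    have "osc_content \<beta> u (d j) (ball (p i) (2 * (5 * \<rho> i))) A
        \<le> ennreal (\<epsilon> * (\<omega> * (5 * \<rho> i) powr \<beta>))"
      using d[OF j] i unfolding weak_osc_def \<epsilon>_def \<omega>_def by simp
    with H1 have "hausdorff_content \<beta> (E \<inter> P) +
        osc_content \<beta> u (d j) (ball (p i) (2 * (5 * \<rho> i))) A \<le>
        ennreal (\<omega> * (5 * \<rho> i) powr \<beta> / 2) + ennreal (\<epsilon> * (\<omega> * (5 * \<rho> i) powr \<beta>))"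
      by (rule add_mono)
    \<comment> \<open>The old bad set takes at most half of the content of P and the new one at most
      an eighth, so a good point remains.\<close>
    also have "\<dots> = ennreal ((1 / 2 + \<epsilon>) * (\<omega> * (5 * \<rho> i) powr \<beta>))"
      using \<omega> \<epsilon> by (simp flip: ennreal_plus add: field_simps)
    also have "\<dots> < ennreal (1 * (\<omega> * (5 * \<rho> i) powr \<beta>))"
      using \<omega> \<epsilon>1 \<epsilon> \<rho>K[OF i(1)] by (intro ennreal_lessI mult_strict_right_mono) auto
    also have "\<dots> \<le> hausdorff_content \<beta> P"
      unfolding P_def \<omega>_def using hausdorff_content_ball_ge[OF \<beta>, of "5 * \<rho> i" "p i"] \<rho>K[OF i(1)] by simp
    finally obtain z where "z \<in> P" "z \<notin> E \<inter> P"
        "z \<notin> {z \<in> ball (p i) (2 * (5 * \<rho> i)). dev u (d j) z > ennreal A}"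
      by (rule exists_point_outside)
    moreover have "z \<in> ball x (2 * R)" using \<open>z \<in> P\<close> P_sub by blast
    ultimately have "dev u c z \<le> ennreal A" "dev u (d j) z \<le> ennreal A"
      using \<rho>K[OF i(1)] by (auto simp: E_def P_def not_less)
    then show ?thesis using A by (intro dist_le_of_dev_le)
  qed
  show thesis
  proof (rule that[of "\<lambda>j. 5 * q j" y d])
    show "0 \<le> 5 * q j" for j using q0 by simp
    show "0 < 5 * q j \<Longrightarrow> weak_osc \<beta> u A (y j) (5 * q j) (d j) \<and> \<bar>d j - c\<bar> \<le> 2 * A" for j
      using d dist by simp
    show "{z \<in> ball x R. dev u c z > ennreal A} \<subseteq> (\<Union>j. ball (y j) (5 * q j))"
    proof
      fix z assume z: "z \<in> {z \<in> ball x R. dev u c z > ennreal A}"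
      then have "z \<in> E" using R by (auto simp: E_def)
      then obtain k where k: "z \<in> ball (p k) (r k)" using pr(2) by blast
      then have "0 < r k" by (smt (verit) mem_ball zero_le_dist)
      then have "k \<in> K" "r k \<le> \<rho> k" using k z \<rho>(1)[of k] by (auto simp: K_def T_def)
      with k have "z \<in> (\<Union>i\<in>K. ball (p i) (\<rho> i))" by (intro UN_I[of k]) auto
      then show "z \<in> (\<Union>j. ball (y j) (5 * q j))" using yq(2) by blast
    qed
    \<comment> \<open>The choice of \<epsilon> pays off: the total is at most
      \<open>(R / 2) powr \<beta> / 2\<close>. The halving in each generation is the source of the
      exponential decay.\<close>
    have "(\<Sum>j. ennreal ((5 * q j) powr \<beta>)) = (\<Sum>j. ennreal (5 powr \<beta> / \<eta>) * ennreal (\<eta> * q j powr \<beta>))"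
      using \<eta> q0 by (intro suminf_cong) (simp flip: ennreal_mult' add: powr_mult)
    also have "\<dots> = ennreal (5 powr \<beta> / \<eta>) * (\<Sum>j. ennreal (\<eta> * q j powr \<beta>))" by simp
    also have "\<dots> \<le> ennreal (5 powr \<beta> / \<eta>) * ennreal (2 * \<epsilon> * R powr \<beta>)"
      by (intro mult_left_mono order_trans[OF yq(3)] m_le) auto
    also have "\<dots> = ennreal (5 powr \<beta> * (2 * \<epsilon> / \<eta> * R powr \<beta>))"
      using \<eta> by (simp flip: ennreal_mult')
    also have "5 powr \<beta> * (2 * \<epsilon> / \<eta> * R powr \<beta>) = (R / 2) powr \<beta> / 2"
      unfolding ratio using R by (simp flip: powr_mult)
    also have "ennreal ((R / 2) powr \<beta> / 2) \<le> ennreal (R powr \<beta> / 2)"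
      using R \<beta> by (intro ennreal_leI divide_right_mono powr_mono2) auto
    finally show "(\<Sum>j. ennreal ((5 * q j) powr \<beta>)) \<le> ennreal (R powr \<beta> / 2)" .
  qed
qed

text \<open>Each generation raises the level by 2A, the possible jump of the constant, and halves
  the sum of r^\<beta>. The constant \<open>c\<close> is a variable of the induction and not chosen
  afresh, since the next generation must start from the very constants \<open>d j\<close> that were
  compared with \<open>c\<close>.\<close>

lemma john_nirenberg_iterate:
  fixes u :: "'a::euclidean_space \<Rightarrow> ereal" and \<beta> :: real
  assumes \<beta>: "0 < \<beta>" "\<beta> \<le> DIM('a)" and A: "0 \<le> A"
    and osc: "\<And>x R. 0 < R \<Longrightarrow> \<exists>c. weak_osc \<beta> u A x R c"
    and "0 < R" "weak_osc \<beta> u A x R c"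
  shows "osc_content \<beta> u c (ball x R) (A * (1 + 2 * real k))
     \<le> ennreal (unit_ball_vol \<beta> * (1 / 2) ^ k * R powr \<beta>)"
  using assms(5,6)
proof (induction k arbitrary: x R c)
  case 0
  have "osc_content \<beta> u c (ball x R) (A * (1 + 2 * real 0))
      \<le> hausdorff_content \<beta> (ball x R)"
    by (rule hausdorff_content_mono) auto
  also have "\<dots> \<le> ennreal (unit_ball_vol \<beta> * R powr \<beta>)"
    using 0 by (intro hausdorff_content_ball_le) auto
  finally show ?case by simp
next
  case (Suc k)
  define \<omega> where "\<omega> = unit_ball_vol \<beta>"
  have \<omega>: "0 < \<omega>" using \<beta> by (simp add: \<omega>_def)
  obtain y :: "nat \<Rightarrow> 'a" and q d where q: "\<And>j. 0 \<le> q j"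
    "\<And>j. 0 < q j \<Longrightarrow> weak_osc \<beta> u A (y j) (q j) (d j) \<and> \<bar>d j - c\<bar> \<le> 2 * A"
    "{z \<in> ball x R. dev u c z > ennreal A} \<subseteq> (\<Union>j. ball (y j) (q j))"
    "(\<Sum>j. ennreal (q j powr \<beta>)) \<le> ennreal (R powr \<beta> / 2)"
    by (rule john_nirenberg_step[OF \<beta> A Suc.prems(1) osc Suc.prems(2)]) (assumption | rule that)+
  define E where "E j = {z \<in> ball (y j) (q j). dev u (d j) z > ennreal (A * (1 + 2 * real k))}" for j
  have "{z \<in> ball x R. dev u c z > ennreal (A * (1 + 2 * real (Suc k)))} \<subseteq> (\<Union>j. E j)"
  proof safe
    fix z assume z: "z \<in> ball x R" "dev u c z > ennreal (A * (1 + 2 * real (Suc k)))"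
    have "ennreal A \<le> ennreal (A * (1 + 2 * real (Suc k)))"
      using A by (intro ennreal_leI) (auto simp: algebra_simps)
    then have "dev u c z > ennreal A" using z by order
    then obtain j where j: "z \<in> ball (y j) (q j)" using z q(3) by blast
    then have "0 < q j" by (smt (verit) mem_ball zero_le_dist)
    then have "ennreal \<bar>d j - c\<bar> \<le> ennreal (2 * A)" using q(2) by (simp add: ennreal_leI)
    then have "dev u c z \<le> dev u (d j) z + ennreal (2 * A)"
      using dev_le_triangle[of u c z "d j"] by (meson add_left_mono order_trans)
    with z have "ennreal (A * (1 + 2 * real k)) + ennreal (2 * A) < dev u (d j) z + ennreal (2 * A)"
      using A by (simp flip: ennreal_plus add: algebra_simps order_less_le_trans)
    then have "dev u (d j) z > ennreal (A * (1 + 2 * real k))"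
      by (meson add_right_mono not_le)
    then show "z \<in> (\<Union>j. E j)" using j by (auto simp: E_def)
  qed
  then have "hausdorff_content \<beta> {z \<in> ball x R. dev u c z > ennreal (A * (1 + 2 * real (Suc k)))}
      \<le> hausdorff_content \<beta> (\<Union>j. E j)"
    by (rule hausdorff_content_mono)
  also have "\<dots> \<le> (\<Sum>j. hausdorff_content \<beta> (E j))"
    by (rule hausdorff_content_countable_subadditive)
  also have "\<dots> \<le> (\<Sum>j. ennreal (\<omega> * (1 / 2) ^ k) * ennreal (q j powr \<beta>))"
  proof (intro suminf_le)
    fix j
    show "hausdorff_content \<beta> (E j) \<le> ennreal (\<omega> * (1 / 2) ^ k) * ennreal (q j powr \<beta>)"
    proof (cases "0 < q j")
      case True
      then show ?thesis using Suc.IH[of "q j" "y j" "d j"] q(2)[OF True] \<omega>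
        by (simp add: E_def \<omega>_def flip: ennreal_mult')
    next
      case False
      then have "E j = {}" using q(1)[of j] by (auto simp: E_def)
      then show ?thesis by simp
    qed
  qed auto
  also have "\<dots> = ennreal (\<omega> * (1 / 2) ^ k) * (\<Sum>j. ennreal (q j powr \<beta>))" by simp
  also have "\<dots> \<le> ennreal (\<omega> * (1 / 2) ^ k) * ennreal (R powr \<beta> / 2)"
    by (intro mult_left_mono q) auto
  also have "\<dots> = ennreal (\<omega> * (1 / 2) ^ Suc k * R powr \<beta>)"
    using \<omega> by (simp flip: ennreal_mult')
  finally show ?case by (simp add: \<omega>_def)
qed


section \<open>Balls, cubes, and the John-Nirenberg inequality on cubes\<close>

lemma ball_subset_cube:
  fixes x :: "'a::euclidean_space"
  shows "ball x R \<subseteq> cube (x - R *\<^sub>R One) (2 * R)"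
proof
  fix y assume y: "y \<in> ball x R"
  have "\<bar>(y - x) \<bullet> i\<bar> < R" if "i \<in> Basis" for i
    using y Basis_le_norm[OF that, of "y - x"] by (simp add: dist_norm norm_minus_commute)
  then have "- R < (y - x) \<bullet> i \<and> (y - x) \<bullet> i < R" if "i \<in> Basis" for i
    using that by (meson abs_less_iff minus_less_iff)
  then show "y \<in> cube (x - R *\<^sub>R One) (2 * R)"
    by (auto simp: cube_def mem_box inner_simps algebra_simps)
qed

lemma dist_cube_less:
  fixes x :: "'a::euclidean_space" and l :: real
  assumes "x \<in> cube a l" "y \<in> cube a l"
  shows "dist x y < DIM('a) * l"
proof -
  have *: "\<bar>(x - y) \<bullet> i\<bar> < l" if "i \<in> Basis" for i
    using assms that by (fastforce simp: cube_def mem_box inner_simps)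
  have "norm (x - y) \<le> (\<Sum>i\<in>Basis. \<bar>(x - y) \<bullet> i\<bar>)" by (rule norm_le_l1)
  also have "\<dots> < (\<Sum>i\<in>(Basis::'a set). l)"
    by (intro sum_strict_mono *) auto
  finally show ?thesis by (simp add: dist_norm)
qed

lemma cube_midpoint: "0 < l \<Longrightarrow> a + (l / 2) *\<^sub>R One \<in> cube a l"
  by (simp add: cube_def mem_box inner_simps)

lemma cube_subset_ball:
  fixes a :: "'a::euclidean_space" and l :: real
  assumes "0 < l"
  shows "cube a l \<subseteq> ball (a + (l / 2) *\<^sub>R One) (DIM('a) * l)"
  using dist_cube_less[OF cube_midpoint[OF assms]] by auto

text \<open>The threshold is that of \<open>weak_osc\<close> transported to cubes:
  \<open>ball x (2 * R)\<close> lies in a cube of side 4R, and 120 = 4 * 30. The constant of a cube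
  is the one of a ball of radius n l around it, which produces the factor
  \<open>DIM('a) powr \<beta>\<close>.\<close>

theorem john_nirenberg:
  fixes u :: "'a::euclidean_space \<Rightarrow> ereal" and \<beta> :: real
  assumes \<beta>: "0 < \<beta>" "\<beta> \<le> DIM('a)" and A: "0 < A" and l: "0 < l"
    and osc: "\<And>a l. 0 < l \<Longrightarrow> \<exists>c. osc_content \<beta> u c (cube a l) A
       \<le> ennreal (unit_ball_vol \<beta> / (8 * 120 powr \<beta>) * l powr \<beta>)"
  shows "\<exists>c. \<forall>t\<ge>0. osc_content \<beta> u c (cube a l) t
    \<le> ennreal (3 * unit_ball_vol \<beta> * DIM('a) powr \<beta> * l powr \<beta> * exp (- (ln 2 / 2) * t / A))"
proof -
  have w: "\<exists>c. weak_osc \<beta> u A x R c" if R: "0 < R" for x R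
  proof -
    obtain c where c: "osc_content \<beta> u c (cube (x - (2 * R) *\<^sub>R One) (4 * R)) A
       \<le> ennreal (unit_ball_vol \<beta> / (8 * 120 powr \<beta>) * (4 * R) powr \<beta>)"
      using osc[of "4 * R" "x - (2 * R) *\<^sub>R One"] R by auto
    have "120 powr \<beta> = 4 powr \<beta> * 30 powr \<beta>" by (simp flip: powr_mult)
    then have "unit_ball_vol \<beta> / (8 * 120 powr \<beta>) * (4 * R) powr \<beta> =
        1 / (8 * 30 powr \<beta>) * (unit_ball_vol \<beta> * R powr \<beta>)"
      using R by (simp add: powr_mult)
    with c have c: "osc_content \<beta> u c (cube (x - (2 * R) *\<^sub>R One) (4 * R)) A
       \<le> ennreal (1 / (8 * 30 powr \<beta>) * (unit_ball_vol \<beta> * R powr \<beta>))" by (simp only:)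
    have "osc_content \<beta> u c (ball x (2 * R)) A
       \<le> osc_content \<beta> u c (cube (x - (2 * R) *\<^sub>R One) (4 * R)) A"
      using ball_subset_cube[of x "2 * R"] by (intro hausdorff_content_mono) auto
    also note c
    finally show ?thesis unfolding weak_osc_def by blast
  qed
  define x where "x = a + (l / 2) *\<^sub>R One"
  define R where "R = DIM('a) * l"
  have R: "0 < R" using l by (simp add: R_def)
  obtain c where c: "weak_osc \<beta> u A x R c" using w[OF R] by blast
  define H where "H t = osc_content \<beta> u c (ball x R) t" for t
  have bound: "H t \<le> ennreal (3 * unit_ball_vol \<beta> * R powr \<beta> * exp (- (ln 2 / 2) * t / A))" if t: "0 \<le> t" for t
  proof -
    \<comment> \<open>The largest k with \<open>A * (1 + 2 * real k) \<le> t\<close>, cut off at 0.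
      Against t / (2A) the rounding loses at most 3 / 2 generations, that is a factor 2^(3/2) \<le>
      3.\<close>
    define k where "k = nat \<lfloor>(t / A - 1) / 2\<rfloor>"
    have "(t / A - 1) / 2 < of_int \<lfloor>(t / A - 1) / 2\<rfloor> + 1" by linarith
    also have "of_int \<lfloor>(t / A - 1) / 2\<rfloor> \<le> real k" unfolding k_def by linarith
    finally have tk: "t / A - 3 \<le> 2 * real k" by (simp add: field_simps)
    have "H t \<le> ennreal (unit_ball_vol \<beta> * (1 / 2) ^ k * R powr \<beta>)"
    proof (cases "t \<ge> A")
      case True
      then have "0 \<le> (t / A - 1) / 2" using A by simp
      then have "real k = of_int \<lfloor>(t / A - 1) / 2\<rfloor>" unfolding k_def by simp
      also have "\<dots> \<le> (t / A - 1) / 2" by linarith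
      finally have "2 * real k \<le> t / A - 1" by (simp add: field_simps)
      then have "A * (1 + 2 * real k) \<le> t" using A by (simp add: field_simps)
      then have "H t \<le> H (A * (1 + 2 * real k))"
        unfolding H_def by (intro hausdorff_content_mono) (auto intro: order_le_less_trans[OF ennreal_leI])
      also have "\<dots> \<le> ennreal (unit_ball_vol \<beta> * (1 / 2) ^ k * R powr \<beta>)"
        unfolding H_def by (rule john_nirenberg_iterate[OF \<beta> _ w R c]) (use A in auto)
      finally show ?thesis .
    next
      case False
      then have "t / A < 1" using A by simp
      then have "(t / A - 1) / 2 < 1" by simp
      then have "\<lfloor>(t / A - 1) / 2\<rfloor> \<le> 0" by (simp add: floor_le_iff)
      then have "k = 0" unfolding k_def by simp
      have "H t \<le> hausdorff_content \<beta> (ball x R)"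
        unfolding H_def by (intro hausdorff_content_mono) auto
      then show ?thesis
        using hausdorff_content_ball_le[of R \<beta> x] R \<open>k = 0\<close> by auto
    qed
    also have "\<dots> \<le> ennreal (unit_ball_vol \<beta> * (3 * exp (- (ln 2 / 2) * t / A)) * R powr \<beta>)"
    proof (intro ennreal_leI mult_right_mono mult_left_mono)
      have "((1::real) / 2) ^ k = exp (- ln 2 * real k)"
      proof -
        have "exp (- ln (2::real)) = 1 / 2" by (simp add: exp_minus)
        then show ?thesis using exp_of_nat2_mult[of "- ln (2::real)" k] by (simp only:)
      qed
      also have "\<dots> \<le> exp (3 / 2 * ln 2 + (- (ln 2 / 2) * t / A))"
      proof -
        have "ln 2 / 2 * (t / A - 3) \<le> ln 2 / 2 * (2 * real k)"
          using tk by (intro mult_left_mono) auto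
        then show ?thesis by (simp add: algebra_simps)
      qed
      also have "\<dots> = exp (3 / 2 * ln 2) * exp (- (ln 2 / 2) * t / A)" by (rule exp_add)
      also have "exp (3 / 2 * ln 2) \<le> (3::real)"
      proof -
        have "exp (3 / 2 * ln 2) ^ 2 = (8::real)"
        proof -
          have "exp (3 / 2 * ln (2::real)) ^ 2 = exp (3 * ln 2)"
            using exp_of_nat_mult[of 2 "3 / 2 * ln (2::real)"] by simp
          also have "\<dots> = exp (ln 2) ^ 3" using exp_of_nat_mult[of 3 "ln (2::real)"] by simp
          finally show ?thesis by simp
        qed
        then have "exp (3 / 2 * ln (2::real)) ^ 2 \<le> 3 ^ 2" by simp
        then show ?thesis by (rule power2_le_imp_le) simp
      qed
      finally show "(1 / 2) ^ k \<le> 3 * exp (- (ln 2 / 2) * t / A)" by simp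
    qed (use \<beta> in auto)
    finally show ?thesis by (simp add: mult_ac)
  qed
  show ?thesis
  proof (intro exI[of _ c] allI impI)
    fix t :: real assume t: "0 \<le> t"
    have "osc_content \<beta> u c (cube a l) t \<le> H t"
      unfolding H_def using cube_subset_ball[OF l, of a]
      by (intro hausdorff_content_mono) (auto simp: x_def R_def)
    also note bound[OF t]
    finally show "osc_content \<beta> u c (cube a l) t
      \<le> ennreal (3 * unit_ball_vol \<beta> * DIM('a) powr \<beta> * l powr \<beta> * exp (- (ln 2 / 2) * t / A))"
      using l by (simp add: R_def powr_mult mult_ac)
  qed
qed

subsection \<open>Choquet integrals and exponential decay\<close>

lemma choquet_chebyshev:
  assumes "0 < t"
  shows "ennreal t * hausdorff_content \<beta> {x \<in> \<Omega>. g x > ennreal t} \<le> choquet \<beta> \<Omega> g"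
proof -
  have "ennreal t * hausdorff_content \<beta> {x \<in> \<Omega>. g x > ennreal t} =
      (\<integral>\<^sup>+ s. hausdorff_content \<beta> {x \<in> \<Omega>. g x > ennreal t} * indicator {0<..<t} s \<partial>lborel)"
    using assms by (subst nn_integral_cmult) (auto simp: mult.commute)
  also have "\<dots> \<le> choquet \<beta> \<Omega> g"
    unfolding choquet_def using assms
    by (intro nn_integral_mono)
       (auto split: split_indicator intro!: hausdorff_content_mono elim!: order_le_less_trans[OF ennreal_leI, rotated])
  finally show ?thesis .
qed

text \<open>All Choquet integrals are bounded through this one majorant:
  \<open>1 / (1 + t)\<^sup>2\<close> has integral 1 over the half-line, so C passes through
  unchanged.\<close>

lemma choquet_le_of_decay:
  assumes "\<And>t. 0 < t \<Longrightarrow> hausdorff_content \<beta> {x \<in> \<Omega>. g x > ennreal t} \<le> ennreal (C / (1 + t)\<^sup>2)" "0 \<le> C"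
  shows "choquet \<beta> \<Omega> g \<le> ennreal C"
proof -
  have "choquet \<beta> \<Omega> g \<le> (\<integral>\<^sup>+ t. ennreal (C / (1 + t)\<^sup>2) * indicator {0..} t \<partial>lborel)"
    unfolding choquet_def using assms by (intro nn_integral_mono) (auto split: split_indicator)
  also have "\<dots> = ennreal (0 - (- C / (1 + 0)))"
  proof (rule nn_integral_FTC_atLeast)
    show "((\<lambda>t. - C / (1 + t)) has_real_derivative C / (1 + t)\<^sup>2) (at t)" if "0 \<le> t" for t
      using that by (auto intro!: derivative_eq_intros simp: power2_eq_square)
    show "((\<lambda>t. - C / (1 + t)) \<longlongrightarrow> 0) at_top" by real_asymp
  qed (use assms in auto)
  finally show ?thesis by simp
qed

text \<open>Brings stretched exponentials, which arise from p-th powers with q = 1 / p, into the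
  form asked for by \<open>choquet_le_of_decay\<close>.\<close>

lemma exp_powr_decay:
  fixes k q :: real
  assumes "0 < k" "0 < q"
  obtains M where "0 < M" "\<And>t. 0 < t \<Longrightarrow> exp (- k * t powr q) \<le> M / (1 + t)\<^sup>2"
proof -
  have "((\<lambda>t. exp (- k * t powr q) * (1 + t)\<^sup>2) \<longlongrightarrow> 0) at_top"
    using assms by real_asymp
  then have "eventually (\<lambda>t. exp (- k * t powr q) * (1 + t)\<^sup>2 < 1) at_top"
    by (rule order_tendstoD) simp
  then obtain T where T: "\<And>t. T \<le> t \<Longrightarrow> exp (- k * t powr q) * (1 + t)\<^sup>2 < 1"
    by (auto simp: eventually_at_top_linorder)
  define M where "M = (1 + \<bar>T\<bar>)\<^sup>2"
  show thesis
  proof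
    show "0 < M" by (simp add: M_def add_pos_nonneg)
    fix t :: real assume t: "0 < t"
    have "exp (- k * t powr q) * (1 + t)\<^sup>2 \<le> M"
    proof (cases "T \<le> t")
      case True
      then have "exp (- k * t powr q) * (1 + t)\<^sup>2 \<le> 1" using T by (simp add: less_imp_le)
      also have "1 \<le> M" unfolding M_def by (simp add: one_le_power)
      finally show ?thesis .
    next
      case False
      have "exp (- k * t powr q) * (1 + t)\<^sup>2 \<le> 1 * (1 + t)\<^sup>2"
        using assms by (intro mult_right_mono) auto
      also have "\<dots> \<le> M" unfolding M_def using False t by (auto intro!: power_mono)
      finally show ?thesis .
    qed
    then show "exp (- k * t powr q) \<le> M / (1 + t)\<^sup>2"
      using t by (simp add: field_simps)
  qed
qed

lemma powr_ennreal_one [simp]: "powr_ennreal x 1 = x"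
  by (cases x) (auto simp: powr_ennreal_def)

lemma less_powr_ennrealD:
  assumes "0 < t" "0 < p" "ennreal t < powr_ennreal x p"
  shows "ennreal (t powr (1 / p)) < x"
proof (cases x)
  case (real r)
  then have "t < r powr p" using assms by (simp add: powr_ennreal_def ennreal_less_iff)
  then have "t powr (1 / p) < (r powr p) powr (1 / p)"
    using assms by (intro powr_less_mono2) auto
  then show ?thesis using real assms by (simp add: powr_powr ennreal_less_iff)
qed auto

lemma less_exp_ennrealD:
  assumes "1 < t" "0 < \<gamma>" "ennreal t < exp_ennreal (ennreal \<gamma> * x)"
  shows "ennreal (ln t / \<gamma>) < x"
proof (cases x)
  case (real r)
  then have "t < exp (\<gamma> * r)"
    using assms by (simp add: exp_ennreal_def ennreal_less_iff flip: ennreal_mult)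
  then have "ln t < \<gamma> * r" using assms by (metis ln_exp ln_less_cancel_iff exp_gt_zero less_trans zero_less_one)
  then show ?thesis using real assms by (simp add: ennreal_less_iff field_simps)
qed auto

lemma less_exp_ennrealI:
  assumes "0 \<le> t" "0 < \<gamma>" "ennreal t < x"
  shows "ennreal (exp (\<gamma> * t)) < exp_ennreal (ennreal \<gamma> * x)"
proof (cases x)
  case (real r)
  then show ?thesis
    using assms by (simp add: exp_ennreal_def ennreal_less_iff flip: ennreal_mult)
qed (use assms in \<open>auto simp: exp_ennreal_def ennreal_mult_top\<close>)

lemma divide_ennreal_le_iff:
  assumes "0 < r"
  shows "x / ennreal r \<le> y \<longleftrightarrow> x \<le> y * ennreal r"
proof
  have "x = x / ennreal r * ennreal r"
    using assms mult_divide_eq_ennreal[of "ennreal r" x] by (simp add: ennreal_times_divide mult.commute)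
  also assume "x / ennreal r \<le> y"
  then have "x / ennreal r * ennreal r \<le> y * ennreal r" by (rule mult_right_mono) simp
  finally show "x \<le> y * ennreal r" .
qed (rule divide_le_posI_ennreal, use assms in \<open>auto simp: mult.commute\<close>)

lemma le_divide_ennreal:
  assumes "0 < t" "ennreal t * x \<le> y"
  shows "x \<le> y / ennreal t"
proof -
  have "x = ennreal t * x / ennreal t"
    using assms mult_divide_eq_ennreal[of "ennreal t" x] by (simp add: mult.commute)
  also have "\<dots> \<le> y / ennreal t" by (rule divide_right_mono_ennreal[OF assms(2)])
  finally show ?thesis .
qed

text \<open>The common hub: the inequality of (iii) with k and C free to depend on u. It does not
  mention the BMO seminorm, so it can be fed from the Morrey condition, from (iii) and from (iv)
  alike.\<close>

definition exp_osc_decay :: "real \<Rightarrow> ('a::euclidean_space \<Rightarrow> ereal) \<Rightarrow> bool" where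
  "exp_osc_decay \<beta> u \<longleftrightarrow> (\<exists>k>0. \<exists>C>0. \<forall>a. \<forall>l>0. \<exists>c. \<forall>t>0.
     osc_content \<beta> u c (cube a l) t \<le> ennreal (C * l powr \<beta> * exp (- k * t)))"

lemma hausdorff_content_cube_le:
  fixes a :: "'a::euclidean_space"
  assumes "0 < l"
  shows "hausdorff_content \<beta> (cube a l) \<le> ennreal (unit_ball_vol \<beta> * DIM('a) powr \<beta> * l powr \<beta>)"
proof -
  have "hausdorff_content \<beta> (cube a l) \<le> hausdorff_content \<beta> (ball (a + (l / 2) *\<^sub>R One) (DIM('a) * l))"
    by (rule hausdorff_content_mono[OF cube_subset_ball[OF assms]])
  also have "\<dots> \<le> ennreal (unit_ball_vol \<beta> * (DIM('a) * l) powr \<beta>)"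
    using assms by (intro hausdorff_content_ball_le) auto
  finally show ?thesis using assms by (simp add: powr_mult mult_ac)
qed

lemma exp_osc_decay_of_exp_integral:
  fixes u :: "'a::euclidean_space \<Rightarrow> ereal"
  assumes "0 < \<gamma>" "0 < C" and c: "\<And>a l. 0 < l \<Longrightarrow> \<exists>c. choquet \<beta> (cube a l) (\<lambda>x. exp_ennreal (ennreal \<gamma> * dev u c x))
            \<le> ennreal (C * l powr \<beta>)"
  shows "exp_osc_decay \<beta> u"
  unfolding exp_osc_decay_def
proof (rule exI[of _ \<gamma>], rule conjI[OF assms(1)], rule exI[of _ C], intro conjI assms(2) allI impI)
  fix a :: 'a and l :: real assume l: "0 < l"
  obtain c where c: "choquet \<beta> (cube a l) (\<lambda>x. exp_ennreal (ennreal \<gamma> * dev u c x)) \<le> ennreal (C * l powr \<beta>)"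
    using c[OF l] by blast
  show "\<exists>c. \<forall>t>0. osc_content \<beta> u c (cube a l) t \<le> ennreal (C * l powr \<beta> * exp (- \<gamma> * t))"
  proof (intro exI[of _ c] allI impI)
    fix t :: real assume t: "0 < t"
    have "ennreal (exp (\<gamma> * t)) * osc_content \<beta> u c (cube a l) t \<le>
        ennreal (exp (\<gamma> * t)) * hausdorff_content \<beta> {y \<in> cube a l. exp_ennreal (ennreal \<gamma> * dev u c y) > ennreal (exp (\<gamma> * t))}"
      using t assms(1) by (intro mult_left_mono hausdorff_content_mono) (auto intro: less_exp_ennrealI)
    also have "\<dots> \<le> ennreal (C * l powr \<beta>)"
      by (rule order_trans[OF choquet_chebyshev c]) simp
    finally have "osc_content \<beta> u c (cube a l) t \<le> ennreal (C * l powr \<beta>) / ennreal (exp (\<gamma> * t))"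
      by (intro le_divide_ennreal) auto
    also have "\<dots> = ennreal (C * l powr \<beta> * exp (- \<gamma> * t))"
      using assms by (subst divide_ennreal) (auto simp: exp_minus divide_inverse)
    finally show "osc_content \<beta> u c (cube a l) t \<le> ennreal (C * l powr \<beta> * exp (- \<gamma> * t))" .
  qed
qed

text \<open>Half of the decay rate is spent: with \<gamma> = k / 2 the superlevel set of the
  exponential at t is a deviation set at level 2 ln t / k, whose content decays like t^(-2) and is
  integrable.\<close>

lemma exp_integral_of_exp_osc_decay:
  fixes u :: "'a::euclidean_space \<Rightarrow> ereal"
  assumes \<beta>: "0 < \<beta>" and "exp_osc_decay \<beta> u"
  shows "\<exists>\<gamma>>0. \<exists>C>0. \<forall>a. \<forall>l>0. \<exists>c. choquet \<beta> (cube a l) (\<lambda>x. exp_ennreal (ennreal \<gamma> * dev u c x))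
            \<le> ennreal (C * l powr \<beta>)"
proof -
  obtain k C where k: "0 < k" "0 < C" and *: "\<And>a l. 0 < l \<Longrightarrow> \<exists>c. \<forall>t>0.
     osc_content \<beta> u c (cube a l) t \<le> ennreal (C * l powr \<beta> * exp (- k * t))"
    using assms unfolding exp_osc_decay_def by blast
  define V where "V = unit_ball_vol \<beta> * DIM('a) powr \<beta>"
  have V: "0 < V" using \<beta> by (simp add: V_def)
  \<comment> \<open>Below t = 2 only the content of the cube is used, and (1 + t)^2 \<le> 9. From t
    = 2 on, 1 + t \<le> 2t gives (1 + t)^2 \<le> 4 t^2.\<close>
  define D where "D = max (4 * C) (9 * V)"
  have "\<exists>c. choquet \<beta> (cube a l) (\<lambda>x. exp_ennreal (ennreal (k / 2) * dev u c x)) \<le> ennreal (D * l powr \<beta>)"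
    if l: "0 < l" for a l
  proof -
    obtain c where c: "\<And>t. 0 < t \<Longrightarrow>
       osc_content \<beta> u c (cube a l) t \<le> ennreal (C * l powr \<beta> * exp (- k * t))"
      using *[OF l] by blast
    have "choquet \<beta> (cube a l) (\<lambda>x. exp_ennreal (ennreal (k / 2) * dev u c x)) \<le> ennreal (D * l powr \<beta>)"
    proof (rule choquet_le_of_decay)
      fix t :: real assume t: "0 < t"
      define S where "S = {x \<in> cube a l. exp_ennreal (ennreal (k / 2) * dev u c x) > ennreal t}"
      show "hausdorff_content \<beta> S \<le> ennreal (D * l powr \<beta> / (1 + t)\<^sup>2)"
      proof (cases "t < 2")
        case True
        have "hausdorff_content \<beta> S \<le> hausdorff_content \<beta> (cube a l)"
          by (rule hausdorff_content_mono) (auto simp: S_def)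
        also have "\<dots> \<le> ennreal (V * l powr \<beta>)"
          unfolding V_def by (rule hausdorff_content_cube_le[OF l])
        also have "V * l powr \<beta> \<le> D * l powr \<beta> / (1 + t)\<^sup>2"
        proof -
          have "(1 + t)\<^sup>2 \<le> 3\<^sup>2" using True t by (intro power_mono) auto
          then have "V * (1 + t)\<^sup>2 \<le> V * 9" using V by (intro mult_left_mono) auto
          also have "\<dots> \<le> D" by (simp add: D_def)
          finally have "V \<le> D / (1 + t)\<^sup>2" using t by (simp add: field_simps)
          then have "V * l powr \<beta> \<le> D / (1 + t)\<^sup>2 * l powr \<beta>" by (rule mult_right_mono) simp
          then show ?thesis by simp
        qed
        finally show ?thesis by (simp add: ennreal_leI)
      next
        case False
        have "hausdorff_content \<beta> S \<le> osc_content \<beta> u c (cube a l) (ln t / (k / 2))"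
          unfolding S_def using False k
          by (intro hausdorff_content_mono) (auto dest!: less_exp_ennrealD[rotated 2])
        also have "\<dots> \<le> ennreal (C * l powr \<beta> * exp (- k * (ln t / (k / 2))))"
          using False k by (intro c) auto
        also have "exp (- k * (ln t / (k / 2))) = 1 / t\<^sup>2"
        proof -
          have "exp (- k * (ln t / (k / 2))) = inverse (exp (ln t * 2))"
            using k by (simp flip: exp_minus)
          also have "exp (ln t * 2) = t\<^sup>2"
            using exp_of_nat2_mult[of "ln t" 2] t by simp
          finally show ?thesis by (simp only: inverse_eq_divide)
        qed
        also have "C * l powr \<beta> * (1 / t\<^sup>2) \<le> D * l powr \<beta> / (1 + t)\<^sup>2"
        proof -
          have "(1 + t)\<^sup>2 \<le> (2 * t)\<^sup>2" using False by (intro power_mono) auto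
          then have "C * (1 + t)\<^sup>2 \<le> C * (4 * t\<^sup>2)" using k by (intro mult_left_mono) (auto simp: power_mult_distrib)
          also have "\<dots> = 4 * C * t\<^sup>2" by simp
          also have "\<dots> \<le> D * t\<^sup>2" by (intro mult_right_mono) (auto simp: D_def)
          finally have "C / t\<^sup>2 \<le> D / (1 + t)\<^sup>2" using t by (simp add: field_simps)
          then have "C / t\<^sup>2 * l powr \<beta> \<le> D / (1 + t)\<^sup>2 * l powr \<beta>" by (rule mult_right_mono) simp
          then show ?thesis by simp
        qed
        finally show ?thesis by (simp add: ennreal_leI)
      qed
    qed (use V k in \<open>auto simp: D_def\<close>)
    then show ?thesis by blast
  qed
  moreover have "0 < k / 2" "0 < D" using k by (auto simp: D_def)
  ultimately show ?thesis by blast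
qed

text \<open>Taking p-th powers replaces level t by t^(1/p), and the stretched exponential is still
  integrable. At p = 1 this also yields finiteness of \<open>bmo_content_norm\<close>.\<close>

lemma bmo_content_p_norm_finite:
  fixes u :: "'a::euclidean_space \<Rightarrow> ereal"
  assumes p: "1 \<le> p" and "exp_osc_decay \<beta> u"
  shows "bmo_content_p_norm \<beta> p u < \<infinity>"
proof -
  obtain k C where k: "0 < k" "0 < C" and *: "\<And>a l. 0 < l \<Longrightarrow> \<exists>c. \<forall>t>0.
     osc_content \<beta> u c (cube a l) t \<le> ennreal (C * l powr \<beta> * exp (- k * t))"
    using assms unfolding exp_osc_decay_def by blast
  obtain M where M: "0 < M" "\<And>t. 0 < t \<Longrightarrow> exp (- k * t powr (1 / p)) \<le> M / (1 + t)\<^sup>2"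
    using exp_powr_decay[of k "1 / p"] k p by auto
  have "bmo_content_p_norm \<beta> p u \<le> ennreal ((C * M) powr (1 / p))"
    unfolding bmo_content_p_norm_def
  proof (intro SUP_least)
    fix a :: 'a and l :: real assume "l \<in> {0<..}"
    then have l: "0 < l" by simp
    obtain c where c: "\<And>t. 0 < t \<Longrightarrow>
       osc_content \<beta> u c (cube a l) t \<le> ennreal (C * l powr \<beta> * exp (- k * t))"
      using *[OF l] by blast
    have ch: "choquet \<beta> (cube a l) (\<lambda>x. powr_ennreal (dev u c x) p) \<le> ennreal (C * M * l powr \<beta>)"
    proof (rule choquet_le_of_decay)
      fix t :: real assume t: "0 < t"
      have "hausdorff_content \<beta> {x \<in> cube a l. powr_ennreal (dev u c x) p > ennreal t}
          \<le> osc_content \<beta> u c (cube a l) (t powr (1 / p))"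
        using t p by (intro hausdorff_content_mono) (auto intro: less_powr_ennrealD)
      also have "\<dots> \<le> ennreal (C * l powr \<beta> * exp (- k * t powr (1 / p)))"
        using t by (intro c) auto
      also have "\<dots> \<le> ennreal (C * l powr \<beta> * (M / (1 + t)\<^sup>2))"
        using k t by (intro ennreal_leI mult_left_mono M) auto
      finally show "hausdorff_content \<beta> {x \<in> cube a l. powr_ennreal (dev u c x) p > ennreal t}
          \<le> ennreal (C * M * l powr \<beta> / (1 + t)\<^sup>2)" by (simp add: mult_ac)
    qed (use k M in auto)
    then have "choquet \<beta> (cube a l) (\<lambda>x. powr_ennreal (dev u c x) p) / ennreal (l powr \<beta>) \<le> ennreal (C * M)"
      using l k M by (subst divide_ennreal_le_iff) (auto simp flip: ennreal_mult')
    then have "powr_ennreal (choquet \<beta> (cube a l) (\<lambda>x. powr_ennreal (dev u c x) p) / ennreal (l powr \<beta>)) (1 / p)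
       \<le> ennreal ((C * M) powr (1 / p))"
      using p k M by (auto simp: powr_ennreal_def top_unique enn2real_leI intro!: ennreal_leI powr_mono2)
    then show "(INF c. powr_ennreal (choquet \<beta> (cube a l) (\<lambda>x. powr_ennreal (dev u c x) p) / ennreal (l powr \<beta>)) (1 / p))
       \<le> ennreal ((C * M) powr (1 / p))"
      by (meson INF_lower2 UNIV_I)
  qed
  then show ?thesis by (simp add: order_le_less_trans)
qed

section \<open>Consequences of a finite BMO seminorm with respect to content\<close>

lemma bmo_content_p_norm_one: "bmo_content_p_norm \<beta> 1 u = bmo_content_norm \<beta> u"
  by (simp add: bmo_content_p_norm_def bmo_content_norm_def)

text \<open>B lies strictly above the seminorm so that some c does no worse than B although the
  infimum may not be attained. One and the same c then serves all levels of the weak-type bound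
  derived from it.\<close>

lemma choquet_dev_of_bmo_content_norm:
  assumes "bmo_content_norm \<beta> u < ennreal B" "0 < l"
  obtains c where "choquet \<beta> (cube a l) (dev u c) \<le> ennreal B * ennreal (l powr \<beta>)"
proof -
  have "(INF c. choquet \<beta> (cube a l) (dev u c) / ennreal (l powr \<beta>)) \<le> bmo_content_norm \<beta> u"
    unfolding bmo_content_norm_def using assms(2) by (intro SUP_upper2[of a] SUP_upper2[of l]) auto
  then have "(INF c. choquet \<beta> (cube a l) (dev u c) / ennreal (l powr \<beta>)) < ennreal B"
    using assms(1) by order
  then obtain c where "choquet \<beta> (cube a l) (dev u c) / ennreal (l powr \<beta>) < ennreal B"
    by (auto simp: INF_less_iff)
  then have "choquet \<beta> (cube a l) (dev u c) \<le> ennreal B * ennreal (l powr \<beta>)"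
    using assms(2) by (subst divide_ennreal_le_iff[symmetric]) auto
  then show thesis by (rule that)
qed

lemma weak_type_of_bmo_content_norm:
  assumes "bmo_content_norm \<beta> u < ennreal B" "0 < l" "0 < B"
  obtains c where "\<And>t. 0 < t \<Longrightarrow>
    osc_content \<beta> u c (cube a l) t \<le> ennreal (B * l powr \<beta> / t)"
proof -
  obtain c where c: "choquet \<beta> (cube a l) (dev u c) \<le> ennreal B * ennreal (l powr \<beta>)"
    using choquet_dev_of_bmo_content_norm[OF assms(1,2)] .
  show thesis
  proof
    fix t :: real assume t: "0 < t"
    have "ennreal t * osc_content \<beta> u c (cube a l) t \<le> ennreal (B * l powr \<beta>)"
      using order_trans[OF choquet_chebyshev[OF t] c] assms by (simp flip: ennreal_mult')
    then have "osc_content \<beta> u c (cube a l) t \<le> ennreal (B * l powr \<beta>) / ennreal t"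
      by (rule le_divide_ennreal[OF t])
    then show "osc_content \<beta> u c (cube a l) t \<le> ennreal (B * l powr \<beta> / t)"
      using t assms by (simp add: divide_ennreal)
  qed
qed

lemma hausdorff_content_cube_pos:
  fixes a :: "'a::euclidean_space" and \<beta> :: real
  assumes "0 < \<beta>" "\<beta> \<le> DIM('a)" "0 < l"
  obtains v where "0 < v" "ennreal v \<le> hausdorff_content \<beta> (cube a l)"
proof
  show "0 < unit_ball_vol \<beta> * (l / 2) powr \<beta>" using assms by simp
  have "ennreal (unit_ball_vol \<beta> * (l / 2) powr \<beta>) \<le> hausdorff_content \<beta> (ball (a + (l / 2) *\<^sub>R One) (l / 2))"
    using assms by (intro hausdorff_content_ball_ge) auto
  also have "\<dots> \<le> hausdorff_content \<beta> (cube a l)"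
    using ball_subset_cube[of "a + (l / 2) *\<^sub>R One" "l / 2"] by (intro hausdorff_content_mono) auto
  finally show "ennreal (unit_ball_vol \<beta> * (l / 2) powr \<beta>) \<le> hausdorff_content \<beta> (cube a l)" .
qed

text \<open>The vanishing infimum gives for each k a constant \<open>c k\<close> whose deviation set
  at level t has content of order 1 / (k t). Since the cube has positive content, two such sets
  leave a common good point, so \<open>c\<close> is a Cauchy sequence. Its limit has deviation sets
  of content 0 at every positive level.\<close>

lemma bmo_content_norm_eq_0D:
  fixes u :: "'a::euclidean_space \<Rightarrow> ereal" and \<beta> :: real
  assumes \<beta>: "0 < \<beta>" "\<beta> \<le> DIM('a)" and l: "0 < l" and 0: "bmo_content_norm \<beta> u = 0"
  obtains c where "\<And>t. 0 < t \<Longrightarrow> osc_content \<beta> u c (cube a l) t = 0"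
proof -
  define L where "L = l powr \<beta>"
  have L: "0 < L" using l by (simp add: L_def)
  have "\<exists>c. \<forall>t>0. osc_content \<beta> u c (cube a l) t \<le> ennreal (inverse (Suc k) * L / t)" for k
    unfolding L_def
    by (rule weak_type_of_bmo_content_norm[of \<beta> u "inverse (Suc k)" l a]) (use 0 l in auto)
  then obtain c where c: "\<And>k t. 0 < t \<Longrightarrow>
      osc_content \<beta> u (c k) (cube a l) t \<le> ennreal (inverse (Suc k) * L / t)"
    by metis
  obtain v where v: "0 < v" "ennreal v \<le> hausdorff_content \<beta> (cube a l)"
    using hausdorff_content_cube_pos[OF \<beta> l] .
  have to0: "(\<lambda>k. inverse (Suc k) * L / t) \<longlonglongrightarrow> 0" for t
    using tendsto_mult[OF LIMSEQ_inverse_real_of_nat tendsto_const[of "L / t"]] by simp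
  have "Cauchy c"
    unfolding Cauchy_def
  proof (intro allI impI)
    fix e :: real assume e: "0 < e"
    have "eventually (\<lambda>k. inverse (Suc k) * L / (e / 3) < v / 2) sequentially"
      using to0[of "e / 3"] by (rule order_tendstoD) (use v in simp)
    then obtain N where N: "\<And>k. N \<le> k \<Longrightarrow> inverse (Suc k) * L / (e / 3) < v / 2"
      by (auto simp: eventually_sequentially)
    have "dist (c i) (c j) < e" if "N \<le> i" "N \<le> j" for i j
    proof -
      have "osc_content \<beta> u (c i) (cube a l) (e / 3) +
          osc_content \<beta> u (c j) (cube a l) (e / 3) \<le>
          ennreal (inverse (Suc i) * L / (e / 3)) + ennreal (inverse (Suc j) * L / (e / 3))"
        using e by (intro add_mono c) auto
      also have "\<dots> = ennreal (inverse (Suc i) * L / (e / 3) + inverse (Suc j) * L / (e / 3))"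
        using e L by (intro ennreal_plus[symmetric]) auto
      also have "\<dots> < ennreal v"
        using N[OF that(1)] N[OF that(2)] v by (intro ennreal_lessI) auto
      also note v(2)
      finally obtain z where "z \<in> cube a l" "z \<notin> {x \<in> cube a l. dev u (c i) x > ennreal (e / 3)}"
          "z \<notin> {x \<in> cube a l. dev u (c j) x > ennreal (e / 3)}"
        by (rule exists_point_outside)
      then have "\<bar>c j - c i\<bar> \<le> 2 * (e / 3)"
        using e by (intro dist_le_of_dev_le[of u _ z]) auto
      then show ?thesis using e unfolding dist_real_def by linarith
    qed
    then show "\<exists>M. \<forall>m\<ge>M. \<forall>n\<ge>M. dist (c m) (c n) < e" by blast
  qed
  then obtain c0 where c0: "c \<longlonglongrightarrow> c0" by (meson Cauchy_convergent convergent_def)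
  show thesis
  proof
    fix t :: real assume t: "0 < t"
    define h where "h = osc_content \<beta> u c0 (cube a l) t"
    have ev: "eventually (\<lambda>k. h \<le> ennreal (inverse (Suc k) * L / (t / 2))) sequentially"
      using tendstoD[OF c0 half_gt_zero[OF t]]
    proof eventually_elim
      case (elim k)
      have "h \<le> osc_content \<beta> u (c k) (cube a l) (t / 2)"
        unfolding h_def
      proof (intro hausdorff_content_mono Collect_mono impI conjI; elim conjE)
        fix x assume "dev u c0 x > ennreal t"
        also have "dev u c0 x \<le> dev u (c k) x + ennreal \<bar>c k - c0\<bar>" by (rule dev_le_triangle)
        also have "\<dots> \<le> dev u (c k) x + ennreal (t / 2)"
          using elim t by (intro add_left_mono ennreal_leI) (simp add: dist_real_def)
        finally have "ennreal (t / 2) + ennreal (t / 2) < dev u (c k) x + ennreal (t / 2)"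
          using t by (simp flip: ennreal_plus)
        then show "dev u (c k) x > ennreal (t / 2)" by (meson add_right_mono not_le)
      qed
      also have "\<dots> \<le> ennreal (inverse (Suc k) * L / (t / 2))" using t by (intro c) auto
      finally show ?case .
    qed
    have "(\<lambda>k. ennreal (inverse (Suc k) * L / (t / 2))) \<longlonglongrightarrow> ennreal 0"
      by (intro tendsto_ennrealI to0)
    then have "h \<le> ennreal 0"
      using ev by (rule tendsto_lowerbound) auto
    then show "osc_content \<beta> u c0 (cube a l) t = 0" by (simp add: h_def)
  qed
qed

lemma john_nirenberg_bmo_content:
  fixes u :: "'a::euclidean_space \<Rightarrow> ereal" and \<beta> :: real
  assumes \<beta>: "0 < \<beta>" "\<beta> \<le> DIM('a)" and l: "0 < l" and fin: "bmo_content_norm \<beta> u < \<infinity>"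
  shows "\<exists>c. \<forall>t>0. osc_content \<beta> u c (cube a l) t
     \<le> (if bmo_content_norm \<beta> u = 0 then 0
        else ennreal (3 * unit_ball_vol \<beta> * DIM('a) powr \<beta> * l powr \<beta> *
          exp (- (ln 2 * unit_ball_vol \<beta> / (32 * 120 powr \<beta>)) * t / enn2real (bmo_content_norm \<beta> u))))"
proof (cases "bmo_content_norm \<beta> u = 0")
  case True
  obtain c where "\<And>t. 0 < t \<Longrightarrow> osc_content \<beta> u c (cube a l) t = 0"
    using bmo_content_norm_eq_0D[OF \<beta> l True, of a] by blast
  then show ?thesis using True by (intro exI[of _ c]) simp
next
  case False
  define B where "B = enn2real (bmo_content_norm \<beta> u)"
  have Beq: "bmo_content_norm \<beta> u = ennreal B" using fin by (simp add: B_def)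
  have B: "0 < B" using False Beq by (cases "0 < B") (auto simp: ennreal_neg)
  define \<epsilon> where "\<epsilon> = unit_ball_vol \<beta> / (8 * 120 powr \<beta>)"
  have \<epsilon>: "0 < \<epsilon>" using \<beta> by (simp add: \<epsilon>_def)
  \<comment> \<open>Chebyshev's inequality at level A, with 2B strictly above the seminorm, gives
    content at most \<open>2 * B * l powr \<beta> / A = \<epsilon> * l powr \<beta>\<close>, the
    threshold of \<open>john_nirenberg\<close>. The resulting rate ln 2 / (2A) equals ln 2 *
    \<epsilon> / (4B), whence the denominator \<open>32 * 120 powr \<beta>\<close>.\<close>
  define A where "A = 2 * B / \<epsilon>"
  have A: "0 < A" using B \<epsilon> by (simp add: A_def)
  have jn: "\<exists>c. \<forall>t\<ge>0. osc_content \<beta> u c (cube a l) t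
    \<le> ennreal (3 * unit_ball_vol \<beta> * DIM('a) powr \<beta> * l powr \<beta> * exp (- (ln 2 / 2) * t / A))"
  proof (rule john_nirenberg[OF \<beta> A l])
    fix a :: 'a and l :: real assume l: "0 < l"
    obtain c where "osc_content \<beta> u c (cube a l) A \<le> ennreal (2 * B * l powr \<beta> / A)"
      using weak_type_of_bmo_content_norm[of \<beta> u "2 * B" l a] l B A Beq by (auto simp: ennreal_less_iff)
    also have "2 * B * l powr \<beta> / A = \<epsilon> * l powr \<beta>" using B \<epsilon> by (simp add: A_def)
    finally show "\<exists>c. osc_content \<beta> u c (cube a l) A
       \<le> ennreal (unit_ball_vol \<beta> / (8 * 120 powr \<beta>) * l powr \<beta>)" unfolding \<epsilon>_def by blast
  qed
  have eq: "- (ln 2 / 2) * t / A = - (ln 2 * unit_ball_vol \<beta> / (32 * 120 powr \<beta>)) * t / B" for t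
    using B \<epsilon> by (simp add: A_def \<epsilon>_def field_simps)
  show ?thesis
    using jn False unfolding B_def[symmetric] eq by (elim exE, intro exI) auto
qed

lemma exp_osc_decay_of_john_nirenberg:
  fixes u :: "'a::euclidean_space \<Rightarrow> ereal" and \<beta> :: real
  assumes "0 < C" "0 < k" "bmo_content_norm \<beta> u < \<infinity>"
    and *: "\<And>a l. 0 < l \<Longrightarrow> \<exists>c. \<forall>t>0. osc_content \<beta> u c (cube a l) t
     \<le> (if bmo_content_norm \<beta> u = 0 then 0
        else ennreal (C * l powr \<beta> * exp (- k * t / enn2real (bmo_content_norm \<beta> u))))"
  shows "exp_osc_decay \<beta> u"
proof -
  define B where "B = enn2real (bmo_content_norm \<beta> u)"
  have Beq: "bmo_content_norm \<beta> u = ennreal B" using assms(3) by (simp add: B_def)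
  \<comment> \<open>For seminorm 0 the deviation sets have content 0 and any rate will do; the value
    1 is arbitrary.\<close>
  define k' where "k' = (if B = 0 then 1 else k / B)"
  have B: "0 \<le> B" by (simp add: B_def)
  show ?thesis
    unfolding exp_osc_decay_def
  proof (rule exI[of _ k'], rule conjI, goal_cases)
    case 1
    show "0 < k'" using assms B by (simp add: k'_def)
  next
    case 2
    show ?case
    proof (rule exI[of _ C], intro conjI allI impI assms(1))
    fix a :: 'a and l :: real assume "0 < l"
    from *[OF this, of a] obtain c where c: "\<And>t. 0 < t \<Longrightarrow>
        osc_content \<beta> u c (cube a l) t \<le> (if bmo_content_norm \<beta> u = 0 then 0
        else ennreal (C * l powr \<beta> * exp (- k * t / B)))" unfolding B_def by blast
    have "osc_content \<beta> u c (cube a l) t \<le> ennreal (C * l powr \<beta> * exp (- k' * t))"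
      if "0 < t" for t
      using c[OF that] B unfolding Beq by (cases "B = 0") (auto simp: k'_def)
    then show "\<exists>c. \<forall>t>0. osc_content \<beta> u c (cube a l) t
       \<le> ennreal (C * l powr \<beta> * exp (- k' * t))" by blast
    qed
  qed
qed

text \<open>Passing from deviation from c to deviation from 0 shifts levels by |c|, which the
  exponential factor in \<open>D\<close> pays for. Levels up to |c| are bounded by the content of
  the whole cube.\<close>

lemma choquet_abs_finite:
  fixes u :: "'a::euclidean_space \<Rightarrow> ereal"
  assumes \<beta>: "0 < \<beta>" and u: "exp_osc_decay \<beta> u" and l: "0 < l"
  shows "choquet \<beta> (cube a l) (\<lambda>x. e2ennreal \<bar>u x\<bar>) < \<infinity>"
proof -
  obtain k C c where k: "0 < k" "0 < C" and c: "\<And>t. 0 < t \<Longrightarrow>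
     osc_content \<beta> u c (cube a l) t \<le> ennreal (C * l powr \<beta> * exp (- k * t))"
    using u l unfolding exp_osc_decay_def by meson
  obtain M where M: "0 < M" "\<And>t. 0 < t \<Longrightarrow> exp (- k * t powr 1) \<le> M / (1 + t)\<^sup>2"
    using exp_powr_decay[of k 1] k by auto
  define V where "V = unit_ball_vol \<beta> * DIM('a) powr \<beta>"
  define D where "D = max C V * l powr \<beta> * exp (k * \<bar>c\<bar>)"
  have D: "0 \<le> D" using k by (auto simp: D_def)
  have "choquet \<beta> (cube a l) (\<lambda>x. e2ennreal \<bar>u x\<bar>) \<le> ennreal (D * M)"
  proof (rule choquet_le_of_decay)
    fix t :: real assume t: "0 < t"
    define S where "S = {x \<in> cube a l. e2ennreal \<bar>u x\<bar> > ennreal t}"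
    have "hausdorff_content \<beta> S \<le> ennreal (D * exp (- k * t))"
    proof (cases "t \<le> \<bar>c\<bar>")
      case True
      have "hausdorff_content \<beta> S \<le> hausdorff_content \<beta> (cube a l)"
        by (rule hausdorff_content_mono) (auto simp: S_def)
      also have "\<dots> \<le> ennreal (V * l powr \<beta>)"
        unfolding V_def by (rule hausdorff_content_cube_le[OF l])
      also have "\<dots> \<le> ennreal (max C V * l powr \<beta> * exp (k * (\<bar>c\<bar> - t)))"
      proof (rule ennreal_leI)
        have "V * l powr \<beta> * 1 \<le> max C V * l powr \<beta> * exp (k * (\<bar>c\<bar> - t))"
          using k True by (intro mult_mono) auto
        then show "V * l powr \<beta> \<le> max C V * l powr \<beta> * exp (k * (\<bar>c\<bar> - t))" by simp
      qed
      also have "max C V * l powr \<beta> * exp (k * (\<bar>c\<bar> - t)) = D * exp (- k * t)"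
        by (simp add: D_def algebra_simps flip: exp_add)
      finally show ?thesis .
    next
      case False
      have "S \<subseteq> {y \<in> cube a l. dev u c y > ennreal (t - \<bar>c\<bar>)}"
      proof
        fix x assume "x \<in> S"
        then have x: "x \<in> cube a l" "ennreal t < dev u 0 x" by (auto simp: S_def dev_def)
        note x(2)
        also have "dev u 0 x \<le> dev u c x + ennreal \<bar>c\<bar>" using dev_le_triangle[of u 0 x c] by simp
        finally have "ennreal (t - \<bar>c\<bar>) + ennreal \<bar>c\<bar> < dev u c x + ennreal \<bar>c\<bar>"
          using False by (simp flip: ennreal_plus)
        then have "dev u c x > ennreal (t - \<bar>c\<bar>)" by (meson add_right_mono not_le)
        then show "x \<in> {y \<in> cube a l. dev u c y > ennreal (t - \<bar>c\<bar>)}" using x by simp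
      qed
      then have "hausdorff_content \<beta> S \<le> osc_content \<beta> u c (cube a l) (t - \<bar>c\<bar>)"
        by (rule hausdorff_content_mono)
      also have "\<dots> \<le> ennreal (C * l powr \<beta> * exp (- k * (t - \<bar>c\<bar>)))"
        using False by (intro c) auto
      also have "\<dots> \<le> ennreal (max C V * l powr \<beta> * exp (- k * (t - \<bar>c\<bar>)))"
        by (intro ennreal_leI mult_right_mono) auto
      also have "max C V * l powr \<beta> * exp (- k * (t - \<bar>c\<bar>)) = D * exp (- k * t)"
        by (simp add: D_def algebra_simps flip: exp_add)
      finally show ?thesis .
    qed
    also have "\<dots> \<le> ennreal (D * (M / (1 + t)\<^sup>2))"
      using M(2)[OF t] D t by (intro ennreal_leI mult_left_mono) auto
    finally show "hausdorff_content \<beta> S \<le> ennreal (D * M / (1 + t)\<^sup>2)" by simp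
  qed (use D M in auto)
  then show ?thesis by (simp add: order_le_less_trans)
qed

subsection \<open>Truncated Riesz kernels\<close>

text \<open>The cutoff bounds the kernel and keeps its tail. At \<rho> = 0 this is the full
  potential; since \<open>0 powr (- s) = 0\<close>, the pole y = x then contributes nothing, and
  comparisons with truncations rely on \<mu> having no atoms.\<close>

definition trunc_pot :: "real \<Rightarrow> real \<Rightarrow> 'a::euclidean_space measure \<Rightarrow> 'a \<Rightarrow> ennreal" where
  "trunc_pot s \<rho> \<mu> x = (\<integral>\<^sup>+ y. ennreal (max (norm (x - y)) \<rho> powr (- s)) \<partial>\<mu>)"

definition local_pot :: "real \<Rightarrow> real \<Rightarrow> 'a::euclidean_space measure \<Rightarrow> 'a \<Rightarrow> ennreal" where
  "local_pot s \<rho> \<mu> x = (\<integral>\<^sup>+ y\<in>ball x \<rho>. ennreal (norm (x - y) powr (- s)) \<partial>\<mu>)"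

lemma powr_minus_mono:
  fixes x y s :: real
  assumes "0 < x" "x \<le> y" "0 \<le> s"
  shows "y powr (- s) \<le> x powr (- s)"
  using assms by (simp add: powr_mono2')

text \<open>For t \<le> 1 / 2 one has 1 / (1 - t) \<le> 1 + 2t \<le> exp (2t), and exp z \<le> 1 + z
  exp z with z = 2ts \<le> s makes the bound linear in t. It measures how much the kernel grows when
  its argument shrinks by a fraction t.\<close>

lemma one_minus_powr_le:
  fixes s t :: real
  assumes "0 \<le> s" "0 \<le> t" "t \<le> 1 / 2"
  shows "(1 - t) powr (- s) \<le> 1 + 2 * s * exp s * t"
proof -
  have "1 \<le> (1 - t) * (1 + 2 * t)"
    using assms mult_left_mono[of t "1 / 2" t] by (simp add: algebra_simps)
  then have "1 / (1 + 2 * t) \<le> 1 - t" using assms by (simp add: pos_divide_le_eq)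
  then have "(1 - t) powr (- s) \<le> (1 / (1 + 2 * t)) powr (- s)"
    using assms by (intro powr_minus_mono) auto
  also have "\<dots> = (1 + 2 * t) powr s"
    using assms by (simp add: powr_divide powr_minus field_simps)
  also have "\<dots> \<le> exp (2 * t) powr s"
    using assms exp_ge_add_one_self[of "2 * t"] by (intro powr_mono2) auto
  also have "\<dots> = exp (2 * t * s)" by (simp add: powr_def)
  also have "\<dots> \<le> 1 + 2 * t * s * exp (2 * t * s)"
  proof -
    have "1 - 2 * t * s \<le> exp (- (2 * t * s))" using exp_ge_add_one_self[of "- (2 * t * s)"] by simp
    then have "(1 - 2 * t * s) * exp (2 * t * s) \<le> exp (- (2 * t * s)) * exp (2 * t * s)"
      by (rule mult_right_mono) simp
    then show ?thesis by (simp add: algebra_simps flip: exp_add)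
  qed
  also have "\<dots> \<le> 1 + 2 * t * s * exp s"
    using assms mult_right_mono[of "2 * t" 1 s] by (intro add_left_mono mult_left_mono) auto
  finally show ?thesis by (simp add: mult_ac)
qed

lemma one_plus_powr_ge:
  fixes s t :: real
  assumes "0 \<le> s" "0 \<le> t"
  shows "1 - s * t \<le> (1 + t) powr (- s)"
proof -
  have "1 - s * t \<le> exp (- (s * t))" using exp_ge_add_one_self[of "- (s * t)"] by simp
  also have "\<dots> = exp t powr (- s)" by (simp add: powr_def mult.commute)
  also have "\<dots> \<le> (1 + t) powr (- s)"
    using assms exp_ge_add_one_self[of t] by (intro powr_minus_mono) auto
  finally show ?thesis .
qed

text \<open>Moving the centre by d changes \<open>max (norm (x - y)) \<rho>\<close> by a factor of
  at most 1 + d / \<rho>. This multiplicative comparison spreads finiteness from one point to all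
  and, as the factor tends to 1, yields continuity without dominated convergence.\<close>

lemma trunc_pot_harnack:
  fixes \<mu> :: "'a::euclidean_space measure"
  assumes [measurable_cong]: "sets \<mu> = sets borel" and "0 < \<rho>" "0 \<le> s"
  shows "trunc_pot s \<rho> \<mu> x' \<le> ennreal ((1 + dist x x' / \<rho>) powr s) * trunc_pot s \<rho> \<mu> x"
proof -
  define d where "d = dist x x'"
  have d: "0 \<le> d" by (simp add: d_def)
  have "trunc_pot s \<rho> \<mu> x' \<le> (\<integral>\<^sup>+ y. ennreal ((1 + d / \<rho>) powr s) * ennreal (max (norm (x - y)) \<rho> powr (- s)) \<partial>\<mu>)"
    unfolding trunc_pot_def
  proof (intro nn_integral_mono)
    fix y
    define m m' where "m = max (norm (x - y)) \<rho>" and "m' = max (norm (x' - y)) \<rho>"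
    have pos: "0 < m" "0 < m'" "\<rho> \<le> m'" using assms by (auto simp: m_def m'_def)
    have "norm (x - y) \<le> norm (x' - y) + d"
      using dist_triangle[of x y x'] by (simp add: d_def dist_norm)
    then have "m \<le> m' + d" using d by (auto simp: m_def m'_def)
    also have "\<dots> \<le> m' + m' / \<rho> * d"
      using pos d assms mult_right_mono[of \<rho> m' d] by (simp add: field_simps)
    finally have "m \<le> (1 + d / \<rho>) * m'" by (simp add: algebra_simps)
    then have "((1 + d / \<rho>) * m') powr (- s) \<le> m powr (- s)"
      using pos assms by (intro powr_minus_mono) auto
    then have "(1 + d / \<rho>) powr s * (((1 + d / \<rho>) * m') powr (- s)) \<le> (1 + d / \<rho>) powr s * m powr (- s)"
      by (intro mult_left_mono) auto
    also have "(1 + d / \<rho>) powr s * (((1 + d / \<rho>) * m') powr (- s)) = m' powr (- s)"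
    proof -
      have "0 < 1 + d / \<rho>" using assms d by (simp add: add_pos_nonneg)
      then have "(1 + d / \<rho>) powr s * (1 + d / \<rho>) powr (- s) = 1" by (simp flip: powr_add)
      then show ?thesis by (simp add: powr_mult flip: mult.assoc)
    qed
    finally show "ennreal (m' powr (- s)) \<le> ennreal ((1 + d / \<rho>) powr s) * ennreal (m powr (- s))"
      by (simp flip: ennreal_mult' add: ennreal_leI)
  qed
  also have "\<dots> = ennreal ((1 + d / \<rho>) powr s) * trunc_pot s \<rho> \<mu> x"
    unfolding trunc_pot_def by (rule nn_integral_cmult) simp
  finally show ?thesis by (simp add: d_def)
qed

lemma trunc_pot_finite:
  fixes \<mu> :: "'a::euclidean_space measure"
  assumes "sets \<mu> = sets borel" "0 < \<rho>" "0 \<le> s" "trunc_pot s \<rho> \<mu> x0 < \<infinity>"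
  shows "trunc_pot s \<rho> \<mu> x < \<infinity>"
  using trunc_pot_harnack[OF assms(1-3), of x x0] assms(4)
  by (auto simp: ennreal_mult_less_top intro: order_le_less_trans)

lemma trunc_pot_continuous:
  fixes \<mu> :: "'a::euclidean_space measure"
  assumes \<mu>: "sets \<mu> = sets borel" "0 < \<rho>" "0 \<le> s" and fin: "trunc_pot s \<rho> \<mu> x0 < \<infinity>"
  shows "continuous_on UNIV (\<lambda>x. enn2real (trunc_pot s \<rho> \<mu> x))"
proof -
  define v where "v x = enn2real (trunc_pot s \<rho> \<mu> x)" for x
  define h where "h x x' = (1 + dist x x' / \<rho>) powr s" for x x' :: 'a
  have h_pos: "0 < h x x'" for x x'
  proof -
    have "0 < 1 + dist x x' / \<rho>" using assms by (simp add: add_pos_nonneg)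
    then show ?thesis by (simp add: h_def)
  qed
  have eq: "trunc_pot s \<rho> \<mu> x = ennreal (v x)" for x
    using trunc_pot_finite[OF \<mu> fin, of x] by (simp add: v_def)
  have v0: "0 \<le> v x" for x by (simp add: v_def)
  have harnack: "v x' \<le> h x x' * v x" for x x'
    using trunc_pot_harnack[OF \<mu>, of x' x] v0 h_pos[of x x']
    by (simp add: eq h_def ennreal_le_iff flip: ennreal_mult')
  have "isCont v x" for x
    unfolding isCont_def
  proof (rule tendsto_sandwich)
    have "((\<lambda>x'. h x x') \<longlongrightarrow> (1 + dist x x / \<rho>) powr s) (at x)"
      unfolding h_def using assms by (intro tendsto_intros) auto
    then have h1: "((\<lambda>x'. h x x') \<longlongrightarrow> 1) (at x)" by simp
    show "((\<lambda>x'. v x / h x x') \<longlongrightarrow> v x) (at x)"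
      using tendsto_divide[OF tendsto_const h1, of "v x"] by simp
    show "((\<lambda>x'. h x x' * v x) \<longlongrightarrow> v x) (at x)"
      using tendsto_mult[OF h1 tendsto_const, of "v x"] by simp
    show "\<forall>\<^sub>F x' in at x. v x' \<le> h x x' * v x" using harnack by simp
    show "\<forall>\<^sub>F x' in at x. v x / h x x' \<le> v x'"
    proof (intro always_eventually allI)
      fix x'
      have "v x \<le> h x x' * v x'" using harnack[of x x'] by (simp add: h_def dist_commute)
      then show "v x / h x x' \<le> v x'" using h_pos[of x x'] by (simp add: field_simps)
    qed
  qed
  then have "continuous_on UNIV v" by (simp add: continuous_on_eq_continuous_at)
  then show ?thesis unfolding v_def .
qed

lemma AE_neq_point:
  assumes "sets \<mu> = sets borel" "emeasure \<mu> {x :: 'a::euclidean_space} = 0"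
  shows "AE y in \<mu>. y \<noteq> x"
proof (rule AE_I)
  show "{y \<in> space \<mu>. \<not> y \<noteq> x} \<subseteq> {x}" by auto
qed (use assms in auto)

lemma trunc_pot_le_pot:
  fixes \<mu> :: "'a::euclidean_space measure"
  assumes "sets \<mu> = sets borel" "emeasure \<mu> {x} = 0" "0 < \<rho>" "0 \<le> s"
  shows "trunc_pot s \<rho> \<mu> x \<le> trunc_pot s 0 \<mu> x"
  unfolding trunc_pot_def
  using AE_neq_point[OF assms(1,2)] assms(3,4)
  by (intro nn_integral_mono_AE) (auto elim!: eventually_mono intro!: ennreal_leI powr_minus_mono)

lemma pot_eq_SUP:
  fixes \<mu> :: "'a::euclidean_space measure"
  assumes \<mu>[measurable_cong]: "sets \<mu> = sets borel" and "emeasure \<mu> {x} = 0" and s: "0 \<le> s"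
  shows "trunc_pot s 0 \<mu> x = (SUP k. trunc_pot s (1 / real (Suc k)) \<mu> x)"
proof -
  have "trunc_pot s 0 \<mu> x =
      (\<integral>\<^sup>+ y. (SUP k. ennreal (max (norm (x - y)) (1 / real (Suc k)) powr (- s))) \<partial>\<mu>)"
    unfolding trunc_pot_def
  proof (rule nn_integral_cong_AE)
    show "AE y in \<mu>. ennreal (max (norm (x - y)) 0 powr (- s)) =
        (SUP k. ennreal (max (norm (x - y)) (1 / real (Suc k)) powr (- s)))"
      using AE_neq_point[OF assms(1,2)]
    proof eventually_elim
      case (elim y)
      then have pos: "0 < norm (x - y)" by simp
      show ?case
      proof (rule antisym)
        obtain k where "inverse (real (Suc k)) < norm (x - y)" using reals_Archimedean[OF pos] by auto
        then show "ennreal (max (norm (x - y)) 0 powr (- s)) \<le>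
            (SUP k. ennreal (max (norm (x - y)) (1 / real (Suc k)) powr (- s)))"
          by (intro SUP_upper2[of k]) (auto simp: max_def inverse_eq_divide)
        show "(SUP k. ennreal (max (norm (x - y)) (1 / real (Suc k)) powr (- s))) \<le>
            ennreal (max (norm (x - y)) 0 powr (- s))"
          using pos s by (intro SUP_least ennreal_leI powr_minus_mono) auto
      qed
    qed
  qed
  also have "\<dots> = (SUP k. trunc_pot s (1 / real (Suc k)) \<mu> x)"
    unfolding trunc_pot_def
  proof (rule nn_integral_monotone_convergence_SUP)
    show "incseq (\<lambda>k y. ennreal (max (norm (x - y)) (1 / real (Suc k)) powr (- s)))"
      unfolding incseq_def le_fun_def using s
      by (auto intro!: ennreal_leI powr_minus_mono max.mono simp: field_simps less_max_iff_disj)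
  qed simp
  finally show ?thesis .
qed

section \<open>Dyadic decompositions of potentials\<close>

lemma ex_half_power:
  fixes t :: real
  assumes "0 < t" "t < 1"
  obtains k where "(1 / 2) ^ Suc k \<le> t" "t < (1 / 2) ^ k"
proof -
  obtain N where N: "(1 / 2 :: real) ^ N < t" using real_arch_pow_inv[OF assms(1), of "1 / 2"] by auto
  define m where "m = (LEAST m. (1 / 2 :: real) ^ m \<le> t)"
  have m: "(1 / 2 :: real) ^ m \<le> t" unfolding m_def
    by (rule LeastI[of "\<lambda>m. (1 / 2 :: real) ^ m \<le> t", OF less_imp_le[OF N]])
  then have "m \<noteq> 0" using assms by (intro notI) simp
  then obtain k where k: "m = Suc k" by (cases m) auto
  then have "\<not> (1 / 2 :: real) ^ k \<le> t" using not_less_Least[of k "\<lambda>m. (1 / 2 :: real) ^ m \<le> t"] by (simp add: m_def)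
  then show thesis using m k by (intro that[of k]) auto
qed

lemma ex_two_power:
  fixes t :: real
  assumes "1 \<le> t"
  obtains k where "2 ^ k \<le> t" "t < 2 ^ Suc k"
proof -
  obtain N where N: "t < 2 ^ N" using real_arch_pow[of 2 t] by auto
  define m where "m = (LEAST m. t < 2 ^ m)"
  have m: "t < 2 ^ m" unfolding m_def by (rule LeastI[of "\<lambda>m. t < 2 ^ m", OF N])
  then have "m \<noteq> 0" using assms by (intro notI) simp
  then obtain k where k: "m = Suc k" by (cases m) auto
  then have "\<not> t < 2 ^ k" using not_less_Least[of k "\<lambda>m. t < 2 ^ m"] by (simp add: m_def)
  then show thesis using m k by (intro that[of k]) auto
qed

text \<open>The geometric series over dyadic annuli, with ratio \<open>2 powr (s - b)\<close> below
  1 for s < b. The factor \<open>2 powr s\<close> comes from evaluating the kernel at the inner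
  radius of each annulus.\<close>

definition local_const :: "real \<Rightarrow> real \<Rightarrow> real" where
  "local_const s b = 2 powr s / (1 - 2 powr (s - b))"

lemma local_const_pos: "s < b \<Longrightarrow> 0 < local_const s b"
  by (simp add: local_const_def powr_less_one)

lemma half_powr_real: "((1 / 2) ^ k) powr r = (2 powr (- r)) ^ k" for r :: real
proof -
  have "((1 / 2) ^ k) powr r = (2 powr (- real k)) powr r"
    by (simp add: powr_minus_divide powr_realpow power_one_over)
  also have "\<dots> = (2 powr (- r)) ^ k"
    by (simp add: powr_powr powr_power mult.commute)
  finally show ?thesis .
qed

text \<open>At distance about 2^(-k) \<rho> the kernel is of size (2^(-k) \<rho>)^(-s) and the mass
  at most S (2^(-k) \<rho>)^b. The exponent b is kept free: it is \<beta> for the fractional maximal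
  bound and n when Lebesgue measure is inserted.\<close>

lemma local_pot_le:
  fixes \<mu> :: "'a::euclidean_space measure"
  assumes \<mu>[measurable_cong]: "sets \<mu> = sets borel" and s: "0 \<le> s" "s < b" and \<rho>: "0 < \<rho>" and S: "0 \<le> S"
    and growth: "\<And>r. 0 < r \<Longrightarrow> r \<le> \<rho> \<Longrightarrow> emeasure \<mu> (ball x r) \<le> ennreal (S * r powr b)"
  shows "local_pot s \<rho> \<mu> x \<le> ennreal (local_const s b * S * \<rho> powr (b - s))"
proof -
  define w where "w k = ((1 / 2) ^ Suc k * \<rho>) powr (- s)" for k
  have [measurable]: "ball z r \<in> sets \<mu>" for z r using \<mu> by simp
  have "local_pot s \<rho> \<mu> x \<le> (\<integral>\<^sup>+ y. (\<Sum>k. ennreal (w k) * indicator (ball x ((1 / 2) ^ k * \<rho>)) y) \<partial>\<mu>)"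
    unfolding local_pot_def
  proof (intro nn_integral_mono)
    fix y
    show "ennreal (norm (x - y) powr (- s)) * indicator (ball x \<rho>) y \<le>
        (\<Sum>k. ennreal (w k) * indicator (ball x ((1 / 2) ^ k * \<rho>)) y)"
    proof (cases "y \<in> ball x \<rho> \<and> y \<noteq> x")
      case True
      then have "0 < norm (x - y) / \<rho>" "norm (x - y) / \<rho> < 1" using \<rho> by (auto simp: dist_norm)
      then obtain k where k: "(1 / 2) ^ Suc k \<le> norm (x - y) / \<rho>" "norm (x - y) / \<rho> < (1 / 2) ^ k"
        by (rule ex_half_power)
      have "norm (x - y) powr (- s) \<le> w k"
        unfolding w_def using k(1) \<rho> s by (intro powr_minus_mono) (auto simp: field_simps)
      moreover have "y \<in> ball x ((1 / 2) ^ k * \<rho>)"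
        using k(2) \<rho> by (simp add: dist_norm field_simps)
      ultimately have "ennreal (norm (x - y) powr (- s)) * indicator (ball x \<rho>) y \<le>
          (\<Sum>k\<in>{k}. ennreal (w k) * indicator (ball x ((1 / 2) ^ k * \<rho>)) y)"
        using True by (simp add: ennreal_leI)
      also have "\<dots> \<le> (\<Sum>k. ennreal (w k) * indicator (ball x ((1 / 2) ^ k * \<rho>)) y)"
        by (rule sum_le_suminf) auto
      finally show ?thesis .
    qed auto
  qed
  also have "\<dots> = (\<Sum>k. ennreal (w k) * emeasure \<mu> (ball x ((1 / 2) ^ k * \<rho>)))"
    by (subst nn_integral_suminf) (auto simp: nn_integral_cmult_indicator \<mu>)
  also have "\<dots> \<le> (\<Sum>k. ennreal (2 powr s * S * \<rho> powr (b - s) * (2 powr (s - b)) ^ k))"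
  proof (intro suminf_le)
    fix k
    have "ennreal (w k) * emeasure \<mu> (ball x ((1 / 2) ^ k * \<rho>)) \<le>
        ennreal (w k) * ennreal (S * ((1 / 2) ^ k * \<rho>) powr b)"
      using \<rho> by (intro mult_left_mono growth) (auto simp: mult_le_cancel_right2 power_le_one)
    also have "\<dots> = ennreal (w k * (S * ((1 / 2) ^ k * \<rho>) powr b))"
      by (simp add: w_def flip: ennreal_mult')
    also have "w k * (S * ((1 / 2) ^ k * \<rho>) powr b) =
        2 powr s * S * \<rho> powr (b - s) * (2 powr (s - b)) ^ k"
    proof -
      have *: "w k = 2 powr s * (2 powr s) ^ k * \<rho> powr (- s)"
        using \<rho> by (simp only: w_def powr_mult half_powr_real) (simp add: half_powr_real)
      have **: "((1 / 2) ^ k * \<rho>) powr b = (2 powr (- b)) ^ k * \<rho> powr b"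
        by (simp only: powr_mult half_powr_real)
      have "(2 powr s) ^ k * (2 powr (- b)) ^ k = ((2::real) powr (s - b)) ^ k"
        by (simp flip: power_mult_distrib powr_add)
      moreover have "\<rho> powr (- s) * \<rho> powr b = \<rho> powr (b - s)"
        by (simp flip: powr_add)
      moreover have "w k * (S * ((1 / 2) ^ k * \<rho>) powr b) =
          2 powr s * S * (\<rho> powr (- s) * \<rho> powr b) * ((2 powr s) ^ k * (2 powr (- b)) ^ k)"
        unfolding * ** by (simp add: mult_ac)
      ultimately show ?thesis by simp
    qed
    finally show "ennreal (w k) * emeasure \<mu> (ball x ((1 / 2) ^ k * \<rho>)) \<le>
        ennreal (2 powr s * S * \<rho> powr (b - s) * (2 powr (s - b)) ^ k)" .
  qed auto
  also have "\<dots> = ennreal (2 powr s * S * \<rho> powr (b - s) * (1 / (1 - 2 powr (s - b))))"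
    using s S by (intro suminf_ennreal_eq sums_mult geometric_sums) (auto simp: powr_less_one)
  finally show ?thesis by (simp add: local_const_def mult_ac)
qed

text \<open>The kernel has one power more than the growth of the mass, so the annuli at distance 2^k
  \<rho> form a convergent series of order M / \<rho>. The extra power is the gain from
  differentiating the kernel of order s.\<close>

lemma trunc_pot_growth_le:
  fixes \<mu> :: "'a::euclidean_space measure"
  assumes \<mu>[measurable_cong]: "sets \<mu> = sets borel" and s: "0 \<le> s" and \<rho>: "0 < \<rho>" and M: "0 \<le> M"
    and growth: "\<And>r. \<rho> \<le> r \<Longrightarrow> emeasure \<mu> (ball x r) \<le> ennreal (M * r powr s)"
  shows "trunc_pot (s + 1) \<rho> \<mu> x \<le> ennreal (2 powr (s + 1) * M / \<rho>)"
proof -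
  define w where "w k = (2 ^ k * \<rho>) powr (- (s + 1))" for k
  have [measurable]: "ball z r \<in> sets \<mu>" for z r using \<mu> by simp
  have "trunc_pot (s + 1) \<rho> \<mu> x \<le> (\<integral>\<^sup>+ y. (\<Sum>k. ennreal (w k) * indicator (ball x (2 ^ Suc k * \<rho>)) y) \<partial>\<mu>)"
    unfolding trunc_pot_def
  proof (intro nn_integral_mono)
    fix y
    define m where "m = max (norm (x - y)) \<rho>"
    have "1 \<le> m / \<rho>" using \<rho> by (simp add: m_def)
    then obtain k where k: "2 ^ k \<le> m / \<rho>" "m / \<rho> < 2 ^ Suc k" by (rule ex_two_power)
    have "m powr (- (s + 1)) \<le> w k"
      unfolding w_def using k(1) \<rho> s by (intro powr_minus_mono) (auto simp: field_simps)
    moreover have "y \<in> ball x (2 ^ Suc k * \<rho>)"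
    proof -
      have "m < 2 ^ Suc k * \<rho>" using k(2) \<rho> by (simp add: field_simps)
      then show ?thesis by (simp add: m_def dist_norm)
    qed
    ultimately have "ennreal (m powr (- (s + 1))) \<le> (\<Sum>k\<in>{k}. ennreal (w k) * indicator (ball x (2 ^ Suc k * \<rho>)) y)"
      by (simp add: ennreal_leI)
    also have "\<dots> \<le> (\<Sum>k. ennreal (w k) * indicator (ball x (2 ^ Suc k * \<rho>)) y)"
      by (rule sum_le_suminf) auto
    finally show "ennreal (max (norm (x - y)) \<rho> powr (- (s + 1))) \<le> \<dots>" by (simp add: m_def)
  qed
  also have "\<dots> = (\<Sum>k. ennreal (w k) * emeasure \<mu> (ball x (2 ^ Suc k * \<rho>)))"
    by (subst nn_integral_suminf) (auto simp: nn_integral_cmult_indicator \<mu>)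
  also have "\<dots> \<le> (\<Sum>k. ennreal (2 powr (s + 1) * M / \<rho> * (1 / 2) ^ Suc k))"
  proof (intro suminf_le)
    fix k
    have "\<rho> * 1 \<le> \<rho> * 2 ^ Suc k" using \<rho> by (intro mult_left_mono one_le_power) auto
    then have "ennreal (w k) * emeasure \<mu> (ball x (2 ^ Suc k * \<rho>)) \<le>
        ennreal (w k) * ennreal (M * (2 ^ Suc k * \<rho>) powr s)"
      by (intro mult_left_mono growth) (auto simp: mult.commute)
    also have "\<dots> = ennreal (w k * (M * (2 ^ Suc k * \<rho>) powr s))"
      by (simp add: w_def flip: ennreal_mult')
    also have "w k * (M * (2 ^ Suc k * \<rho>) powr s) = 2 powr (s + 1) * M / \<rho> * (1 / 2) ^ Suc k"
    proof -
      define z where "z = 2 ^ k * \<rho>"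
      have z: "0 < z" using \<rho> by (simp add: z_def)
      have "w k = z powr (- s) / z"
        using z by (simp add: w_def z_def powr_diff powr_minus_divide)
      moreover have "(2 ^ Suc k * \<rho>) powr s = 2 powr s * z powr s"
        by (simp add: z_def mult.assoc powr_mult)
      moreover have "z powr (- s) * z powr s = 1" using z by (simp flip: powr_add)
      ultimately have "w k * (M * (2 ^ Suc k * \<rho>) powr s) = 2 powr s * M / z"
        by (simp add: field_simps)
      then show ?thesis using \<rho> by (simp add: z_def powr_add power_one_over field_simps)
    qed
    finally show "ennreal (w k) * emeasure \<mu> (ball x (2 ^ Suc k * \<rho>)) \<le>
        ennreal (2 powr (s + 1) * M / \<rho> * (1 / 2) ^ Suc k)" .
  qed auto
  also have "\<dots> = ennreal (2 powr (s + 1) * M / \<rho> * 1)"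
    using M \<rho> by (intro suminf_ennreal_eq sums_mult power_half_series) auto
  finally show ?thesis by simp
qed

text \<open>Over distances up to \<rho> / 2 the kernel of order s varies by at most a multiple of
  \<rho> times the kernel of order s + 1. The half keeps the relative change t at most 1 / 2, as
  \<open>one_minus_powr_le\<close> demands. Together with \<open>trunc_pot_growth_le\<close> the
  factors \<rho> cancel, and the oscillation is bounded independently of the scale.\<close>

lemma trunc_pot_osc:
  fixes \<mu> :: "'a::euclidean_space measure"
  assumes \<mu>[measurable_cong]: "sets \<mu> = sets borel" and "0 < \<rho>" "0 \<le> s" and d: "dist x x' \<le> \<rho> / 2"
  shows "trunc_pot s \<rho> \<mu> x' \<le> trunc_pot s \<rho> \<mu> x + ennreal (s * exp s * \<rho>) * trunc_pot (s + 1) \<rho> \<mu> x"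
proof -
  have "trunc_pot s \<rho> \<mu> x' \<le> (\<integral>\<^sup>+ y. ennreal (max (norm (x - y)) \<rho> powr (- s)) +
      ennreal (s * exp s * \<rho>) * ennreal (max (norm (x - y)) \<rho> powr (- (s + 1))) \<partial>\<mu>)"
    unfolding trunc_pot_def
  proof (intro nn_integral_mono)
    fix y
    define m m' where "m = max (norm (x - y)) \<rho>" and "m' = max (norm (x' - y)) \<rho>"
    have pos: "0 < m" "0 < m'" "\<rho> \<le> m" using assms by (auto simp: m_def m'_def)
    have "norm (x - y) \<le> norm (x' - y) + dist x x'"
      using dist_triangle[of x y x'] by (simp add: dist_norm)
    then have "m - \<rho> / 2 \<le> m'" using d assms by (auto simp: m_def m'_def)
    define t where "t = \<rho> / (2 * m)"
    have t: "0 < t" "t \<le> 1 / 2" using pos assms by (auto simp: t_def field_simps)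
    have "m * (1 - t) = m - \<rho> / 2" using pos by (simp add: t_def field_simps)
    also note \<open>m - \<rho> / 2 \<le> m'\<close>
    finally have "m' powr (- s) \<le> (m * (1 - t)) powr (- s)"
      using pos t assms by (intro powr_minus_mono) auto
    also have "\<dots> = m powr (- s) * (1 - t) powr (- s)" by (rule powr_mult)
    also have "\<dots> \<le> m powr (- s) * (1 + 2 * s * exp s * t)"
      using t assms by (intro mult_left_mono one_minus_powr_le) auto
    also have "\<dots> = m powr (- s) * (1 + s * exp s * (\<rho> / m))" by (simp add: t_def)
    also have "\<dots> = m powr (- s) + s * exp s * \<rho> * m powr (- (s + 1))"
    proof -
      have *: "- (s + 1) = - s - 1" by simp
      have "m powr (- (s + 1)) = m powr (- s) / m"
        unfolding * powr_diff using pos by simp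
      then show ?thesis by (simp add: algebra_simps)
    qed
    finally show "ennreal (m' powr (- s)) \<le> ennreal (m powr (- s)) + ennreal (s * exp s * \<rho>) * ennreal (m powr (- (s + 1)))"
      using assms by (simp flip: ennreal_mult' ennreal_plus add: ennreal_leI)
  qed
  also have "\<dots> = trunc_pot s \<rho> \<mu> x + ennreal (s * exp s * \<rho>) * trunc_pot (s + 1) \<rho> \<mu> x"
    unfolding trunc_pot_def by (subst nn_integral_add) (auto simp: nn_integral_cmult)
  finally show ?thesis .
qed

lemma pot_le_trunc_plus_local:
  fixes \<mu> :: "'a::euclidean_space measure"
  assumes \<mu>[measurable_cong]: "sets \<mu> = sets borel" and "0 < \<rho>" "0 \<le> s"
  shows "trunc_pot s 0 \<mu> x \<le> trunc_pot s \<rho> \<mu> x + local_pot s \<rho> \<mu> x"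
proof -
  have [measurable]: "ball z r \<in> sets \<mu>" for z r using \<mu> by simp
  have "trunc_pot s 0 \<mu> x \<le> (\<integral>\<^sup>+ y. ennreal (max (norm (x - y)) \<rho> powr (- s)) +
       ennreal (norm (x - y) powr (- s)) * indicator (ball x \<rho>) y \<partial>\<mu>)"
    unfolding trunc_pot_def
    by (intro nn_integral_mono) (auto simp: dist_norm max_def split: split_indicator)
  also have "\<dots> = trunc_pot s \<rho> \<mu> x + local_pot s \<rho> \<mu> x"
    unfolding trunc_pot_def local_pot_def by (subst nn_integral_add) auto
  finally show ?thesis .
qed

text \<open>If every ball of radius r \<le> \<rho> about x had mass below S r^\<beta>,
  \<open>local_pot_le\<close> would bound the local potential at x. So each bad point is the centre
  of a heavy ball, and a Vitali selection turns masses into content: the weak-type bound of the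
  fractional maximal function.\<close>

lemma local_pot_weak_type:
  fixes \<mu> :: "'a::euclidean_space measure"
  assumes \<mu>: "sets \<mu> = sets borel" and s: "0 \<le> s" "s < \<beta>" and \<rho>: "0 < \<rho>" and S: "0 < S" and A: "A \<subseteq> ball c R"
  shows "hausdorff_content \<beta> {x \<in> A. local_pot s \<rho> \<mu> x > ennreal (local_const s \<beta> * S * \<rho> powr (\<beta> - s))}
    \<le> ennreal (unit_ball_vol \<beta> * 5 powr \<beta> / S) * emeasure \<mu> (ball c (R + \<rho>))"
proof -
  define Z where "Z = {x \<in> A. local_pot s \<rho> \<mu> x > ennreal (local_const s \<beta> * S * \<rho> powr (\<beta> - s))}"
  have v: "0 < unit_ball_vol \<beta>" using s by simp
  have "\<exists>r. 0 < r \<and> r \<le> \<rho> \<and> ennreal (S * r powr \<beta>) \<le> emeasure \<mu> (ball x r)" if "x \<in> Z" for x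
  proof (rule ccontr)
    assume "\<not> ?thesis"
    then have "local_pot s \<rho> \<mu> x \<le> ennreal (local_const s \<beta> * S * \<rho> powr (\<beta> - s))"
      using S by (intro local_pot_le[OF \<mu> s \<rho>]) (auto simp: not_le intro: less_imp_le)
    then show False using that by (auto simp: Z_def)
  qed
  then obtain r where r: "\<And>x. x \<in> Z \<Longrightarrow> 0 < r x \<and> r x \<le> \<rho>"
      and mass: "\<And>x. x \<in> Z \<Longrightarrow> ennreal (S * r x powr \<beta>) \<le> emeasure \<mu> (ball x (r x))" by metis
  obtain y :: "nat \<Rightarrow> 'a" and q where yq: "\<And>j. q j = 0 \<or> (\<exists>i\<in>Z. y j = i \<and> q j = r i)"
    "(\<Union>i\<in>Z. ball i (r i)) \<subseteq> (\<Union>j. ball (y j) (5 * q j))"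
    "(\<Sum>j. ennreal (S * q j powr \<beta>)) \<le> emeasure \<mu> (\<Union>i\<in>Z. ball i (r i))"
    by (rule vitali_disjoint_sum[OF \<mu> S r mass]) (assumption | rule that)+
  have q0: "0 \<le> q j" for j using yq(1)[of j] r by (auto simp: less_imp_le)
  have "hausdorff_content \<beta> Z \<le> (\<Sum>j. ennreal (unit_ball_vol \<beta> * (5 * q j) powr \<beta>))"
  proof (rule hausdorff_content_cover)
    show "Z \<subseteq> (\<Union>j. ball (y j) (5 * q j))" using yq(2) r by force
  qed (use q0 in auto)
  also have "\<dots> = (\<Sum>j. ennreal (unit_ball_vol \<beta> * 5 powr \<beta> / S) * ennreal (S * q j powr \<beta>))"
    using S q0 v by (intro suminf_cong) (simp flip: ennreal_mult' add: powr_mult)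
  also have "\<dots> = ennreal (unit_ball_vol \<beta> * 5 powr \<beta> / S) * (\<Sum>j. ennreal (S * q j powr \<beta>))" by simp
  also have "\<dots> \<le> ennreal (unit_ball_vol \<beta> * 5 powr \<beta> / S) * emeasure \<mu> (ball c (R + \<rho>))"
  proof (intro mult_left_mono order_trans[OF yq(3)] emeasure_mono)
    show "(\<Union>i\<in>Z. ball i (r i)) \<subseteq> ball c (R + \<rho>)"
    proof safe
      fix i z assume i: "i \<in> Z" and z: "z \<in> ball i (r i)"
      then have "dist c i < R" "dist i z < \<rho>" using A r[OF i] by (auto simp: Z_def)
      then show "z \<in> ball c (R + \<rho>)" using dist_triangle[of c z i] by simp
    qed
  qed (auto simp: \<mu>)
  finally show ?thesis by (simp add: Z_def)
qed

subsection \<open>Morrey measures have exponentially decaying oscillation\<close>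

lemma dev_enn2ereal_le:
  assumes "p x \<le> ennreal c + y" "ennreal c \<le> p x + y" "0 \<le> c"
  shows "dev (\<lambda>x. enn2ereal (p x)) c x \<le> y"
proof (cases "p x")
  case (real r)
  show ?thesis
  proof (cases y)
    case y: (real q)
    have "r \<le> c + q" "c \<le> r + q" using assms real y by (auto simp flip: ennreal_plus)
    then have "\<bar>r - c\<bar> \<le> q" by linarith
    then show ?thesis using real y by (simp add: dev_def enn2ereal_ennreal ennreal_leI)
  qed simp
next
  case top
  then have "y = top" using assms by (auto simp: top_unique)
  then show ?thesis by simp
qed

lemma exp_osc_decay_of_growth:
  fixes \<mu> :: "'a::euclidean_space measure" and s \<beta> :: real
  assumes \<mu>: "sets \<mu> = sets borel" and atom: "\<And>x. emeasure \<mu> {x} = 0"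
    and s: "0 < s" "s < \<beta>" "\<beta> \<le> DIM('a)" and M: "0 < M"
    and growth: "\<And>x r. 0 < r \<Longrightarrow> emeasure \<mu> (ball x r) \<le> ennreal (M * r powr s)"
    and fin: "trunc_pot s 0 \<mu> x0 < \<infinity>"
  shows "exp_osc_decay \<beta> (\<lambda>x. enn2ereal (trunc_pot s 0 \<mu> x))" (is "exp_osc_decay \<beta> ?u")
proof -
  define n where "n = real DIM('a)"
  have n: "1 \<le> n" using DIM_positive[where 'a='a] by (simp add: n_def Suc_le_eq)
  define osc where "osc = s * exp s * (2 powr (s + 1) * M)"
  have osc: "0 < osc" using s M by (simp add: osc_def)
  define \<omega> where "\<omega> = unit_ball_vol \<beta>"
  have \<omega>: "0 < \<omega>" using s by (simp add: \<omega>_def)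
  define \<epsilon> where "\<epsilon> = \<omega> / (8 * 120 powr \<beta>)"
  have \<epsilon>: "0 < \<epsilon>" using \<omega> by (simp add: \<epsilon>_def)
  \<comment> \<open>With \<open>S = T * l powr (s - \<beta>)\<close> the weak-type bound becomes a
    multiple of \<open>l powr \<beta>\<close>; T is solved from the requirement that this multiple
    be \<epsilon>, and 3n is the ratio of the radius n l + \<rho> to l. The matching deviation
    \<open>loc\<close> no longer depends on l.\<close>
  define T where "T = \<omega> * 5 powr \<beta> * M * (3 * n) powr s / \<epsilon>"
  have T: "0 < T" using \<omega> M n \<epsilon> by (simp add: T_def)
  define loc where "loc = local_const s \<beta> * T * (2 * n) powr (\<beta> - s)"
  have loc: "0 < loc" using local_const_pos[OF s(2)] T n by (simp add: loc_def)
  define A where "A = osc + loc"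
  have A: "0 < A" using osc loc by (simp add: A_def)
  have hyp: "\<exists>c. osc_content \<beta> ?u c (cube a l) A
       \<le> ennreal (unit_ball_vol \<beta> / (8 * 120 powr \<beta>) * l powr \<beta>)" if l: "0 < l" for a :: 'a and l
  proof -
    \<comment> \<open>Two points of the cube are less than n l = \<rho> / 2 apart, the displacement
      allowed in \<open>trunc_pot_osc\<close>.\<close>
    define \<rho> where "\<rho> = 2 * n * l"
    have \<rho>: "0 < \<rho>" using n l by (simp add: \<rho>_def)
    define z where "z = a + (l / 2) *\<^sub>R One"
    have z: "z \<in> cube a l" using cube_midpoint[OF l] by (simp add: z_def)
    have tfin: "trunc_pot s \<rho> \<mu> x < \<infinity>" for x
      by (rule trunc_pot_finite[OF \<mu> \<rho>])
         (use s fin trunc_pot_le_pot[OF \<mu> atom \<rho>, of s x0] in \<open>auto intro: order_le_less_trans\<close>)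
    \<comment> \<open>The constant of the cube is the truncated potential at its midpoint, a real
      number even where the potential itself is infinite.\<close>
    define c where "c = enn2real (trunc_pot s \<rho> \<mu> z)"
    have c: "trunc_pot s \<rho> \<mu> z = ennreal c" "0 \<le> c" using tfin[of z] by (auto simp: c_def)
    define S where "S = T * l powr (s - \<beta>)"
    have S: "0 < S" using T l by (simp add: S_def)
    have osc_le: "trunc_pot s \<rho> \<mu> y \<le> trunc_pot s \<rho> \<mu> x + ennreal osc" if "x \<in> cube a l" "y \<in> cube a l" for x y
    proof -
      have "dist x y \<le> \<rho> / 2" using dist_cube_less[OF that] by (simp add: \<rho>_def n_def)
      then have "trunc_pot s \<rho> \<mu> y \<le> trunc_pot s \<rho> \<mu> x + ennreal (s * exp s * \<rho>) * trunc_pot (s + 1) \<rho> \<mu> x"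
        using s by (intro trunc_pot_osc[OF \<mu> \<rho>]) auto
      also have "\<dots> \<le> trunc_pot s \<rho> \<mu> x + ennreal (s * exp s * \<rho>) * ennreal (2 powr (s + 1) * M / \<rho>)"
        using s M \<rho> by (intro add_left_mono mult_left_mono trunc_pot_growth_le[OF \<mu>] growth) auto
      also have "ennreal (s * exp s * \<rho>) * ennreal (2 powr (s + 1) * M / \<rho>) = ennreal osc"
        using s \<rho> by (simp add: osc_def mult.assoc flip: ennreal_mult')
      finally show ?thesis .
    qed
    have "{y \<in> cube a l. dev ?u c y > ennreal A} \<subseteq>
        {x \<in> cube a l. local_pot s \<rho> \<mu> x > ennreal (local_const s \<beta> * S * \<rho> powr (\<beta> - s))}"
    proof safe
      fix x assume x: "x \<in> cube a l" and dx: "dev ?u c x > ennreal A"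
      have "trunc_pot s 0 \<mu> x \<le> trunc_pot s \<rho> \<mu> x + local_pot s \<rho> \<mu> x"
        using s by (intro pot_le_trunc_plus_local[OF \<mu> \<rho>]) auto
      also have "\<dots> \<le> (ennreal c + ennreal osc) + local_pot s \<rho> \<mu> x"
        using osc_le[OF z x] c by (intro add_right_mono) auto
      finally have 1: "trunc_pot s 0 \<mu> x \<le> ennreal c + (ennreal osc + local_pot s \<rho> \<mu> x)"
        by (simp add: add_ac)
      have "ennreal c \<le> trunc_pot s \<rho> \<mu> x + ennreal osc" using osc_le[OF x z] c by simp
      also have "\<dots> \<le> trunc_pot s 0 \<mu> x + (ennreal osc + local_pot s \<rho> \<mu> x)"
        using trunc_pot_le_pot[OF \<mu> atom \<rho>, of s x] s by (intro add_mono) auto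
      finally have "dev ?u c x \<le> ennreal osc + local_pot s \<rho> \<mu> x"
        using 1 c by (intro dev_enn2ereal_le)
      with dx have "ennreal osc + ennreal loc < ennreal osc + local_pot s \<rho> \<mu> x"
        using osc loc by (simp add: A_def flip: ennreal_plus)
      then have "ennreal loc < local_pot s \<rho> \<mu> x"
        by (meson add_left_mono not_le)
      also have "loc = local_const s \<beta> * S * \<rho> powr (\<beta> - s)"
      proof -
        have "\<rho> powr (\<beta> - s) = (2 * n) powr (\<beta> - s) * l powr (\<beta> - s)"
          by (simp only: \<rho>_def powr_mult)
        moreover have "l powr (s - \<beta>) * l powr (\<beta> - s) = 1" using l by (simp flip: powr_add)
        ultimately show ?thesis by (simp add: S_def loc_def)
      qed
      finally show "ennreal (local_const s \<beta> * S * \<rho> powr (\<beta> - s)) < local_pot s \<rho> \<mu> x" .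
    qed
    then have "osc_content \<beta> ?u c (cube a l) A \<le> hausdorff_content \<beta>
        {x \<in> cube a l. local_pot s \<rho> \<mu> x > ennreal (local_const s \<beta> * S * \<rho> powr (\<beta> - s))}"
      by (rule hausdorff_content_mono)
    also have "\<dots> \<le> ennreal (\<omega> * 5 powr \<beta> / S) * emeasure \<mu> (ball z (n * l + \<rho>))"
      unfolding \<omega>_def using s cube_subset_ball[OF l, of a]
      by (intro local_pot_weak_type[OF \<mu> _ _ \<rho> S]) (auto simp: z_def n_def)
    also have "\<dots> \<le> ennreal (\<omega> * 5 powr \<beta> / S) * ennreal (M * (n * l + \<rho>) powr s)"
      using n l \<rho> by (intro mult_left_mono growth) (auto intro!: add_pos_pos)
    also have "\<dots> = ennreal (\<epsilon> * l powr \<beta>)"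
    proof -
      have "n * l + \<rho> = (3 * n) * l" by (simp add: \<rho>_def)
      then have "M * (n * l + \<rho>) powr s = M * (3 * n) powr s * l powr s" by (simp add: powr_mult)
      then have "\<omega> * 5 powr \<beta> / S * (M * (n * l + \<rho>) powr s) =
          (\<omega> * 5 powr \<beta> * M * (3 * n) powr s / T) * (l powr s / l powr (s - \<beta>))"
        by (simp add: S_def)
      also have "\<omega> * 5 powr \<beta> * M * (3 * n) powr s / T = \<epsilon>"
        using \<omega> M n \<epsilon> by (simp add: T_def)
      finally have "\<omega> * 5 powr \<beta> / S * (M * (n * l + \<rho>) powr s) = \<epsilon> * (l powr s / l powr (s - \<beta>))" .
      also have "l powr s / l powr (s - \<beta>) = l powr \<beta>" using l by (simp flip: powr_diff)
      finally show ?thesis using \<omega> S by (simp flip: ennreal_mult')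
    qed
    finally show ?thesis unfolding \<epsilon>_def \<omega>_def by blast
  qed
  show ?thesis
    unfolding exp_osc_decay_def
  proof (rule exI[of _ "ln 2 / 2 / A"], rule conjI, goal_cases)
    case 2
    show ?case
    proof (rule exI[of _ "3 * unit_ball_vol \<beta> * DIM('a) powr \<beta>"], intro conjI allI impI)
      fix a :: 'a and l :: real assume l: "0 < l"
      have \<beta>: "0 < \<beta>" using s by simp
      obtain c where c: "\<And>t. 0 \<le> t \<Longrightarrow> osc_content \<beta> ?u c (cube a l) t
          \<le> ennreal (3 * unit_ball_vol \<beta> * DIM('a) powr \<beta> * l powr \<beta> * exp (- (ln 2 / 2) * t / A))"
        using john_nirenberg[OF \<beta> s(3) A l hyp, of a] by blast
      show "\<exists>c. \<forall>t>0. osc_content \<beta> ?u c (cube a l) t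
          \<le> ennreal (3 * unit_ball_vol \<beta> * DIM('a) powr \<beta> * l powr \<beta> * exp (- (ln 2 / 2 / A) * t))"
        using c by (intro exI[of _ c]) auto
    qed (use s in auto)
  qed (use A in simp)
qed

section \<open>Quasicontinuity of the potential\<close>

lemma local_pot_content_small:
  fixes \<mu> :: "'a::euclidean_space measure" and s \<beta> :: real
  assumes \<mu>: "sets \<mu> = sets borel" and s: "0 \<le> s" "s < \<beta>"
    and fin: "emeasure \<mu> (ball c (R + 1)) < \<infinity>" and A: "A \<subseteq> ball c R" and "0 < \<tau>" "0 < \<delta>"
  obtains \<rho> where "0 < \<rho>" "hausdorff_content \<beta> {x \<in> A. local_pot s \<rho> \<mu> x > ennreal \<tau>} \<le> ennreal \<delta>"
proof -
  define m where "m = enn2real (emeasure \<mu> (ball c (R + 1)))"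
  have m: "emeasure \<mu> (ball c (R + 1)) = ennreal m" "0 \<le> m" using fin by (auto simp: m_def)
  have v: "0 < unit_ball_vol \<beta>" using s by simp
  define C where "C = local_const s \<beta>"
  have C: "0 < C" using local_const_pos[OF s(2)] by (simp add: C_def)
  define K where "K = unit_ball_vol \<beta> * 5 powr \<beta> * C / \<tau> * m"
  have K: "0 \<le> K" using v C m assms by (simp add: K_def)
  \<comment> \<open>The weak-type bound at height \<tau> is K \<rho>^(\<beta> - s), which tends to 0
    with \<rho>. The cap 1 keeps the enlarged ball inside \<open>ball c (R + 1)\<close>, and K + 1
    avoids a division by 0.\<close>
  define \<rho> where "\<rho> = min 1 ((\<delta> / (K + 1)) powr (1 / (\<beta> - s)))"
  have \<rho>: "0 < \<rho>" "\<rho> \<le> 1" using K assms by (auto simp: \<rho>_def)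
  define S where "S = \<tau> / (C * \<rho> powr (\<beta> - s))"
  have S: "0 < S" using assms C \<rho> by (simp add: S_def)
  show thesis
  proof
    have "C * S * \<rho> powr (\<beta> - s) = \<tau>" using C \<rho> by (simp add: S_def)
    then have "hausdorff_content \<beta> {x \<in> A. local_pot s \<rho> \<mu> x > ennreal \<tau>} \<le>
        ennreal (unit_ball_vol \<beta> * 5 powr \<beta> / S) * emeasure \<mu> (ball c (R + \<rho>))"
      using local_pot_weak_type[OF \<mu> s \<rho>(1) S A] by (simp add: C_def)
    also have "\<dots> \<le> ennreal (unit_ball_vol \<beta> * 5 powr \<beta> / S) * emeasure \<mu> (ball c (R + 1))"
      using \<rho> by (intro mult_left_mono emeasure_mono subset_ball) (auto simp: \<mu>)
    also have "\<dots> = ennreal (K * \<rho> powr (\<beta> - s))"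
    proof -
      have "unit_ball_vol \<beta> * 5 powr \<beta> / S * m = K * \<rho> powr (\<beta> - s)"
        by (simp add: K_def S_def)
      then show ?thesis using m v S by (simp flip: ennreal_mult')
    qed
    also have "\<dots> \<le> ennreal \<delta>"
    proof (rule ennreal_leI)
      have "\<rho> powr (\<beta> - s) \<le> ((\<delta> / (K + 1)) powr (1 / (\<beta> - s))) powr (\<beta> - s)"
        using \<rho> s by (intro powr_mono2) (auto simp: \<rho>_def)
      also have "\<dots> = \<delta> / (K + 1)" using s K assms by (simp add: powr_powr)
      finally have "K * \<rho> powr (\<beta> - s) \<le> K * (\<delta> / (K + 1))" using K by (intro mult_left_mono)
      also have "\<dots> \<le> \<delta>" using K assms by (simp add: field_simps)
      finally show "K * \<rho> powr (\<beta> - s) \<le> \<delta>" .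
    qed
    finally show "hausdorff_content \<beta> {x \<in> A. local_pot s \<rho> \<mu> x > ennreal \<tau>} \<le> ennreal \<delta>" .
  qed (use \<rho> in simp)
qed

text \<open>Lower semicontinuity: the potential is the supremum of its continuous truncations at
  radii 1 / (k + 1), so the set is a union of sets given by strict inequalities between real-valued
  continuous functions.\<close>

lemma open_pot_gt_trunc_pot:
  fixes \<mu> :: "'a::euclidean_space measure"
  assumes \<mu>: "sets \<mu> = sets borel" and atom: "\<And>x. emeasure \<mu> {x} = 0"
    and s: "0 \<le> s" and \<rho>: "0 < \<rho>" and fin: "trunc_pot s 0 \<mu> x0 < \<infinity>" and e: "0 \<le> e"
  shows "open {x. trunc_pot s \<rho> \<mu> x + ennreal e < trunc_pot s 0 \<mu> x}"
proof -
  have tfin: "trunc_pot s \<rho> \<mu> x0 < \<infinity>" if "0 < \<rho>" for \<rho>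
    using fin trunc_pot_le_pot[OF \<mu> atom that s, of x0] by (rule order_le_less_trans[rotated])
  define v where "v \<rho> x = enn2real (trunc_pot s \<rho> \<mu> x)" for \<rho> x
  have v: "trunc_pot s \<rho> \<mu> x = ennreal (v \<rho> x)" "0 \<le> v \<rho> x" if "0 < \<rho>" for \<rho> x
    using trunc_pot_finite[OF \<mu> that s tfin[OF that], of x] by (auto simp: v_def)
  have "{x. trunc_pot s \<rho> \<mu> x + ennreal e < trunc_pot s 0 \<mu> x} =
      (\<Union>k. {x. v \<rho> x + e < v (1 / real (Suc k)) x})"
    unfolding pot_eq_SUP[OF \<mu> atom s] less_SUP_iff
    using v \<rho> e by (auto simp: ennreal_less_iff simp flip: ennreal_plus)
  moreover have "open {x. v \<rho> x + e < v (1 / real (Suc k)) x}" for k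
    unfolding v_def
    by (intro open_Collect_less continuous_intros trunc_pot_continuous[OF \<mu> _ s tfin]) (use \<rho> in auto)
  ultimately show ?thesis by auto
qed

text \<open>Off the open set where some truncation misses the potential by more than \<open>2\<^bsup>-j\<^esup>\<close>, the potential is
  a uniform limit of its continuous truncations.\<close>

lemma quasicontinuous_pot:
  fixes \<mu> :: "'a::euclidean_space measure" and s \<beta> :: real
  assumes \<mu>: "sets \<mu> = sets borel" and atom: "\<And>x. emeasure \<mu> {x} = 0"
    and s: "0 \<le> s" "s < \<beta>" and fin: "trunc_pot s 0 \<mu> x0 < \<infinity>"
    and bnd: "\<And>x r. emeasure \<mu> (ball x r) < \<infinity>" and \<Omega>: "open \<Omega>" "bounded \<Omega>"
  shows "quasicontinuous_on \<beta> \<Omega> (\<lambda>x. enn2ereal (trunc_pot s 0 \<mu> x))"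
  unfolding quasicontinuous_on_def
proof (intro allI impI)
  fix \<epsilon> :: real assume \<epsilon>: "0 < \<epsilon>"
  obtain R where R: "\<Omega> \<subseteq> ball 0 R"
    using bounded_subset_ballD[OF \<Omega>(2), of 0] by blast
  have ex: "\<exists>\<rho>>0. hausdorff_content \<beta> {x \<in> \<Omega>. local_pot s \<rho> \<mu> x > ennreal ((1 / 2) ^ j)} \<le> ennreal (\<epsilon> / 2 * (1 / 2) ^ Suc j)" for j :: nat
    by (rule local_pot_content_small[OF \<mu> s bnd R, where \<tau>="(1 / 2) ^ j" and \<delta>="\<epsilon> / 2 * (1 / 2) ^ Suc j"])
       (use \<epsilon> in auto)
  then obtain \<rho> where \<rho>: "\<And>j. 0 < \<rho> j"
    "\<And>j. hausdorff_content \<beta> {x \<in> \<Omega>. local_pot s (\<rho> j) \<mu> x > ennreal ((1 / 2) ^ j)} \<le> ennreal (\<epsilon> / 2 * (1 / 2) ^ Suc j)"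
    by metis
  have tfin: "trunc_pot s (\<rho> j) \<mu> x < \<infinity>" for j x
    using trunc_pot_finite[OF \<mu> \<rho>(1)[of j] s(1), of x0 x] fin trunc_pot_le_pot[OF \<mu> atom[of x0] \<rho>(1)[of j] s(1)]
    by (meson order_le_less_trans)
  \<comment> \<open>The content bound is inherited from the superlevel sets of
    \<open>local_pot\<close>, openness from the semicontinuity of the potential; \<open>V j\<close>
    has both.\<close>
  define V where "V j = \<Omega> \<inter> {x. trunc_pot s (\<rho> j) \<mu> x + ennreal ((1 / 2) ^ j) < trunc_pot s 0 \<mu> x}" for j
  define U where "U = (\<Union>j. V j)"
  have "open U" unfolding U_def V_def
    by (intro open_UN ballI open_Int \<Omega> open_pot_gt_trunc_pot[OF \<mu> atom s(1) \<rho>(1) fin]) auto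
  moreover have "U \<subseteq> \<Omega>" by (auto simp: U_def V_def)
  moreover have "hausdorff_content \<beta> U < ennreal \<epsilon>"
  proof -
    have sub: "V j \<subseteq> {x \<in> \<Omega>. local_pot s (\<rho> j) \<mu> x > ennreal ((1 / 2) ^ j)}" for j
    proof
      fix x assume x: "x \<in> V j"
      then have "trunc_pot s (\<rho> j) \<mu> x + ennreal ((1 / 2) ^ j) < trunc_pot s 0 \<mu> x"
        by (simp add: V_def)
      also note pot_le_trunc_plus_local[OF \<mu> \<rho>(1)[of j] s(1), of x]
      finally have "trunc_pot s (\<rho> j) \<mu> x + ennreal ((1 / 2) ^ j) < trunc_pot s (\<rho> j) \<mu> x + local_pot s (\<rho> j) \<mu> x" .
      then have "ennreal ((1 / 2) ^ j) < local_pot s (\<rho> j) \<mu> x" by (meson add_left_mono not_le)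
      then show "x \<in> {x \<in> \<Omega>. local_pot s (\<rho> j) \<mu> x > ennreal ((1 / 2) ^ j)}" using x by (auto simp: V_def)
    qed
    have "hausdorff_content \<beta> U \<le> (\<Sum>j. hausdorff_content \<beta> (V j))"
      unfolding U_def by (rule hausdorff_content_countable_subadditive)
    also have "\<dots> \<le> (\<Sum>j. ennreal (\<epsilon> / 2 * (1 / 2) ^ Suc j))"
      by (intro suminf_le order_trans[OF hausdorff_content_mono[OF sub] \<rho>(2)]) auto
    also have "\<dots> = ennreal (\<epsilon> / 2 * 1)"
      using \<epsilon> by (intro suminf_ennreal_eq sums_mult power_half_series) auto
    also have "\<dots> < ennreal \<epsilon>" using \<epsilon> by (intro ennreal_lessI) auto
    finally show ?thesis .
  qed
  moreover have fin': "trunc_pot s 0 \<mu> x < \<infinity>" if "x \<in> \<Omega> - U" for x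
  proof -
    have "x \<notin> V 0" using that by (auto simp: U_def)
    then have "trunc_pot s 0 \<mu> x \<le> trunc_pot s (\<rho> 0) \<mu> x + ennreal ((1 / 2) ^ 0)"
      using that by (simp add: V_def not_less)
    also have "\<dots> < \<infinity>" using tfin[of 0 x] by simp
    finally show ?thesis .
  qed
  moreover have "continuous_on (\<Omega> - U) (\<lambda>x. enn2ereal (trunc_pot s 0 \<mu> x))"
  proof -
    define p where "p x = enn2real (trunc_pot s 0 \<mu> x)" for x
    define v where "v j x = enn2real (trunc_pot s (\<rho> j) \<mu> x)" for j x
    have p: "trunc_pot s 0 \<mu> x = ennreal (p x)" "0 \<le> p x" if "x \<in> \<Omega> - U" for x
      using fin'[OF that] by (auto simp: p_def)
    have v: "trunc_pot s (\<rho> j) \<mu> x = ennreal (v j x)" "0 \<le> v j x" for j x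
      using tfin[of j x] by (auto simp: v_def)
    have close: "\<bar>v j x - p x\<bar> \<le> (1 / 2) ^ j" if x: "x \<in> \<Omega> - U" for j x
    proof -
      have "v j x \<le> p x"
        using trunc_pot_le_pot[OF \<mu> atom[of x] \<rho>(1)[of j] s(1)] p[OF x] v[of j x] by simp
      moreover have "trunc_pot s 0 \<mu> x \<le> trunc_pot s (\<rho> j) \<mu> x + ennreal ((1 / 2) ^ j)"
        using x by (auto simp: U_def V_def not_less)
      then have "p x \<le> v j x + (1 / 2) ^ j"
        using p[OF x] v[of j x] by (simp flip: ennreal_plus)
      ultimately show ?thesis by linarith
    qed
    have "uniform_limit (\<Omega> - U) v p sequentially"
    proof (rule uniform_limitI)
      fix e :: real assume "0 < e"
      have "(\<lambda>j. (1 / 2 :: real) ^ j) \<longlonglongrightarrow> 0" by (rule LIMSEQ_power_zero) simp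
      then have "\<forall>\<^sub>F j in sequentially. (1 / 2 :: real) ^ j < e"
        using \<open>0 < e\<close> by (rule order_tendstoD)
      then show "\<forall>\<^sub>F j in sequentially. \<forall>x\<in>\<Omega> - U. dist (v j x) (p x) < e"
        by eventually_elim (use close in \<open>auto simp: dist_real_def intro: order_le_less_trans\<close>)
    qed
    moreover have "continuous_on (\<Omega> - U) (v j)" for j
      unfolding v_def
      by (rule continuous_on_subset[OF trunc_pot_continuous[OF \<mu> \<rho>(1) s(1) tfin]]) simp
    ultimately have "continuous_on (\<Omega> - U) p"
      by (intro uniform_limit_theorem[where f=v and F=sequentially]) auto
    then have "continuous_on (\<Omega> - U) (\<lambda>x. ereal (p x))" by (rule continuous_on_ereal)
    then show ?thesis
      by (rule continuous_on_cong[THEN iffD1, rotated -1]) (auto simp: p enn2ereal_ennreal)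
  qed
  ultimately show "\<exists>U. open U \<and> U \<subseteq> \<Omega> \<and> hausdorff_content \<beta> U < ennreal \<epsilon> \<and>
        (\<forall>x\<in>\<Omega> - U. \<bar>enn2ereal (trunc_pot s 0 \<mu> x)\<bar> \<noteq> \<infinity>) \<and>
        continuous_on (\<Omega> - U) (\<lambda>x. enn2ereal (trunc_pot s 0 \<mu> x))"
    by (intro exI[of _ U]) (auto simp: less_top[symmetric] dest!: fin')
qed

section \<open>Comparison with Lebesgue integrals\<close>

lemma nn_integral_le_choquet:
  fixes g :: "'a::euclidean_space \<Rightarrow> ennreal"
  assumes [measurable]: "g \<in> borel_measurable borel" "\<Omega> \<in> sets borel"
  shows "(\<integral>\<^sup>+ x\<in>\<Omega>. g x \<partial>lborel) \<le> choquet (real DIM('a)) \<Omega> g"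
proof -
  \<comment> \<open>The layer-cake formula for a single value in [0,\<infinity>]. Together with
    Fubini's theorem it reduces the claim to comparing measure and content of each superlevel
    set.\<close>
  have layer: "(\<integral>\<^sup>+ t. indicator {t. 0 < t \<and> ennreal t < y} t \<partial>lborel) = y" for y :: ennreal
  proof (cases y)
    case (real r)
    then have "{t. 0 < t \<and> ennreal t < y} = {0<..<r}" by (auto simp: ennreal_less_iff)
    then show ?thesis using real by (simp only: nn_integral_indicator) simp
  next
    case top
    then have *: "{t. 0 < t \<and> ennreal t < y} = {0<..}" by auto
    have "emeasure lborel {0::real<..} = \<infinity>"
    proof (rule ccontr)
      assume "emeasure lborel {0::real<..} \<noteq> \<infinity>"
      then obtain m where m: "emeasure lborel {0::real<..} = ennreal m" "0 \<le> m"
        by (cases "emeasure lborel {0::real<..}") auto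
      have "ennreal (m + 1) = emeasure lborel {0<..<m + 1}" using m by simp
      also have "\<dots> \<le> emeasure lborel {0::real<..}" by (rule emeasure_mono) auto
      finally show False using m by simp
    qed
    then show ?thesis using top unfolding * by simp
  qed
  have "(\<integral>\<^sup>+ x\<in>\<Omega>. g x \<partial>lborel) =
      (\<integral>\<^sup>+ x. (\<integral>\<^sup>+ t. indicator {t. 0 < t \<and> ennreal t < g x} t * indicator \<Omega> x \<partial>lborel) \<partial>lborel)"
    by (intro nn_integral_cong) (subst nn_integral_multc, auto simp: layer)
  also have "\<dots> = (\<integral>\<^sup>+ t. (\<integral>\<^sup>+ x. indicator {t. 0 < t \<and> ennreal t < g x} t * indicator \<Omega> x \<partial>lborel) \<partial>lborel)"
    by (rule lborel_pair.Fubini'[symmetric]) (simp add: indicator_def, measurable)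
  also have "\<dots> = (\<integral>\<^sup>+ t\<in>{0<..}. emeasure lborel {x \<in> \<Omega>. ennreal t < g x} \<partial>lborel)"
  proof (intro nn_integral_cong)
    fix t :: real
    have "(\<integral>\<^sup>+ x. indicator {t. 0 < t \<and> ennreal t < g x} t * indicator \<Omega> x \<partial>lborel) =
        (\<integral>\<^sup>+ x. indicator {x \<in> \<Omega>. ennreal t < g x} x * indicator {0<..} t \<partial>lborel)"
      by (intro nn_integral_cong) (auto split: split_indicator)
    also have "\<dots> = emeasure lborel {x \<in> \<Omega>. ennreal t < g x} * indicator {0<..} t"
      by (subst nn_integral_multc) auto
    finally show "(\<integral>\<^sup>+ x. indicator {t. 0 < t \<and> ennreal t < g x} t * indicator \<Omega> x \<partial>lborel) = \<dots>" .
  qed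
  also have "\<dots> \<le> choquet (real DIM('a)) \<Omega> g"
    unfolding choquet_def
    by (intro nn_integral_mono mult_right_mono emeasure_lborel_le_hausdorff_content) auto
  finally show ?thesis .
qed

lemma lborel_dev_le:
  fixes u :: "'a::euclidean_space \<Rightarrow> ereal"
  assumes [measurable]: "u \<in> borel_measurable borel"
  shows "(\<integral>\<^sup>+ x\<in>cube a l. dev u c x \<partial>lebesgue) \<le> choquet (real DIM('a)) (cube a l) (dev u c)"
  unfolding nn_integral_completion
  by (rule nn_integral_le_choquet) (auto simp: dev_def[abs_def] cube_def)

lemma cube_borel [measurable]: "cube a l \<in> sets borel"
  by (simp add: cube_def)

lemma emeasure_cube_finite: "emeasure lborel (cube a l) < \<infinity>"
  using emeasure_lborel_box_finite by (simp add: cube_def)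

lemma bounded_subset_cube:
  fixes K :: "'a::euclidean_space set"
  assumes "bounded K"
  obtains a :: 'a and l where "0 < l" "K \<subseteq> cube a l"
proof -
  obtain R where R: "0 < R" "K \<subseteq> ball 0 R" using bounded_subset_ballD[OF assms] by blast
  show thesis
    by (rule that[of "2 * R" "0 - R *\<^sub>R One"]) (use R ball_subset_cube[of 0 R] in auto)
qed

text \<open>At \<beta> = n the content dominates Lebesgue measure, so the content oscillation bounds
  the Lebesgue oscillation on each cube. Local integrability follows too: on a cube |u| is at most
  the deviation from c plus |c|, and both are integrable.\<close>

lemma BMO_of_bmo_content_norm:
  fixes u :: "'a::euclidean_space \<Rightarrow> ereal"
  assumes u[measurable]: "u \<in> borel_measurable borel" and fin: "bmo_content_norm (real DIM('a)) u < \<infinity>"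
  shows "u \<in> BMO"
proof -
  define n where "n = real DIM('a)"
  obtain B where B: "bmo_content_norm n u < ennreal B"
  proof (cases "bmo_content_norm n u")
    case (real r)
    then show thesis by (intro that[of "r + 1"]) (simp add: ennreal_less_iff)
  qed (use fin in \<open>simp add: n_def\<close>)
  have "bmo_norm u \<le> ennreal B"
    unfolding bmo_norm_def
  proof (intro SUP_least)
    fix a :: 'a and l :: real assume "l \<in> {0<..}"
    then have l: "0 < l" by simp
    obtain c where c: "choquet n (cube a l) (dev u c) \<le> ennreal B * ennreal (l powr n)"
      by (rule choquet_dev_of_bmo_content_norm[OF B l])
    have "(\<integral>\<^sup>+ x\<in>cube a l. dev u c x \<partial>lebesgue) / ennreal (l ^ DIM('a)) \<le> ennreal B"
      using order_trans[OF lborel_dev_le[OF u, where a=a and l=l and c=c]] c l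
      by (subst divide_ennreal_le_iff) (auto simp: n_def powr_realpow)
    then show "(INF c. (\<integral>\<^sup>+ x\<in>cube a l. dev u c x \<partial>lebesgue) / ennreal (l ^ DIM('a))) \<le> ennreal B"
      by (meson INF_lower2 UNIV_I)
  qed
  then have "bmo_norm u < \<infinity>" by (simp add: order_le_less_trans)
  moreover have "u \<in> L1loc_lebesgue"
    unfolding L1loc_lebesgue_def
  proof (intro CollectI conjI allI impI)
    show "u \<in> borel_measurable lebesgue" using u by (simp add: measurable_completion)
    fix K :: "'a set" assume "compact K"
    then obtain a l where al: "0 < l" "K \<subseteq> cube a l"
      using bounded_subset_cube compact_imp_bounded by metis
    obtain c where c: "choquet n (cube a l) (dev u c) \<le> ennreal B * ennreal (l powr n)"
      by (rule choquet_dev_of_bmo_content_norm[OF B al(1)])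
    have "(\<integral>\<^sup>+ x\<in>K. e2ennreal \<bar>u x\<bar> \<partial>lebesgue) \<le>
        (\<integral>\<^sup>+ x. dev u c x * indicator (cube a l) x + ennreal \<bar>c\<bar> * indicator (cube a l) x \<partial>lebesgue)"
      using dev_le_triangle[of u 0 _ c] al(2)
      by (intro nn_integral_mono) (auto simp: dev_def split: split_indicator)
    also have "\<dots> = (\<integral>\<^sup>+ x\<in>cube a l. dev u c x \<partial>lebesgue) + ennreal \<bar>c\<bar> * emeasure lborel (cube a l)"
      unfolding nn_integral_completion
      by (subst nn_integral_add) (auto simp: dev_def[abs_def] nn_integral_cmult_indicator)
    also have "\<dots> < \<infinity>"
    proof -
      have "(\<integral>\<^sup>+ x\<in>cube a l. dev u c x \<partial>lebesgue) \<le> ennreal B * ennreal (l powr n)"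
        using order_trans[OF lborel_dev_le[OF u, where a=a and l=l and c=c]] c by (simp add: n_def)
      then have "(\<integral>\<^sup>+ x\<in>cube a l. dev u c x \<partial>lebesgue) < \<infinity>"
        by (rule order_le_less_trans) (simp add: ennreal_mult_less_top)
      moreover have "ennreal \<bar>c\<bar> * emeasure lborel (cube a l) < \<infinity>"
        using emeasure_cube_finite[of a l] by (simp add: ennreal_mult_less_top)
      ultimately show ?thesis by simp
    qed
    finally show "(\<integral>\<^sup>+ x\<in>K. e2ennreal \<bar>u x\<bar> \<partial>lebesgue) < \<infinity>" .
  qed
  ultimately show ?thesis by (simp add: BMO_def)
qed

subsection \<open>From bounded mean oscillation to the Morrey condition\<close>

definition centred_cube :: "'a::euclidean_space \<Rightarrow> real \<Rightarrow> 'a set" where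
  "centred_cube x L = cube (x - (L / 2) *\<^sub>R One) L"

lemma centred_cube_borel [measurable]: "centred_cube x L \<in> sets borel"
  by (simp add: centred_cube_def)

lemma emeasure_cube:
  fixes a :: "'a::euclidean_space" and l :: real
  assumes "0 < l"
  shows "emeasure lborel (cube a l) = ennreal (l powr DIM('a))"
  using assms by (simp add: cube_def emeasure_lborel_box_eq inner_simps powr_realpow)

lemma emeasure_centred_cube:
  fixes x :: "'a::euclidean_space" and L :: real
  assumes "0 < L"
  shows "emeasure lborel (centred_cube x L) = ennreal (L powr DIM('a))"
  using emeasure_cube[OF assms] by (simp add: centred_cube_def)

lemma dist_centred_cube:
  fixes x :: "'a::euclidean_space" and L :: real
  assumes "0 < L" "z \<in> centred_cube x L"
  shows "dist x z < DIM('a) * L"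
proof -
  have "x \<in> centred_cube x L"
    using cube_midpoint[OF assms(1), of "x - (L / 2) *\<^sub>R One"] by (simp add: centred_cube_def)
  then show ?thesis using assms(2) unfolding centred_cube_def by (rule dist_cube_less)
qed

lemma centred_cube_mono:
  fixes x :: "'a::euclidean_space"
  assumes "L \<le> L'"
  shows "centred_cube x L \<subseteq> centred_cube x L'"
proof -
  have "x \<bullet> i - L' / 2 \<le> x \<bullet> i - L / 2" "x \<bullet> i - L / 2 + L \<le> x \<bullet> i - L' / 2 + L'" for i :: 'a
    using assms by (auto simp: field_simps)
  then show ?thesis
    unfolding centred_cube_def cube_def by (intro subset_box_imp) (auto simp: inner_simps)
qed

section \<open>Averages of the Riesz kernel over cubes\<close>

definition kernel_avg :: "real \<Rightarrow> 'a::euclidean_space \<Rightarrow> real \<Rightarrow> 'a \<Rightarrow> ennreal" where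
  "kernel_avg s x L y = ennreal (L powr (- real DIM('a))) *
     (\<integral>\<^sup>+ z\<in>centred_cube x L. ennreal (norm (z - y) powr (- s)) \<partial>lborel)"

lemma ennreal_powr_mult_minus: "0 < L \<Longrightarrow> ennreal (L powr (- n)) * (c * ennreal (L powr n)) = c"
proof -
  assume L: "0 < L"
  have "ennreal (L powr (- n)) * (c * ennreal (L powr n)) = c * (ennreal (L powr (- n)) * ennreal (L powr n))"
    by (simp only: mult_ac)
  also have "ennreal (L powr (- n)) * ennreal (L powr n) = 1"
    using L by (simp flip: ennreal_mult' powr_add)
  finally show ?thesis by simp
qed

text \<open>Every point of the cube has distance at most dist x y + n L from y, and the kernel
  decreases. The point z = y, where \<open>powr\<close> returns 0, is discarded as a null
  set.\<close>

lemma kernel_avg_ge: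
  fixes x :: "'a::euclidean_space" and s L :: real
  assumes L: "0 < L" and s: "0 \<le> s"
  shows "ennreal ((dist x y + DIM('a) * L) powr (- s)) \<le> kernel_avg s x L y"
proof -
  define c where "c = ennreal ((dist x y + DIM('a) * L) powr (- s))"
  have "c * ennreal (L powr DIM('a)) = (\<integral>\<^sup>+ z\<in>centred_cube x L. c \<partial>lborel)"
    by (simp add: nn_integral_cmult_indicator emeasure_centred_cube L)
  also have "\<dots> \<le> (\<integral>\<^sup>+ z\<in>centred_cube x L. ennreal (norm (z - y) powr (- s)) \<partial>lborel)"
  proof (rule nn_integral_mono_AE)
    have "AE z in lborel. z \<noteq> y" by (rule AE_lborel_singleton)
    then show "AE z in lborel. c * indicator (centred_cube x L) z \<le>
        ennreal (norm (z - y) powr (- s)) * indicator (centred_cube x L) z"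
    proof eventually_elim
      case (elim z)
      show ?case
      proof (cases "z \<in> centred_cube x L")
        case True
        have "norm (z - y) \<le> dist x y + DIM('a) * L"
          using dist_centred_cube[OF L True] dist_triangle[of z y x] by (simp add: dist_norm norm_minus_commute)
        then show ?thesis using True elim s by (auto simp: c_def intro!: ennreal_leI powr_minus_mono)
      qed simp
    qed
  qed
  finally have "ennreal (L powr (- real DIM('a))) * (c * ennreal (L powr DIM('a))) \<le> kernel_avg s x L y"
    unfolding kernel_avg_def by (rule mult_left_mono) simp
  then show ?thesis by (simp add: ennreal_powr_mult_minus L c_def)
qed

text \<open>A bound independent of the position of the pole y: outside \<open>ball y L\<close> the
  kernel is at most L^(-s), and inside it the local potential of Lebesgue measure, of growth
  exponent n > s, is of order L^(n - s).\<close>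

lemma kernel_avg_le_const:
  fixes x :: "'a::euclidean_space" and s L :: real
  assumes L: "0 < L" and s: "0 \<le> s" "s < DIM('a)"
  shows "kernel_avg s x L y \<le> ennreal ((1 + local_const s DIM('a) * unit_ball_vol DIM('a)) * L powr (- s))"
proof -
  define n where "n = real DIM('a)"
  define V where "V = local_const s n * unit_ball_vol n"
  have V: "0 \<le> V" using local_const_pos[of s n] s by (simp add: V_def n_def)
  have [measurable]: "ball y L \<in> sets borel" by simp
  have "(\<integral>\<^sup>+ z\<in>centred_cube x L. ennreal (norm (z - y) powr (- s)) \<partial>lborel) \<le>
      (\<integral>\<^sup>+ z. ennreal (L powr (- s)) * indicator (centred_cube x L) z +
         ennreal (norm (y - z) powr (- s)) * indicator (ball y L) z \<partial>lborel)"
    using L s by (intro nn_integral_mono)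
      (auto simp: dist_norm norm_minus_commute not_less intro!: ennreal_leI powr_minus_mono split: split_indicator)
  also have "\<dots> = ennreal (L powr (- s)) * ennreal (L powr n) + local_pot s L lborel y"
    unfolding local_pot_def
    by (subst nn_integral_add) (auto simp: nn_integral_cmult_indicator emeasure_centred_cube L n_def)
  also have "\<dots> \<le> ennreal (L powr (- s)) * ennreal (L powr n) + ennreal (V * L powr (n - s))"
    unfolding V_def using s L
    by (intro add_left_mono local_pot_le) (auto simp: n_def emeasure_ball powr_realpow)
  also have "ennreal (L powr (- s)) * ennreal (L powr n) = ennreal (L powr (n - s))"
    by (simp add: algebra_simps flip: ennreal_mult' powr_add)
  also have "ennreal (L powr (n - s)) + ennreal (V * L powr (n - s)) = ennreal ((1 + V) * L powr (- s)) * ennreal (L powr n)"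
  proof -
    have "L powr (- s) * L powr n = L powr (n - s)" by (simp flip: powr_add)
    then have "L powr (n - s) + V * L powr (n - s) = (1 + V) * L powr (- s) * L powr n"
      by (simp add: algebra_simps)
    then show ?thesis using V by (simp flip: ennreal_plus ennreal_mult')
  qed
  finally have "kernel_avg s x L y \<le> ennreal (L powr (- n)) * (ennreal ((1 + V) * L powr (- s)) * ennreal (L powr n))"
    unfolding kernel_avg_def n_def by (rule mult_left_mono) simp
  then show ?thesis by (simp add: ennreal_powr_mult_minus L V_def n_def)
qed

text \<open>The points of the cube are displaced from x by at most half of T = dist x y, so the
  kernel on it exceeds T^(-s) by a relative error of order L / T at most.\<close>

lemma kernel_avg_le_far:
  fixes x :: "'a::euclidean_space" and s L :: real
  assumes L: "0 < L" and s: "0 \<le> s" and far: "2 * DIM('a) * L \<le> dist x y"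
  shows "kernel_avg s x L y \<le> ennreal (dist x y powr (- s) * (1 + 2 * DIM('a) * s * exp s * (L / dist x y)))"
proof -
  define n where "n = real DIM('a)"
  have n: "1 \<le> n" using DIM_positive[where 'a='a] by (simp add: n_def Suc_le_eq)
  define T where "T = dist x y"
  have nL: "0 < n * L" using n L by simp
  have T1: "2 * n * L \<le> T" using far by (simp add: T_def n_def)
  then have "0 < T" using nL by linarith
  note T = T1 this
  define c where "c = T powr (- s) * (1 + 2 * s * exp s * (n * L / T))"
  have "(\<integral>\<^sup>+ z\<in>centred_cube x L. ennreal (norm (z - y) powr (- s)) \<partial>lborel) \<le>
      (\<integral>\<^sup>+ z\<in>centred_cube x L. ennreal c \<partial>lborel)"
  proof (intro nn_integral_mono)
    fix z
    show "ennreal (norm (z - y) powr (- s)) * indicator (centred_cube x L) z \<le> ennreal c * indicator (centred_cube x L) z"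
    proof (cases "z \<in> centred_cube x L")
      case True
      have "T * (1 - n * L / T) = T - n * L" using T by (simp add: field_simps)
      also have "\<dots> \<le> norm (z - y)"
        using dist_centred_cube[OF L True] dist_triangle[of x y z] by (simp add: dist_norm T_def n_def)
      finally have "norm (z - y) powr (- s) \<le> (T * (1 - n * L / T)) powr (- s)"
        using T nL s by (intro powr_minus_mono) (auto simp: field_simps)
      also have "\<dots> = T powr (- s) * (1 - n * L / T) powr (- s)" by (rule powr_mult)
      also have "\<dots> \<le> c"
        unfolding c_def using T nL s by (intro mult_left_mono one_minus_powr_le) (auto simp: field_simps)
      finally show ?thesis using True by (simp add: ennreal_leI)
    qed simp
  qed
  also have "\<dots> = ennreal c * ennreal (L powr n)"
    by (simp add: nn_integral_cmult_indicator emeasure_centred_cube L n_def)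
  finally have "kernel_avg s x L y \<le> ennreal (L powr (- n)) * (ennreal c * ennreal (L powr n))"
    unfolding kernel_avg_def n_def by (rule mult_left_mono) simp
  then have "kernel_avg s x L y \<le> ennreal c" by (simp only: ennreal_powr_mult_minus[OF L])
  then show ?thesis by (simp add: c_def T_def n_def mult_ac)
qed

text \<open>One constant for all positions. While \<open>dist x y\<close> lies between L and 2 n L,
  the quotient L / dist x y is bounded below, and the first summand of C absorbs the crude bound
  into the error term.\<close>

lemma kernel_avg_le:
  fixes s :: real
  assumes s: "0 \<le> s" "s < DIM('a::euclidean_space)"
  obtains C where "0 < C"
    "\<And>(x::'a) y L. 0 < L \<Longrightarrow> kernel_avg s x L y \<le> ennreal (C * L powr (- s))"
    "\<And>(x::'a) y L. 0 < L \<Longrightarrow> L \<le> dist x y \<Longrightarrow> kernel_avg s x L y \<le> ennreal (dist x y powr (- s) * (1 + C * (L / dist x y)))"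
proof -
  define n where "n = real DIM('a)"
  have n: "1 \<le> n" using DIM_positive[where 'a='a] by (simp add: n_def Suc_le_eq)
  define C0 where "C0 = 1 + local_const s n * unit_ball_vol n"
  have C0: "0 < C0" using local_const_pos[of s n] s by (simp add: C0_def n_def add_pos_nonneg)
  define C where "C = C0 * (2 * n) powr s * (2 * n) + 2 * n * s * exp s + C0"
  have C: "C0 \<le> C" "2 * n * s * exp s \<le> C" "C0 * (2 * n) powr s * (2 * n) \<le> C"
    using C0 n s by (auto simp: C_def)
  show thesis
  proof
    show "0 < C" using C0 C by linarith
    fix x y :: 'a and L :: real assume L: "0 < L"
    have le: "kernel_avg s x L y \<le> ennreal (C0 * L powr (- s))"
      unfolding C0_def n_def by (rule kernel_avg_le_const[OF L s])
    also have "\<dots> \<le> ennreal (C * L powr (- s))" using C by (intro ennreal_leI mult_right_mono) auto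
    finally show "kernel_avg s x L y \<le> ennreal (C * L powr (- s))" .
    assume LT: "L \<le> dist x y"
    define T where "T = dist x y"
    have T: "L \<le> T" "0 < T" using LT L by (auto simp: T_def)
    show "kernel_avg s x L y \<le> ennreal (dist x y powr (- s) * (1 + C * (L / dist x y)))"
    proof (cases "2 * n * L \<le> T")
      case True
      then have "kernel_avg s x L y \<le> ennreal (T powr (- s) * (1 + 2 * n * s * exp s * (L / T)))"
        using kernel_avg_le_far[OF L s(1), of x y] by (simp add: T_def n_def)
      also have "\<dots> \<le> ennreal (T powr (- s) * (1 + C * (L / T)))"
        using C T L by (intro ennreal_leI mult_left_mono add_left_mono mult_right_mono) auto
      finally show ?thesis by (simp add: T_def)
    next
      case False
      note le
      also have "C0 * L powr (- s) \<le> C0 * (T / (2 * n)) powr (- s)"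
        using False C0 T n s by (intro mult_left_mono powr_minus_mono) (auto simp: field_simps)
      also have "\<dots> = C0 * (2 * n) powr s * T powr (- s) * 1"
        using T n by (simp add: powr_divide powr_minus field_simps)
      also have "\<dots> \<le> C0 * (2 * n) powr s * T powr (- s) * (2 * n * (L / T))"
        using False C0 T by (intro mult_left_mono) (auto simp: field_simps)
      also have "\<dots> = T powr (- s) * (C0 * (2 * n) powr s * (2 * n) * (L / T))" by (simp add: mult_ac)
      also have "\<dots> \<le> T powr (- s) * (1 + C * (L / T))"
      proof (rule mult_left_mono)
        have "C0 * (2 * n) powr s * (2 * n) * (L / T) \<le> C * (L / T)"
          using C T L by (intro mult_right_mono) auto
        then show "C0 * (2 * n) powr s * (2 * n) * (L / T) \<le> 1 + C * (L / T)" by simp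
      qed simp
      finally show ?thesis by (simp add: T_def ennreal_leI)
    qed
  qed
qed

lemma suminf_two_sided_geometric:
  fixes \<theta> :: real
  assumes "0 \<le> \<theta>" "\<theta> < 1"
  shows "(\<Sum>j. ennreal (if j \<le> J then \<theta> ^ (J - j) else \<theta> ^ (j - J))) \<le> ennreal (2 / (1 - \<theta>))"
proof -
  define f where "f j = ennreal (if j \<le> J then \<theta> ^ (J - j) else \<theta> ^ (j - J))" for j
  have geo: "(\<Sum>j. ennreal (\<theta> ^ j)) = ennreal (1 / (1 - \<theta>))"
    using assms by (intro suminf_ennreal_eq geometric_sums) auto
  have "sum f {..<Suc J} = (\<Sum>j<Suc J. ennreal (\<theta> ^ j))"
    by (rule sum.reindex_bij_witness[of _ "\<lambda>j. J - j" "\<lambda>j. J - j"]) (auto simp: f_def)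
  also have "\<dots> \<le> ennreal (1 / (1 - \<theta>))"
    unfolding geo[symmetric] by (rule sum_le_suminf) auto
  finally have 1: "sum f {..<Suc J} \<le> ennreal (1 / (1 - \<theta>))" .
  have "(\<Sum>j. f (j + Suc J)) \<le> (\<Sum>j. ennreal (\<theta> ^ j))"
    using assms by (intro suminf_le) (auto simp: f_def intro!: ennreal_leI power_decreasing mult_left_le_one_le)
  then have 2: "(\<Sum>j. f (j + Suc J)) \<le> ennreal (1 / (1 - \<theta>))" by (simp only: geo)
  have "(\<Sum>j. f j) = (\<Sum>j. f (j + Suc J)) + sum f {..<Suc J}"
    by (rule suminf_offset) auto
  also have "\<dots> \<le> ennreal (1 / (1 - \<theta>)) + ennreal (1 / (1 - \<theta>))" by (rule add_mono[OF 2 1])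
  also have "\<dots> = ennreal (2 / (1 - \<theta>))" using assms by (simp flip: ennreal_plus)
  finally show ?thesis by (simp add: f_def)
qed

text \<open>The average of the kernel over a small cube dominates a mixture of its averages over dyadic
  dilates, provided that the weights \<open>(1 - q) q\<^sup>j\<close> decay slowly: at distance \<open>2\<^sup>J r\<close> the cubes of
  side up to \<open>2\<^sup>J r\<close> contribute at most \<open>1 - q\<^bsup>J+1\<^esup>\<close> plus an error of order \<open>(1 - q) q\<^sup>J\<close>, and
  the larger cubes contribute an error of this order too.\<close>

lemma kernel_avg_mixture:
  fixes s :: real
  assumes s: "0 < s" "s < DIM('a::euclidean_space)"
  obtains q \<delta> c :: real where "0 < q" "q < 1" "0 < \<delta>" "\<delta> \<le> 1" "0 < c"
    "\<And>(x::'a) y r. 0 < r \<Longrightarrow> ennreal (c * r powr (- s)) * indicator (ball x r) y +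
        (\<Sum>j. ennreal ((1 - q) * q ^ j) * kernel_avg s x (2 ^ j * r) y) \<le> kernel_avg s x (\<delta> * r) y"
proof -
  define n where "n = real DIM('a)"
  have n: "1 \<le> n" using DIM_positive[where 'a='a] by (simp add: n_def Suc_le_eq)
  obtain C where C: "0 < C"
    and C_const: "\<And>(x::'a) y L. 0 < L \<Longrightarrow> kernel_avg s x L y \<le> ennreal (C * L powr (- s))"
    and C_far: "\<And>(x::'a) y L. 0 < L \<Longrightarrow> L \<le> dist x y \<Longrightarrow>
        kernel_avg s x L y \<le> ennreal (dist x y powr (- s) * (1 + C * (L / dist x y)))"
    by (rule kernel_avg_le[OF less_imp_le[OF s(1)] s(2)]) (rule that, assumption+)
  define a where "a = 2 powr (- s)"
  have a: "0 < a" "a < 1" using s by (auto simp: a_def powr_less_one)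
  \<comment> \<open>A common ratio for both error series: a governs the cubes larger than the
    distance, and 2 / 3 suffices for the smaller ones, because q \<ge> 3 / 4 then gives 1 / 2 \<le>
    q \<theta>.\<close>
  define \<theta> where "\<theta> = max (2 / 3) a"
  have \<theta>: "0 < \<theta>" "\<theta> < 1" "a \<le> \<theta>" "2 / 3 \<le> \<theta>" using a by (auto simp: \<theta>_def)
  define C2 where "C2 = C / a"
  have C2: "0 < C2" "C \<le> C2" using C a by (auto simp: C2_def field_simps mult_le_cancel_left1)
  define C3 where "C3 = C2 * (2 / (1 - \<theta>))"
  have C3: "0 < C3" using C2 \<theta> by (simp add: C3_def)
  \<comment> \<open>\<eta> = 1 - q controls how slowly the weights decay. The bound 1 / 4 gives q
    \<ge> 3 / 4; \<open>C3 * \<eta> \<le> 1 / 4\<close> keeps q - C3 \<eta> \<ge> 1 / 2 for poles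
    outside \<open>ball x r\<close>; \<open>C3 * \<eta> \<le> a / 2\<close> makes the mixture at
    most half of the small-cube average for poles inside.\<close>
  define \<eta> where "\<eta> = min (1 / 4) (min (1 / (4 * C3)) (a / (2 * C3)))"
  have \<eta>: "0 < \<eta>" "\<eta> \<le> 1 / 4" "C3 * \<eta> \<le> 1 / 4" "C3 * \<eta> \<le> a / 2"
  proof -
    show "0 < \<eta>" using C3 a by (simp add: \<eta>_def)
    show "\<eta> \<le> 1 / 4" by (simp add: \<eta>_def)
    have "C3 * \<eta> \<le> C3 * (1 / (4 * C3))" using C3 by (intro mult_left_mono) (auto simp: \<eta>_def)
    then show "C3 * \<eta> \<le> 1 / 4" using C3 by simp
    have "C3 * \<eta> \<le> C3 * (a / (2 * C3))" using C3 by (intro mult_left_mono) (auto simp: \<eta>_def)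
    then show "C3 * \<eta> \<le> a / 2" using C3 by simp
  qed
  define q where "q = 1 - \<eta>"
  have q: "3 / 4 \<le> q" "q < 1" using \<eta> by (auto simp: q_def)
  \<comment> \<open>n \<delta> \<le> 1 / 2 bounds the small-cube average below by (2r)^(-s) for
    poles in \<open>ball x r\<close>, and s n \<delta> \<le> 1 / 2 limits its loss against T^(-s)
    for the others.\<close>
  define \<delta> where "\<delta> = 1 / (2 * n * (s + 1))"
  have den: "1 \<le> n * (s + 1)" using n s mult_mono[of 1 n 1 "s + 1"] by simp
  have \<delta>: "0 < \<delta>" "\<delta> \<le> 1" "n * \<delta> \<le> 1 / 2" "s * (n * \<delta>) \<le> 1 / 2"
    using den n s by (auto simp: \<delta>_def field_simps)
  have dy: "(2 ^ k) powr (- s) = a ^ k" for k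
    by (simp add: a_def powr_power mult.commute flip: powr_realpow) (simp add: powr_powr mult.commute)
  show thesis
  proof
    show "0 < q" "q < 1" "0 < \<delta>" "\<delta> \<le> 1" "0 < a / 2" using q \<delta> a by auto
    fix x y :: 'a and r :: real assume r: "0 < r"
    define T where "T = dist x y"
    define W where "W = (\<Sum>j. ennreal ((1 - q) * q ^ j) * kernel_avg s x (2 ^ j * r) y)"
    have term_const: "ennreal ((1 - q) * q ^ j) * kernel_avg s x (2 ^ j * r) y \<le>
        ennreal (\<eta> * q ^ j * (C * (2 ^ j * r) powr (- s)))" for j
    proof -
      have "ennreal ((1 - q) * q ^ j) * kernel_avg s x (2 ^ j * r) y \<le>
          ennreal ((1 - q) * q ^ j) * ennreal (C * (2 ^ j * r) powr (- s))"
        using r by (intro mult_left_mono C_const) auto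
      then show ?thesis using \<eta> q by (simp add: q_def flip: ennreal_mult')
    qed
    show "ennreal (a / 2 * r powr (- s)) * indicator (ball x r) y + W \<le> kernel_avg s x (\<delta> * r) y"
    proof (cases "T < r")
      case True
      have "W \<le> (\<Sum>j. ennreal (\<eta> * C * r powr (- s) * \<theta> ^ j))"
        unfolding W_def
      proof (intro suminf_le order_trans[OF term_const] ennreal_leI)
        fix j
        have "\<eta> * q ^ j * (C * (2 ^ j * r) powr (- s)) = \<eta> * C * r powr (- s) * (q ^ j * a ^ j)"
          by (simp add: powr_mult dy mult_ac)
        also have "\<dots> \<le> \<eta> * C * r powr (- s) * (1 * \<theta> ^ j)"
          using \<eta> C q a \<theta> by (intro mult_left_mono mult_mono power_mono power_le_one) auto
        finally show "\<eta> * q ^ j * (C * (2 ^ j * r) powr (- s)) \<le> \<eta> * C * r powr (- s) * \<theta> ^ j" by simp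
      qed auto
      also have "\<dots> = ennreal (\<eta> * C * r powr (- s) * (1 / (1 - \<theta>)))"
        using \<eta> C \<theta> by (intro suminf_ennreal_eq sums_mult geometric_sums) auto
      also have "\<dots> \<le> ennreal (a / 2 * r powr (- s))"
      proof (rule ennreal_leI)
        have "C * (1 / (1 - \<theta>)) \<le> C3"
          unfolding C3_def using C2 \<theta> C by (intro mult_mono) (auto simp: divide_right_mono)
        then have "\<eta> * (C * (1 / (1 - \<theta>))) \<le> \<eta> * C3" using \<eta> by (intro mult_left_mono) auto
        also have "\<dots> \<le> a / 2" using \<eta>(4) by (simp add: mult.commute)
        finally have "\<eta> * (C * (1 / (1 - \<theta>))) * r powr (- s) \<le> a / 2 * r powr (- s)" by (rule mult_right_mono) simp
        then show "\<eta> * C * r powr (- s) * (1 / (1 - \<theta>)) \<le> a / 2 * r powr (- s)" by (simp add: mult_ac)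
      qed
      finally have "ennreal (a / 2 * r powr (- s)) * indicator (ball x r) y + W \<le>
          ennreal (a / 2 * r powr (- s)) + ennreal (a / 2 * r powr (- s))"
        by (intro add_mono) (auto split: split_indicator)
      also have "\<dots> = ennreal ((2 * r) powr (- s))"
        using a r by (simp add: powr_mult a_def flip: ennreal_plus)
      also have "\<dots> \<le> ennreal ((T + n * (\<delta> * r)) powr (- s))"
      proof (intro ennreal_leI powr_minus_mono)
        have "n * (\<delta> * r) = n * \<delta> * r" by simp
        also have "\<dots> \<le> 1 / 2 * r" using \<delta> r by (intro mult_right_mono) auto
        finally show "T + n * (\<delta> * r) \<le> 2 * r" using True r by linarith
        show "0 < T + n * (\<delta> * r)" using n \<delta> r by (simp add: T_def add_nonneg_pos)
      qed (use s in auto)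
      also have "\<dots> \<le> kernel_avg s x (\<delta> * r) y"
        using kernel_avg_ge[of "\<delta> * r" s x y] \<delta> r s by (simp add: T_def n_def)
      finally show ?thesis .
    next
      case False
      then have T: "r \<le> T" "0 < T" using r by auto
      then have "1 \<le> T / r" using r by simp
      then obtain J where "2 ^ J \<le> T / r" "T / r < 2 ^ Suc J" by (rule ex_two_power)
      then have J: "2 ^ J * r \<le> T" "T < 2 ^ Suc J * r" using r by (auto simp: field_simps)
      \<comment> \<open>\<open>\<phi>\<close> carries the main part, the weights of the cubes of
        side at most T. \<open>\<psi>\<close> is the profile of the errors, which decay
        geometrically on both sides of the scale 2^J r of the pole.\<close>
      define \<psi> where "\<psi> j = (if j \<le> J then \<theta> ^ (J - j) else \<theta> ^ (j - J))" for j
      define \<phi> where "\<phi> j = (if j \<le> J then \<eta> * q ^ j else 0)" for j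
      have "W \<le> (\<Sum>j. ennreal (T powr (- s)) * (ennreal (\<phi> j) + ennreal (C2 * \<eta> * q ^ J) * ennreal (\<psi> j)))"
        unfolding W_def
      proof (intro suminf_le)
        fix j
        have "ennreal ((1 - q) * q ^ j) * kernel_avg s x (2 ^ j * r) y \<le>
            ennreal (T powr (- s) * (\<phi> j + C2 * \<eta> * q ^ J * \<psi> j))"
        proof (cases "j \<le> J")
          case True
          have "2 ^ j * r \<le> 2 ^ J * r" using True r by (intro mult_right_mono power_increasing) auto
          then have jT: "2 ^ j * r \<le> T" using J by linarith
          have "ennreal ((1 - q) * q ^ j) * kernel_avg s x (2 ^ j * r) y \<le>
              ennreal ((1 - q) * q ^ j) * ennreal (T powr (- s) * (1 + C * (2 ^ j * r / T)))"
            unfolding T_def using r jT by (intro mult_left_mono C_far) (auto simp: T_def)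
          also have "\<dots> = ennreal (T powr (- s) * (\<eta> * q ^ j + C * \<eta> * (q ^ j * (2 ^ j * r / T))))"
            using q \<eta> by (simp add: q_def algebra_simps flip: ennreal_mult')
          also have "\<dots> \<le> ennreal (T powr (- s) * (\<phi> j + C2 * \<eta> * q ^ J * \<psi> j))"
          proof (intro ennreal_leI mult_left_mono add_mono)
            have "2 ^ j * r / T \<le> (1 / 2) ^ (J - j)"
            proof -
              have "2 ^ j * r * 2 ^ (J - j) = 2 ^ J * r"
                using True by (simp add: mult_ac flip: power_add)
              then have "2 ^ j * r * 2 ^ (J - j) \<le> T" using J(1) by linarith
              then show ?thesis using T by (simp add: power_one_over field_simps)
            qed
            then have "q ^ j * (2 ^ j * r / T) \<le> q ^ j * (1 / 2) ^ (J - j)"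
              using q by (intro mult_left_mono) auto
            \<comment> \<open>The factors q complete q^j to q^J: every error is measured by the
              weight at the scale of the pole, and the powers of \<theta> remain for
              summation.\<close>
            also have "\<dots> \<le> q ^ j * (q * \<theta>) ^ (J - j)"
            proof (intro mult_left_mono power_mono)
              have "1 / 2 = 3 / 4 * (2 / 3 :: real)" by simp
              also have "\<dots> \<le> q * \<theta>" using q \<theta> by (intro mult_mono) auto
              finally show "1 / 2 \<le> q * \<theta>" .
            qed (use q in auto)
            also have "\<dots> = q ^ J * \<psi> j"
              using True by (simp add: \<psi>_def power_mult_distrib mult.assoc[symmetric] flip: power_add)
            finally have le: "q ^ j * (2 ^ j * r / T) \<le> q ^ J * \<psi> j" .
            have "C * \<eta> \<le> C2 * \<eta>" using C2 \<eta> by (intro mult_right_mono) auto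
            then have "C * \<eta> * (q ^ j * (2 ^ j * r / T)) \<le> C2 * \<eta> * (q ^ J * \<psi> j)"
              by (rule mult_mono[OF _ le]) (use C2 \<eta> q r T in auto)
            then show "C * \<eta> * (q ^ j * (2 ^ j * r / T)) \<le> C2 * \<eta> * q ^ J * \<psi> j" by (simp add: mult_ac)
          qed (use True in \<open>auto simp: \<phi>_def\<close>)
          finally show ?thesis .
        next
          case False
          note term_const[of j]
          also have "\<eta> * q ^ j * (C * (2 ^ j * r) powr (- s)) \<le> T powr (- s) * (\<phi> j + C2 * \<eta> * q ^ J * \<psi> j)"
          proof -
            have "T * 2 ^ (j - J) \<le> 2 ^ Suc J * r * 2 ^ (j - J)" using J by (intro mult_right_mono) auto
            also have "\<dots> = 2 * (2 ^ j * r)"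
              using False by (simp add: mult_ac flip: power_add)
            finally have "T / 2 * 2 ^ (j - J) \<le> 2 ^ j * r" by simp
            then have "(2 ^ j * r) powr (- s) \<le> (T / 2 * 2 ^ (j - J)) powr (- s)"
              using T s by (intro powr_minus_mono) auto
            also have "\<dots> = T powr (- s) / a * a ^ (j - J)"
              by (simp only: powr_mult powr_divide dy a_def)
            also have "\<dots> \<le> T powr (- s) / a * \<theta> ^ (j - J)"
              using a \<theta> by (intro mult_left_mono power_mono) auto
            finally have 1: "(2 ^ j * r) powr (- s) \<le> T powr (- s) / a * \<psi> j" using False by (simp add: \<psi>_def)
            have "q ^ j \<le> q ^ J" using False q by (intro power_decreasing) auto
            then have "\<eta> * q ^ j * (C * (2 ^ j * r) powr (- s)) \<le> \<eta> * q ^ J * (C * (T powr (- s) / a * \<psi> j))"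
              using 1 \<eta> q C by (intro mult_mono mult_left_mono) auto
            also have "\<dots> = T powr (- s) * (\<phi> j + C2 * \<eta> * q ^ J * \<psi> j)"
              using False by (simp add: \<phi>_def C2_def)
            finally show ?thesis .
          qed
          finally show ?thesis by (simp add: ennreal_leI)
        qed
        also have "\<dots> = ennreal (T powr (- s)) * (ennreal (\<phi> j) + ennreal (C2 * \<eta> * q ^ J) * ennreal (\<psi> j))"
        proof -
          have "0 \<le> \<phi> j" "0 \<le> \<psi> j" "0 \<le> C2 * \<eta> * q ^ J" using \<eta> q \<theta> C2 by (auto simp: \<phi>_def \<psi>_def)
          then show ?thesis by (simp flip: ennreal_mult' ennreal_plus)
        qed
        finally show "ennreal ((1 - q) * q ^ j) * kernel_avg s x (2 ^ j * r) y \<le> \<dots>" .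
      qed auto
      also have "\<dots> = ennreal (T powr (- s)) * ((\<Sum>j. ennreal (\<phi> j)) + ennreal (C2 * \<eta> * q ^ J) * (\<Sum>j. ennreal (\<psi> j)))"
        by (simp add: suminf_add[symmetric])
      also have "\<dots> \<le> ennreal (T powr (- s)) * (ennreal (1 - q ^ Suc J) + ennreal (C2 * \<eta> * q ^ J) * ennreal (2 / (1 - \<theta>)))"
      proof (intro mult_left_mono add_mono)
        show "(\<Sum>j. ennreal (\<psi> j)) \<le> ennreal (2 / (1 - \<theta>))"
          unfolding \<psi>_def using \<theta> by (intro suminf_two_sided_geometric) auto
        have "(\<Sum>j. ennreal (\<phi> j)) = (\<Sum>j<Suc J. ennreal (\<phi> j))"
          by (rule suminf_finite) (auto simp: \<phi>_def)
        also have "\<dots> = ennreal (\<Sum>j<Suc J. \<phi> j)"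
          using \<eta> q by (intro sum_ennreal) (auto simp: \<phi>_def)
        also have "(\<Sum>j<Suc J. \<phi> j) = (\<Sum>j<Suc J. \<eta> * q ^ j)"
          by (rule sum.cong) (auto simp: \<phi>_def)
        also have "\<dots> = 1 - q ^ Suc J"
          using q one_diff_power_eq[of q "Suc J"] by (simp only: sum_distrib_left[symmetric]) (simp add: q_def)
        finally show "(\<Sum>j. ennreal (\<phi> j)) \<le> ennreal (1 - q ^ Suc J)" by simp
      qed auto
      also have "\<dots> = ennreal (T powr (- s) * (1 - q ^ Suc J + C2 * \<eta> * q ^ J * (2 / (1 - \<theta>))))"
      proof -
        have "q ^ Suc J \<le> 1" using q by (intro power_le_one) auto
        then show ?thesis using C2 \<eta> q \<theta> by (simp flip: ennreal_mult' ennreal_plus)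
      qed
      also have "\<dots> \<le> ennreal ((T + n * (\<delta> * r)) powr (- s))"
      proof (rule ennreal_leI)
        have "1 - q ^ Suc J + C2 * \<eta> * q ^ J * (2 / (1 - \<theta>)) = 1 - q ^ J * (q - C3 * \<eta>)"
          by (simp add: C3_def algebra_simps)
        also have "\<dots> \<le> 1 - q ^ J * (1 / 2)"
          using q \<eta> by (intro diff_left_mono mult_left_mono) auto
        \<comment> \<open>The slow decay is used here: the loss of the small-cube average is at most
          half of r / T \<le> 2^(-J) \<le> q^J, no more than the gap q^J / 2 that the mixture
          leaves.\<close>
        also have "\<dots> \<le> 1 - s * (n * (\<delta> * r) / T)"
        proof -
          have "r / T \<le> (1 / 2) ^ J" using J T by (simp add: power_one_over field_simps)
          also have "\<dots> \<le> q ^ J" using q by (intro power_mono) auto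
          finally have "s * (n * \<delta>) * (r / T) \<le> 1 / 2 * q ^ J"
            using \<delta> r T by (intro mult_mono) auto
          then show ?thesis by (simp add: mult_ac)
        qed
        also have "\<dots> \<le> (1 + n * (\<delta> * r) / T) powr (- s)"
          using s n \<delta> r T by (intro one_plus_powr_ge) auto
        finally have "T powr (- s) * (1 - q ^ Suc J + C2 * \<eta> * q ^ J * (2 / (1 - \<theta>))) \<le>
            T powr (- s) * (1 + n * (\<delta> * r) / T) powr (- s)" by (rule mult_left_mono) simp
        also have "\<dots> = (T * (1 + n * (\<delta> * r) / T)) powr (- s)" by (rule powr_mult[symmetric])
        also have "T * (1 + n * (\<delta> * r) / T) = T + n * (\<delta> * r)" using T by (simp add: field_simps)
        finally show "T powr (- s) * (1 - q ^ Suc J + C2 * \<eta> * q ^ J * (2 / (1 - \<theta>))) \<le> (T + n * (\<delta> * r)) powr (- s)" .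
      qed
      also have "\<dots> \<le> kernel_avg s x (\<delta> * r) y"
        using kernel_avg_ge[of "\<delta> * r" s x y] \<delta> r s by (simp add: T_def n_def)
      finally show ?thesis using False by (simp add: T_def)
    qed
  qed
qed


text \<open>Both averages are compared with one constant, nearly optimal for the larger cube;
  restricting its deviation to the smaller cube costs the ratio of the volumes. The additive form
  makes sense in [0,\<infinity>] before any average is known to be finite.\<close>

lemma bmo_cube_average_le:
  fixes p :: "'a::euclidean_space \<Rightarrow> ennreal" and x :: 'a and L' L B :: real
  assumes [measurable]: "p \<in> borel_measurable borel"
    and bmo: "bmo_norm (\<lambda>z. enn2ereal (p z)) < ennreal B" and L: "0 < L'" "L' \<le> L"
  defines "m \<equiv> \<lambda>L. ennreal (L powr (- real DIM('a))) * (\<integral>\<^sup>+ z\<in>centred_cube x L. p z \<partial>lborel)"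
  shows "m L' \<le> m L + ennreal (B * (1 + (L / L') powr DIM('a)))"
proof -
  define n where "n = real DIM('a)"
  define u where "u = (\<lambda>z. enn2ereal (p z))"
  have [measurable]: "u \<in> borel_measurable borel" by (simp add: u_def)
  have dm[measurable]: "dev u c \<in> borel_measurable borel" for c by (simp add: dev_def[abs_def])
  have L0: "0 < L" using L by simp
  have "0 < B" using bmo by (metis ennreal_less_zero_iff order_le_less_trans zero_le)
  define D where "D c L = (\<integral>\<^sup>+ z\<in>centred_cube x L. dev u c z \<partial>lborel)" for c L
  have "(INF c. (\<integral>\<^sup>+ z\<in>centred_cube x L. dev u c z \<partial>lebesgue) / ennreal (L ^ DIM('a))) \<le> bmo_norm u"
    unfolding bmo_norm_def centred_cube_def using L0
    by (intro SUP_upper2[of "x - (L / 2) *\<^sub>R One"] SUP_upper2[of L]) auto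
  also have "\<dots> < ennreal B" using bmo by (simp add: u_def)
  finally obtain c0 where "D c0 L / ennreal (L ^ DIM('a)) < ennreal B"
    by (auto simp: INF_less_iff nn_integral_completion D_def)
  then have "D c0 L / ennreal (L powr n) \<le> ennreal B"
    using L0 by (simp add: n_def powr_realpow less_imp_le)
  then have c0: "D c0 L \<le> ennreal B * ennreal (L powr n)"
    using L0 by (subst (asm) divide_ennreal_le_iff) auto
  \<comment> \<open>The potential is nonnegative, so replacing a negative constant by 0 does not
    increase the deviation, and c can be used inside \<open>ennreal\<close>.\<close>
  define c where "c = max c0 0"
  have dev_c: "dev u c z \<le> dev u c0 z" for z
    by (cases "p z") (auto simp: dev_def u_def c_def enn2ereal_ennreal max_def intro!: ennreal_leI)
  have DL: "D c L \<le> ennreal B * ennreal (L powr n)"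
    using c0 unfolding D_def by (rule order_trans[rotated]) (auto intro!: nn_integral_mono mult_right_mono dev_c)
  have DL': "D c L' \<le> ennreal B * ennreal (L powr n)"
  proof (rule order_trans[OF _ DL])
    show "D c L' \<le> D c L"
      using centred_cube_mono[OF L(2), of x] unfolding D_def
      by (intro nn_integral_mono) (auto split: split_indicator)
  qed
  have p_le: "p z \<le> ennreal c + dev u c z" "ennreal c \<le> p z + dev u c z" for z
  proof -
    have "p z \<le> ennreal c + dev u c z \<and> ennreal c \<le> p z + dev u c z"
    proof (cases "p z")
      case (real r)
      then have "dev u c z = ennreal \<bar>r - c\<bar>" by (simp add: dev_def u_def enn2ereal_ennreal)
      moreover have "ennreal r \<le> ennreal (c + \<bar>r - c\<bar>)" "ennreal c \<le> ennreal (r + \<bar>r - c\<bar>)"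
        by (intro ennreal_leI; linarith)+
      ultimately show ?thesis using real by (simp add: c_def)
    qed (simp add: dev_def u_def)
    then show "p z \<le> ennreal c + dev u c z" "ennreal c \<le> p z + dev u c z" by auto
  qed
  have avg_const: "ennreal (L powr (- n)) * (\<integral>\<^sup>+ z\<in>centred_cube x L. ennreal c \<partial>lborel) = ennreal c" if "0 < L" for L
    using that by (simp add: nn_integral_cmult_indicator emeasure_centred_cube n_def[symmetric] ennreal_powr_mult_minus)
  have "m L' \<le> ennreal (L' powr (- n)) * (\<integral>\<^sup>+ z. ennreal c * indicator (centred_cube x L') z + dev u c z * indicator (centred_cube x L') z \<partial>lborel)"
    unfolding m_def n_def
    by (intro mult_left_mono nn_integral_mono) (auto split: split_indicator intro: p_le)
  also have "\<dots> = ennreal c + ennreal (L' powr (- n)) * D c L'"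
    using L by (simp add: nn_integral_add distrib_left avg_const D_def)
  also have "\<dots> \<le> ennreal c + ennreal (L' powr (- n)) * (ennreal B * ennreal (L powr n))"
    by (intro add_left_mono mult_left_mono DL') auto
  also have "\<dots> = ennreal c + ennreal (B * (L / L') powr n)"
    using \<open>0 < B\<close> L by (simp add: powr_divide powr_minus field_simps flip: ennreal_mult')
  also have "ennreal c \<le> m L + ennreal B"
  proof -
    have "ennreal c = ennreal (L powr (- n)) * (\<integral>\<^sup>+ z\<in>centred_cube x L. ennreal c \<partial>lborel)"
      by (simp add: avg_const L0)
    also have "\<dots> \<le> ennreal (L powr (- n)) * (\<integral>\<^sup>+ z. p z * indicator (centred_cube x L) z + dev u c z * indicator (centred_cube x L) z \<partial>lborel)"
      by (intro mult_left_mono nn_integral_mono) (auto split: split_indicator intro: p_le)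
    also have "\<dots> = m L + ennreal (L powr (- n)) * D c L"
      by (simp add: nn_integral_add distrib_left D_def m_def n_def)
    also have "\<dots> \<le> m L + ennreal (L powr (- n)) * (ennreal B * ennreal (L powr n))"
      by (intro add_left_mono mult_left_mono DL) auto
    finally show ?thesis by (simp add: ennreal_powr_mult_minus L0)
  qed
  finally have "m L' \<le> m L + ennreal B + ennreal (B * (L / L') powr n)" by (simp add: add_right_mono)
  also have "\<dots> = m L + ennreal (B * (1 + (L / L') powr n))"
    using \<open>0 < B\<close> by (simp add: add.assoc algebra_simps flip: ennreal_plus)
  finally show ?thesis by (simp add: n_def)
qed

text \<open>Fubini's theorem moves the averaging from the potential to the kernel, so pointwise
  inequalities for \<open>kernel_avg\<close> in y integrate to inequalities between averages of the
  potential.\<close>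

lemma cube_average_pot:
  fixes \<mu> :: "'a::euclidean_space measure" and s :: real
  assumes \<mu>[measurable_cong]: "sets \<mu> = sets borel" and "sigma_finite_measure \<mu>"
  shows "ennreal (L powr (- real DIM('a))) * (\<integral>\<^sup>+ z\<in>centred_cube x L. trunc_pot s 0 \<mu> z \<partial>lborel) =
    (\<integral>\<^sup>+ y. kernel_avg s x L y \<partial>\<mu>)"
proof -
  interpret sigma_finite_measure \<mu> by fact
  interpret pair_sigma_finite lborel \<mu> ..
  have "(\<integral>\<^sup>+ z\<in>centred_cube x L. trunc_pot s 0 \<mu> z \<partial>lborel) =
      (\<integral>\<^sup>+ z. (\<integral>\<^sup>+ y. ennreal (norm (z - y) powr (- s)) * indicator (centred_cube x L) z \<partial>\<mu>) \<partial>lborel)"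
    unfolding trunc_pot_def by (intro nn_integral_cong) (simp add: nn_integral_multc)
  also have "\<dots> = (\<integral>\<^sup>+ y. (\<integral>\<^sup>+ z\<in>centred_cube x L. ennreal (norm (z - y) powr (- s)) \<partial>lborel) \<partial>\<mu>)"
    by (rule Fubini'[symmetric]) measurable
  finally show ?thesis
    unfolding kernel_avg_def by (simp add: nn_integral_cmult)
qed

lemma measurable_pot:
  fixes \<mu> :: "'a::euclidean_space measure"
  assumes \<mu>[measurable_cong]: "sets \<mu> = sets borel" and "sigma_finite_measure \<mu>"
  shows "trunc_pot s 0 \<mu> \<in> borel_measurable borel"
proof -
  interpret sigma_finite_measure \<mu> by fact
  show ?thesis unfolding trunc_pot_def[abs_def] by measurable
qed

lemma measurable_kernel_avg [measurable]:
  "kernel_avg s (x :: 'a::euclidean_space) L \<in> borel_measurable borel"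
proof -
  have "(\<lambda>y. \<integral>\<^sup>+ z\<in>centred_cube x L. ennreal (norm (z - y) powr (- s)) \<partial>lborel) \<in> borel_measurable borel"
    by measurable
  then show ?thesis unfolding kernel_avg_def[abs_def] by measurable
qed

text \<open>Integrated against \<mu>, the mixture inequality gives X + S \<le> m (\<delta> r), with
  X a multiple of r^(-s) \<mu>(B(x, r)) and S the mixture of dyadic averages. Comparison from scale
  to scale gives m (\<delta> r) \<le> S + K, since the drift is linear in j and is summed by the
  geometric weights. Cancelling S leaves X \<le> K.\<close>

lemma growth_of_BMO:
  fixes \<mu> :: "'a::euclidean_space measure" and s :: real
  assumes \<mu>[measurable_cong]: "sets \<mu> = sets borel" and sf: "sigma_finite_measure \<mu>"
    and s: "0 < s" "s < DIM('a)" and u: "(\<lambda>x. enn2ereal (trunc_pot s 0 \<mu> x)) \<in> BMO"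
  obtains M where "0 < M" "\<And>x r. 0 < r \<Longrightarrow> emeasure \<mu> (ball x r) \<le> ennreal (M * r powr s)"
proof -
  define n where "n = real DIM('a)"
  define p where "p = trunc_pot s 0 \<mu>"
  have [measurable]: "p \<in> borel_measurable borel" unfolding p_def by (rule measurable_pot[OF \<mu> sf])
  have [measurable]: "ball z r \<in> sets \<mu>" for z r using \<mu> by simp
  have meas: "kernel_avg s x L \<in> borel_measurable \<mu>" for x L by measurable
  obtain B where bmo: "bmo_norm (\<lambda>z. enn2ereal (p z)) < ennreal B" "0 < B"
  proof (cases "bmo_norm (\<lambda>z. enn2ereal (p z))")
    case (real b)
    then show thesis by (intro that[of "b + 1"]) (auto simp: ennreal_less_iff)
  qed (use u in \<open>simp add: BMO_def p_def\<close>)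
  obtain q \<delta> c :: real where q: "0 < q" "q < 1" and \<delta>: "0 < \<delta>" "\<delta> \<le> 1" and c: "0 < c"
    and mix: "\<And>(x::'a) y r. 0 < r \<Longrightarrow> ennreal (c * r powr (- s)) * indicator (ball x r) y +
        (\<Sum>j. ennreal ((1 - q) * q ^ j) * kernel_avg s x (2 ^ j * r) y) \<le> kernel_avg s x (\<delta> * r) y"
    by (rule kernel_avg_mixture[OF s]) (rule that, assumption+)
  define E1 where "E1 = B * (1 + (1 / \<delta>) powr n)"
  define E2 where "E2 = B * (1 + 2 powr n)"
  have E: "0 < E1" "0 < E2" using bmo by (auto simp: E1_def E2_def add_pos_nonneg)
  define K where "K = E1 + E2 / (1 - q)"
  have K: "0 < K" using E q by (simp add: K_def add_pos_pos)
  show thesis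
  proof
    show "0 < K / c" using K c by simp
    fix x :: 'a and r :: real assume r: "0 < r"
    define m where "m L = ennreal (L powr (- n)) * (\<integral>\<^sup>+ z\<in>centred_cube x L. p z \<partial>lborel)" for L
    have m_eq: "m L = (\<integral>\<^sup>+ y. kernel_avg s x L y \<partial>\<mu>)" for L
      unfolding m_def p_def n_def by (rule cube_average_pot[OF \<mu> sf])
    have step: "m L' \<le> m L + ennreal (B * (1 + (L / L') powr n))" if "0 < L'" "L' \<le> L" for L L'
      unfolding m_def n_def by (rule bmo_cube_average_le[OF _ bmo(1) that]) measurable
    have chain: "m (\<delta> * r) \<le> m (2 ^ j * r) + ennreal (E1 + j * E2)" for j
    proof (induction j)
      case 0
      have "\<delta> * r \<le> r" using \<delta> r by (simp add: mult_le_cancel_right1)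
      then show ?case using step[of "\<delta> * r" r] \<delta> r by (simp add: E1_def)
    next
      case (Suc j)
      have "m (2 ^ j * r) \<le> m (2 ^ Suc j * r) + ennreal E2"
        using step[of "2 ^ j * r" "2 ^ Suc j * r"] r by (simp add: E2_def)
      then have "m (\<delta> * r) \<le> (m (2 ^ Suc j * r) + ennreal E2) + ennreal (E1 + j * E2)"
        using Suc.IH by (meson add_right_mono order_trans)
      also have "\<dots> = m (2 ^ Suc j * r) + ennreal (E2 + (E1 + j * E2))"
        using E by (simp add: add.assoc)
      finally show ?case by (simp add: algebra_simps)
    qed
    define w where "w j = (1 - q) * q ^ j" for j
    have w: "0 \<le> w j" for j using q by (simp add: w_def)
    define X where "X = ennreal (c * r powr (- s)) * emeasure \<mu> (ball x r)"
    define S where "S = (\<Sum>j. ennreal (w j) * m (2 ^ j * r))"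
    have sum_w: "(\<Sum>j. ennreal (w j)) = 1"
    proof -
      have "(\<lambda>j. (1 - q) * q ^ j) sums ((1 - q) * (1 / (1 - q)))"
        using q by (intro sums_mult geometric_sums) auto
      then have "w sums 1" using q by (simp add: w_def[abs_def])
      then show ?thesis using w by (subst suminf_ennreal_eq) auto
    qed
    \<comment> \<open>The drift E1 + j E2 is enlarged to E1 + (j + 1) E2 so that its sum is read off
      from the derivative of the geometric series.\<close>
    have sum_e: "(\<Sum>j. ennreal (w j * (E1 + Suc j * E2))) = ennreal K"
    proof (rule suminf_ennreal_eq)
      have "(\<lambda>j. (1 - q) * E1 * q ^ j + (1 - q) * E2 * (of_nat (Suc j) * q ^ j)) sums
          ((1 - q) * E1 * (1 / (1 - q)) + (1 - q) * E2 * (1 / (1 - q)\<^sup>2))"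
        using q by (intro sums_add sums_mult geometric_sums geometric_deriv_sums) auto
      also have "(1 - q) * E1 * (1 / (1 - q)) + (1 - q) * E2 * (1 / (1 - q)\<^sup>2) = K"
        using q by (simp add: K_def power2_eq_square)
      finally show "(\<lambda>j. w j * (E1 + Suc j * E2)) sums K"
        by (simp add: w_def algebra_simps)
    qed (use w E in auto)
    have "m (\<delta> * r) = (\<Sum>j. ennreal (w j) * m (\<delta> * r))"
      by (simp add: sum_w)
    also have "\<dots> \<le> (\<Sum>j. ennreal (w j) * m (2 ^ j * r) + ennreal (w j * (E1 + Suc j * E2)))"
    proof (intro suminf_le)
      fix j
      have "ennreal (w j) * m (\<delta> * r) \<le> ennreal (w j) * (m (2 ^ j * r) + ennreal (E1 + j * E2))"
        by (intro mult_left_mono chain) auto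
      also have "\<dots> = ennreal (w j) * m (2 ^ j * r) + ennreal (w j * (E1 + j * E2))"
        by (subst ennreal_mult'[OF w]) (rule distrib_left)
      also have "\<dots> \<le> ennreal (w j) * m (2 ^ j * r) + ennreal (w j * (E1 + Suc j * E2))"
        using w E by (intro add_left_mono ennreal_leI mult_left_mono) auto
      finally show "ennreal (w j) * m (\<delta> * r) \<le> \<dots>" .
    qed auto
    also have "\<dots> = S + ennreal K"
      unfolding S_def sum_e[symmetric] by (rule suminf_add[symmetric]) auto
    finally have upper: "m (\<delta> * r) \<le> S + ennreal K" .
    have "X + S = (\<integral>\<^sup>+ y. ennreal (c * r powr (- s)) * indicator (ball x r) y +
        (\<Sum>j. ennreal (w j) * kernel_avg s x (2 ^ j * r) y) \<partial>\<mu>)"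
      unfolding X_def S_def m_eq
      by (subst nn_integral_add) (auto simp: nn_integral_cmult_indicator nn_integral_suminf nn_integral_cmult meas)
    also have "\<dots> \<le> m (\<delta> * r)"
      unfolding m_eq w_def by (intro nn_integral_mono mix r)
    finally have lower: "X + S \<le> m (\<delta> * r)" .
    \<comment> \<open>Local integrability of the potential enters here: it makes this average
      finite, hence also S, which permits the cancellation.\<close>
    have "m (\<delta> * r) < \<infinity>"
    proof -
      obtain a b where ab: "centred_cube x (\<delta> * r) \<subseteq> cbox a b"
        unfolding centred_cube_def cube_def using box_subset_cbox by blast
      have "(\<integral>\<^sup>+ z\<in>centred_cube x (\<delta> * r). p z \<partial>lborel) \<le> (\<integral>\<^sup>+ z\<in>cbox a b. e2ennreal \<bar>enn2ereal (p z)\<bar> \<partial>lebesgue)"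
        unfolding nn_integral_completion using ab by (intro nn_integral_mono) (auto split: split_indicator)
      also have "\<dots> < \<infinity>"
        using u unfolding BMO_def L1loc_lebesgue_def p_def by auto
      finally show ?thesis by (simp add: m_def ennreal_mult_less_top)
    qed
    moreover have "S \<le> X + S" by simp
    ultimately have "S < \<infinity>" using lower by order
    moreover have "S + X \<le> S + ennreal K" 
      using order_trans[OF lower upper] by (subst add.commute)
    ultimately have X: "X \<le> ennreal K" by (auto simp: ennreal_add_left_cancel_le)
    have "emeasure \<mu> (ball x r) \<le> ennreal K / ennreal (c * r powr (- s))"
      using c r X by (intro le_divide_ennreal) (auto simp: X_def)
    also have "\<dots> = ennreal (K / c * r powr s)"
      using c r K by (subst divide_ennreal) (auto simp: powr_minus field_simps)
    finally show "emeasure \<mu> (ball x r) \<le> ennreal (K / c * r powr s)" .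
  qed
qed

subsection \<open>Riesz potentials as potentials of measures\<close>

lemma riesz_const_pos: "0 < \<alpha> \<Longrightarrow> \<alpha> < real n \<Longrightarrow> 0 < riesz_const n \<alpha>"
  by (simp add: riesz_const_def Gamma_real_pos)

text \<open>A Lebesgue measurable density is replaced by a Borel one, so that Fubini's theorem applies.\<close>

lemma riesz_potential_measure:
  fixes f :: "'a::euclidean_space \<Rightarrow> real" and \<alpha> :: real
  assumes \<alpha>: "0 < \<alpha>" "\<alpha> < DIM('a)" and f: "f \<in> borel_measurable lebesgue" "\<And>x. 0 \<le> f x"
  obtains \<mu> :: "'a measure" where "sets \<mu> = sets borel" "sigma_finite_measure \<mu>" "\<And>x. emeasure \<mu> {x} = 0"
    "riesz_potential \<alpha> f = (\<lambda>x. enn2ereal (trunc_pot (DIM('a) - \<alpha>) 0 \<mu> x))"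
    "\<And>a l. emeasure \<mu> (cube a l) = ennreal (1 / riesz_const DIM('a) \<alpha>) * (\<integral>\<^sup>+ y\<in>cube a l. ennreal \<bar>f y\<bar> \<partial>lebesgue)"
proof -
  define \<kappa> where "\<kappa> = 1 / riesz_const DIM('a) \<alpha>"
  have \<kappa>: "0 < \<kappa>" using riesz_const_pos[OF \<alpha>] by (simp add: \<kappa>_def)
  obtain g where g[measurable]: "g \<in> borel_measurable lborel" and ae: "AE x in lborel. f x = g x"
    using completion_ex_borel_measurable_real[OF f(1)] by blast
  \<comment> \<open>The normalising constant goes into the density, so that the potential is
    \<open>trunc_pot\<close> of \<mu> without a prefactor. Where g is negative, on a null set,
    \<open>ennreal\<close> cuts the density off at 0.\<close>
  define \<mu> where "\<mu> = density lborel (\<lambda>y. ennreal (\<kappa> * g y))"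
  have [measurable]: "(\<lambda>y. ennreal (\<kappa> * g y)) \<in> borel_measurable lborel" by measurable
  show thesis
  proof
    show "sets \<mu> = sets borel" by (simp add: \<mu>_def)
    show "sigma_finite_measure \<mu>"
      unfolding \<mu>_def
      by (subst sigma_finite_measure.sigma_finite_iff_density_finite[OF sigma_finite_lborel]) auto
    show "emeasure \<mu> {x} = 0" for x
    proof -
      have "emeasure \<mu> {x} = (\<integral>\<^sup>+ y. ennreal (\<kappa> * g y) * indicator {x} y \<partial>lborel)"
        unfolding \<mu>_def by (rule emeasure_density) auto
      also have "\<dots> = (\<integral>\<^sup>+ (y::'a). 0 \<partial>lborel)"
      proof (rule nn_integral_cong_AE)
        show "AE y in lborel. ennreal (\<kappa> * g y) * indicator {x} y = 0"
          using AE_lborel_singleton[of x] by eventually_elim simp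
      qed
      finally show ?thesis by simp
    qed
    show "emeasure \<mu> (cube a l) = ennreal (1 / riesz_const DIM('a) \<alpha>) * (\<integral>\<^sup>+ y\<in>cube a l. ennreal \<bar>f y\<bar> \<partial>lebesgue)" for a l
    proof -
      have "(\<integral>\<^sup>+ y\<in>cube a l. ennreal \<bar>f y\<bar> \<partial>lebesgue) = (\<integral>\<^sup>+ y\<in>cube a l. ennreal (g y) \<partial>lborel)"
        unfolding nn_integral_completion using ae f(2)
        by (intro nn_integral_cong_AE) (auto elim!: eventually_mono)
      then have "ennreal \<kappa> * (\<integral>\<^sup>+ y\<in>cube a l. ennreal \<bar>f y\<bar> \<partial>lebesgue) =
          (\<integral>\<^sup>+ y. ennreal \<kappa> * (ennreal (g y) * indicator (cube a l) y) \<partial>lborel)"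
        by (simp add: nn_integral_cmult)
      also have "\<dots> = emeasure \<mu> (cube a l)"
        unfolding \<mu>_def using \<kappa> by (simp add: emeasure_density ennreal_mult' mult.assoc)
      finally show ?thesis by (simp add: \<kappa>_def)
    qed
    show "riesz_potential \<alpha> f = (\<lambda>x. enn2ereal (trunc_pot (DIM('a) - \<alpha>) 0 \<mu> x))"
    proof
      fix x :: 'a
      define k where "k y = ennreal (norm (x - y) powr (- (DIM('a) - \<alpha>)))" for y
      have [measurable]: "k \<in> borel_measurable borel" by (simp add: k_def[abs_def])
      have "(\<integral>\<^sup>+ y. ennreal (f y / norm (x - y) powr (real DIM('a) - \<alpha>)) \<partial>lebesgue) =
          (\<integral>\<^sup>+ y. ennreal (g y) * k y \<partial>lborel)"
        unfolding nn_integral_completion k_def using ae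
        by (intro nn_integral_cong_AE)
           (auto elim!: eventually_mono simp: powr_minus divide_inverse ennreal_mult'' simp del: minus_diff_eq)
      then have "ennreal \<kappa> * (\<integral>\<^sup>+ y. ennreal (f y / norm (x - y) powr (real DIM('a) - \<alpha>)) \<partial>lebesgue) =
          (\<integral>\<^sup>+ y. ennreal \<kappa> * (ennreal (g y) * k y) \<partial>lborel)"
        by (simp add: nn_integral_cmult)
      also have "\<dots> = trunc_pot (DIM('a) - \<alpha>) 0 \<mu> x"
      proof -
        have "trunc_pot (DIM('a) - \<alpha>) 0 \<mu> x = (\<integral>\<^sup>+ y. k y \<partial>\<mu>)"
          by (simp add: trunc_pot_def k_def)
        then show ?thesis
          unfolding \<mu>_def using \<kappa> by (simp add: nn_integral_density ennreal_mult' mult.assoc)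
      qed
      finally show "riesz_potential \<alpha> f x = enn2ereal (trunc_pot (DIM('a) - \<alpha>) 0 \<mu> x)"
        by (simp add: riesz_potential_def \<kappa>_def)
    qed
  qed
qed

text \<open>The Morrey condition is about cubes, the covering arguments are about balls. Each ball
  lies in a cube of side twice its radius and each cube in a ball of radius n times its side, which
  affects the constants only.\<close>

lemma morrey_iff_growth:
  fixes f :: "'a::euclidean_space \<Rightarrow> real" and \<mu> :: "'a measure" and \<alpha> \<kappa> :: real
  assumes \<kappa>: "0 < \<kappa>" and \<mu>: "sets \<mu> = sets borel" and f: "f \<in> borel_measurable lebesgue" and \<alpha>: "\<alpha> < DIM('a)"
    and eq: "\<And>a l. emeasure \<mu> (cube a l) = ennreal \<kappa> * (\<integral>\<^sup>+ y\<in>cube a l. ennreal \<bar>f y\<bar> \<partial>lebesgue)"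
  shows "f \<in> morrey \<alpha> \<longleftrightarrow>
    (\<exists>M>0. \<forall>x r. 0 < r \<longrightarrow> emeasure \<mu> (ball x r) \<le> ennreal (M * r powr (DIM('a) - \<alpha>)))" (is "_ = ?G")
proof
  define s where "s = DIM('a) - \<alpha>"
  have s: "0 < s" using \<alpha> by (simp add: s_def)
  define I where "I a l = (\<integral>\<^sup>+ y\<in>cube a l. ennreal \<bar>f y\<bar> \<partial>lebesgue)" for a l
  define N where "N = (SUP a. SUP l\<in>{0<..}. ennreal (l powr (- s)) * I a l)"
  have mor: "f \<in> morrey \<alpha> \<longleftrightarrow> N < \<infinity>" using f by (simp add: morrey_def N_def I_def s_def)
  {
    assume "f \<in> morrey \<alpha>"
    then obtain b where b: "N = ennreal b" "0 \<le> b" using mor by (cases N) auto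
    have I_le: "I a l \<le> ennreal (b * l powr s)" if l: "0 < l" for a l
    proof -
      have "ennreal (l powr (- s)) * I a l \<le> ennreal b"
        unfolding b(1)[symmetric] N_def using l by (intro SUP_upper2[of a] SUP_upper2[of l]) auto
      then have "I a l \<le> ennreal b / ennreal (l powr (- s))"
        using l by (intro le_divide_ennreal) auto
      also have "\<dots> = ennreal (b * l powr s)" using b l by (subst divide_ennreal) (auto simp: powr_minus divide_inverse)
      finally show ?thesis .
    qed
    \<comment> \<open>The summand 1 makes M positive even if f vanishes almost everywhere.\<close>
    define M where "M = \<kappa> * b * 2 powr s + 1"
    show ?G
    proof (intro exI[of _ M] conjI allI impI)
      show "0 < M" using \<kappa> b by (auto simp: M_def intro!: add_nonneg_pos)
      fix x :: 'a and r :: real assume r: "0 < r"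
      have "emeasure \<mu> (ball x r) \<le> emeasure \<mu> (cube (x - r *\<^sub>R One) (2 * r))"
        by (rule emeasure_mono[OF ball_subset_cube]) (simp add: \<mu>)
      also have "\<dots> \<le> ennreal \<kappa> * ennreal (b * (2 * r) powr s)"
        unfolding eq I_def[symmetric] using r by (intro mult_left_mono I_le) auto
      also have "\<dots> = ennreal (\<kappa> * b * 2 powr s * r powr s)"
        using \<kappa> by (simp add: powr_mult mult.assoc flip: ennreal_mult')
      also have "\<dots> \<le> ennreal (M * r powr s)"
        by (intro ennreal_leI mult_right_mono) (auto simp: M_def)
      finally show "emeasure \<mu> (ball x r) \<le> ennreal (M * r powr (DIM('a) - \<alpha>))" by (simp add: s_def)
    qed
  next
    assume ?G
    then obtain M where M: "0 < M" "\<And>x r. 0 < r \<Longrightarrow> emeasure \<mu> (ball x r) \<le> ennreal (M * r powr s)"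
      unfolding s_def by blast
    define n where "n = real DIM('a)"
    have n: "0 < n" by (simp add: n_def)
    have "ennreal (l powr (- s)) * I a l \<le> ennreal (M * n powr s / \<kappa>)" if l: "0 < l" for a l
    proof -
      have "ennreal \<kappa> * I a l \<le> emeasure \<mu> (ball (a + (l / 2) *\<^sub>R One) (n * l))"
        unfolding I_def eq[symmetric] n_def by (rule emeasure_mono[OF cube_subset_ball[OF l]]) (simp add: \<mu>)
      also have "\<dots> \<le> ennreal (M * (n * l) powr s)" using n l by (intro M) auto
      finally have "I a l \<le> ennreal (M * (n * l) powr s) / ennreal \<kappa>" by (intro le_divide_ennreal \<kappa>)
      also have "\<dots> = ennreal (M * n powr s / \<kappa>) * ennreal (l powr s)"
        using \<kappa> M by (simp add: divide_ennreal powr_mult mult_ac flip: ennreal_mult')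
      finally have "ennreal (l powr (- s)) * I a l \<le>
          ennreal (l powr (- s)) * (ennreal (M * n powr s / \<kappa>) * ennreal (l powr s))" by (rule mult_left_mono) simp
      then show ?thesis by (simp only: ennreal_powr_mult_minus[OF l])
    qed
    then have "N \<le> ennreal (M * n powr s / \<kappa>)" unfolding N_def by (intro SUP_least) auto
    then show "f \<in> morrey \<alpha>" unfolding mor by (simp add: order_le_less_trans)
  }
qed

text \<open>Excludes a potential that is identically infinite. One point of finiteness is enough,
  since \<open>trunc_pot_finite\<close> spreads it over all points for every truncation.\<close>

lemma L1loc_lebesgue_finite_point:
  fixes p :: "'a::euclidean_space \<Rightarrow> ennreal"
  assumes "(\<lambda>x. enn2ereal (p x)) \<in> L1loc_lebesgue"
  obtains x where "p x < \<infinity>"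
proof (rule ccontr)
  assume "\<not> thesis"
  then have p: "p x = \<infinity>" for x using that[of x] by (cases "p x") auto
  have "(\<integral>\<^sup>+ x\<in>cbox 0 One. e2ennreal \<bar>enn2ereal (p x)\<bar> \<partial>lebesgue) < \<infinity>"
    using assms unfolding L1loc_lebesgue_def by (auto simp: compact_cbox)
  moreover have "(\<integral>\<^sup>+ x\<in>cbox 0 (One::'a). e2ennreal \<bar>enn2ereal (p x)\<bar> \<partial>lebesgue) = \<infinity>"
    unfolding nn_integral_completion p
    by (simp add: nn_integral_cmult_indicator emeasure_lborel_cbox_eq)
  ultimately show False by simp
qed

section \<open>The cycle of implications\<close>

lemma TFAE_6I:
  assumes "A1 \<Longrightarrow> A6" "A6 \<Longrightarrow> A2" "A2 \<Longrightarrow> A3" "A3 \<Longrightarrow> A4" "A4 \<Longrightarrow> A5" "A5 \<Longrightarrow> A1"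
  shows "TFAE [A1, A2, A3, A4, A5, A6]"
proof -
  have "A1 = A2" "A3 = A2" "A4 = A2" "A5 = A2" "A6 = A2" using assms by blast+
  then show ?thesis by (simp add: TFAE_def)
qed

text \<open>The constants of \<open>john_nirenberg_bmo_content\<close>. Positivity is asked for at
  every real argument, so \<open>jn_factor\<close> and \<open>jn_rate\<close> default to 1 unless
  \<beta> > 0.\<close>

definition jn_factor :: "nat \<Rightarrow> real \<Rightarrow> real" where
  "jn_factor n \<beta> = (if 0 < \<beta> then 3 * unit_ball_vol \<beta> * n powr \<beta> else 1)"

definition jn_rate :: "real \<Rightarrow> real" where
  "jn_rate \<beta> = (if 0 < \<beta> then ln 2 * unit_ball_vol \<beta> / (32 * 120 powr \<beta>) else 1)"

theorem theorem1p7: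
  shows "\<exists>c\<^sub>1 c\<^sub>2 :: real \<Rightarrow> real. (\<forall>\<beta>. 0 < c\<^sub>1 \<beta> \<and> 0 < c\<^sub>2 \<beta>) \<and>
    (\<forall>(\<alpha>::real) (f :: real ^ 'n \<Rightarrow> real).
      0 < \<alpha> \<longrightarrow> \<alpha> < real CARD('n) \<longrightarrow>
      f \<in> borel_measurable lebesgue \<longrightarrow> (\<forall>x. 0 \<le> f x) \<longrightarrow>
      TFAE [
        riesz_potential \<alpha> f \<in> BMO,

        \<forall>\<beta>\<in>{real CARD('n) - \<alpha> <.. real CARD('n)}. riesz_potential \<alpha> f \<in> BMO_content \<beta>,

        \<forall>\<beta>\<in>{real CARD('n) - \<alpha> <.. real CARD('n)}.
          bmo_content_norm \<beta> (riesz_potential \<alpha> f) < \<infinity> \<and>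
          (\<forall>a. \<forall>l>0. \<exists>c. \<forall>t>0.
             hausdorff_content \<beta> {x \<in> cube a l. dev (riesz_potential \<alpha> f) c x > ennreal t}
             \<le> (if bmo_content_norm \<beta> (riesz_potential \<alpha> f) = 0 then 0
                else ennreal (c\<^sub>1 \<beta> * l powr \<beta> *
                  exp (- c\<^sub>2 \<beta> * t / enn2real (bmo_content_norm \<beta> (riesz_potential \<alpha> f)))))),

        \<forall>\<beta>\<in>{real CARD('n) - \<alpha> <.. real CARD('n)}.
          \<exists>\<gamma>>0. \<exists>C>0. \<forall>a. \<forall>l>0. \<exists>c.
            choquet \<beta> (cube a l)
              (\<lambda>x. exp_ennreal (ennreal \<gamma> * dev (riesz_potential \<alpha> f) c x))
            \<le> ennreal (C * l powr \<beta>),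

        \<forall>\<beta>\<in>{real CARD('n) - \<alpha> <.. real CARD('n)}. \<forall>p\<ge>1.
          bmo_content_p_norm \<beta> p (riesz_potential \<alpha> f) < \<infinity>,

        f \<in> morrey \<alpha> \<and> riesz_potential \<alpha> f \<in> L1loc_lebesgue])"
proof (rule exI[of _ "jn_factor CARD('n)"], rule exI[of _ jn_rate], intro conjI allI impI, goal_cases)
  case (3 \<alpha> f)
  then have \<alpha>: "0 < \<alpha>" "\<alpha> < real CARD('n)" and f: "f \<in> borel_measurable lebesgue" "\<forall>x. 0 \<le> f x"
    by auto
  have dim: "DIM(real ^ 'n) = CARD('n)" by simp
  define s where "s = real CARD('n) - \<alpha>"
  have s: "0 < s" "s < real CARD('n)" using \<alpha> by (auto simp: s_def)
  define \<kappa> where "\<kappa> = 1 / riesz_const CARD('n) \<alpha>"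
  have \<kappa>: "0 < \<kappa>" using riesz_const_pos[OF \<alpha>] by (simp add: \<kappa>_def)
  obtain \<mu> :: "(real ^ 'n) measure" where \<mu>: "sets \<mu> = sets borel" and sf: "sigma_finite_measure \<mu>"
    and atom: "\<And>x. emeasure \<mu> {x} = 0"
    and pot: "riesz_potential \<alpha> f = (\<lambda>x. enn2ereal (trunc_pot s 0 \<mu> x))"
    and cubes: "\<And>a l. emeasure \<mu> (cube a l) = ennreal \<kappa> * (\<integral>\<^sup>+ y\<in>cube a l. ennreal \<bar>f y\<bar> \<partial>lebesgue)"
    by (rule riesz_potential_measure[of \<alpha> f, unfolded dim, folded s_def \<kappa>_def, OF \<alpha> f(1) spec[OF f(2)]])
       (rule that, assumption+)
  define u where "u = riesz_potential \<alpha> f"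
  have u: "u = (\<lambda>x. enn2ereal (trunc_pot s 0 \<mu> x))" by (simp add: u_def pot)
  have u_meas: "u \<in> borel_measurable borel"
    unfolding u using measurable_pot[OF \<mu> sf, of s] by measurable
  have morrey: "f \<in> morrey \<alpha> \<longleftrightarrow> (\<exists>M>0. \<forall>x r. 0 < r \<longrightarrow> emeasure \<mu> (ball x r) \<le> ennreal (M * r powr s))"
    unfolding s_def using morrey_iff_growth[OF \<kappa> \<mu> f(1) _ cubes, of \<alpha>] \<alpha> by simp
  let ?I = "{real CARD('n) - \<alpha> <.. real CARD('n)}"
  have I: "0 < \<beta>" "s < \<beta>" "\<beta> \<le> real DIM(real ^ 'n)" if "\<beta> \<in> ?I" for \<beta>
    using that \<alpha> by (auto simp: s_def)
  \<comment> \<open>\<beta> = n is admissible because \<alpha> > 0. At this exponent the content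
    dominates Lebesgue measure, which closes the cycle from (v) back to (i).\<close>
  have top_I: "real CARD('n) \<in> ?I" using \<alpha> by auto
  show ?case
    unfolding u_def[symmetric]
  proof (rule TFAE_6I, goal_cases)
    case 1
    then have "(\<lambda>x. enn2ereal (trunc_pot s 0 \<mu> x)) \<in> BMO" by (simp add: u)
    then obtain M where "0 < M" "\<And>x r. 0 < r \<Longrightarrow> emeasure \<mu> (ball x r) \<le> ennreal (M * r powr s)"
      by (rule growth_of_BMO[OF \<mu> sf s(1), rotated]) (use s in auto)
    then show ?case using 1 unfolding morrey by (auto simp: BMO_def)
  next
    case 2
    then obtain M where M: "0 < M" "\<And>x r. 0 < r \<Longrightarrow> emeasure \<mu> (ball x r) \<le> ennreal (M * r powr s)"
      using morrey by blast
    obtain x0 where fin: "trunc_pot s 0 \<mu> x0 < \<infinity>"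
      using L1loc_lebesgue_finite_point 2 unfolding u by blast
    have bnd: "emeasure \<mu> (ball x r) < \<infinity>" for x r
    proof (cases "0 < r")
      case True
      then show ?thesis using M(2)[OF True, of x] by (simp add: order_le_less_trans)
    qed (simp add: ball_empty)
    show ?case
    proof
      fix \<beta> assume \<beta>: "\<beta> \<in> ?I"
      have decay: "exp_osc_decay \<beta> u"
        unfolding u by (rule exp_osc_decay_of_growth[OF \<mu> atom s(1) I(2,3)[OF \<beta>] M fin])
      have "quasicontinuous_on \<beta> (cube a l) u" for a l
        unfolding u by (rule quasicontinuous_pot[OF \<mu> atom _ I(2)[OF \<beta>] fin bnd])
          (use s in \<open>auto simp: cube_def\<close>)
      then have "u \<in> L1loc_content \<beta>"
        using choquet_abs_finite[OF I(1)[OF \<beta>] decay] by (simp add: L1loc_content_def L1_content_def)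
      moreover have "bmo_content_norm \<beta> u < \<infinity>"
        using bmo_content_p_norm_finite[of 1, OF _ decay] by (simp add: bmo_content_p_norm_one)
      ultimately show "u \<in> BMO_content \<beta>" by (simp add: BMO_content_def)
    qed
  next
    case 3
    show ?case
    proof (intro ballI conjI allI impI)
      fix \<beta> assume \<beta>: "\<beta> \<in> ?I"
      then show fin: "bmo_content_norm \<beta> u < \<infinity>" using 3 by (auto simp: BMO_content_def)
      fix a :: "real ^ 'n" and l :: real assume l: "0 < l"
      show "\<exists>c. \<forall>t>0. hausdorff_content \<beta> {x \<in> cube a l. dev u c x > ennreal t}
         \<le> (if bmo_content_norm \<beta> u = 0 then 0
            else ennreal (jn_factor CARD('n) \<beta> * l powr \<beta> * exp (- jn_rate \<beta> * t / enn2real (bmo_content_norm \<beta> u))))"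
      proof -
        have "jn_factor CARD('n) \<beta> = 3 * unit_ball_vol \<beta> * CARD('n) powr \<beta>"
          "jn_rate \<beta> = ln 2 * unit_ball_vol \<beta> / (32 * 120 powr \<beta>)"
          using I(1)[OF \<beta>] by (simp_all add: jn_factor_def jn_rate_def)
        then show ?thesis
          using john_nirenberg_bmo_content[OF I(1,3)[OF \<beta>] l fin, of a] by (simp only: dim)
      qed
    qed
  next
    case 4
    show ?case
    proof
      fix \<beta> assume \<beta>: "\<beta> \<in> ?I"
      have "exp_osc_decay \<beta> u"
        by (rule exp_osc_decay_of_john_nirenberg[of "jn_factor CARD('n) \<beta>" "jn_rate \<beta>"])
          (use 4 \<beta> in \<open>auto simp: jn_factor_def jn_rate_def\<close>)
      then show "\<exists>\<gamma>>0. \<exists>C>0. \<forall>a. \<forall>l>0. \<exists>c. choquet \<beta> (cube a l) (\<lambda>x. exp_ennreal (ennreal \<gamma> * dev u c x))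
            \<le> ennreal (C * l powr \<beta>)"
        by (rule exp_integral_of_exp_osc_decay[OF I(1)[OF \<beta>]])
    qed
  next
    case 5
    show ?case
    proof (intro ballI allI impI)
      fix \<beta> p :: real assume \<beta>: "\<beta> \<in> ?I" and p: "1 \<le> p"
      have "exp_osc_decay \<beta> u" using 5 \<beta> exp_osc_decay_of_exp_integral by blast
      then show "bmo_content_p_norm \<beta> p u < \<infinity>" by (rule bmo_content_p_norm_finite[OF p])
    qed
  next
    case 6
    then have "bmo_content_p_norm (real CARD('n)) 1 u < \<infinity>" using top_I by blast
    then show ?case by (intro BMO_of_bmo_content_norm u_meas) (simp add: bmo_content_p_norm_one)
  qed
qed (auto simp: jn_factor_def jn_rate_def)

end
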